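(* Let $n\in\mathbb{Z}_{>0}$ and let $\mu,\pi$ be partitions of $n$. Then $$\sum_{\nu\vdash n}\ \sum_{w\in S_n}q^{n(\mu)}\,a_{\mu\nu}(t,q^{-1})\,q^{n-\ell(\nu)}\,\kappa_{\nu,w}\,C_{w,\pi}\,\frac{1}{[\pi]!}=b_{\mu\pi}(t,q).$$
   Context: Partitions: for $\lambda=(\lambda_1\ge\cdots\ge\lambda_\ell>0)$, $\ell(\lambda)=\ell$ and $n(\lambda)=\sum_{i}(i-1)\lambda_i$. Symmetric functions are in infinitely many variables $x=(x_1,x_2,\dots)$ with coefficients in $\mathbb{Q}(q,t)$; $m_\nu$ are the monomial symmetric functions, $s_\lambda$ the Schur functions. Integral form Macdonald polynomials: $J_\mu(x;q,t)=\Big(\prod_{s\in\mu}(1-q^{a(s)}t^{l(s)+1})\Big)P_\mu(x;q,t)$, where $a(s),l(s)$ are the arm and leg lengths of the box $s$ of $\mu$ and $P_\mu(x;q,t)$ are the Macdonald symmetric functions (characterized by $P_\mu\in m_\mu+\sum_{\nu<\mu}\mathbb{Q}(q,t)m_\nu$ in dominance order and orthogonality with respect to $\langle p_\lambda,p_\mu\rangle_{q,t}=\delta_{\lambda\mu}z_\lambda\prod_i\frac{1-q^{\lambda_i}}{1-t^{\lambda_i}}$). Define $a_{\mu\nu}(q,t)$ by $$J_\mu(x;q,t)=\sum_\nu a_{\mu\nu}(q,t)(1-t)^{\ell(\nu)}m_\nu .$$ Big Schur functions: $S_\lambda(x;t)=\det(q_{\lambda_i-i+j}(x;t))_{i,j}$,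 where $\sum_{r\ge0}q_r(x;t)y^r=\prod_i\frac{1-tx_iy}{1-x_iy}$ and $q_r=0$ for $r<0$. Define $K_{\lambda\mu}(q,t)$ by $J_\mu(x;q,t)=\sum_\lambda K_{\lambda\mu}(q,t)S_\lambda(x;t)$. Modified Macdonald polynomials and $b_{\mu\pi}(q,t)$: $$\widetilde H_\mu[X;q,t]=\sum_\lambda t^{n(\mu)}K_{\lambda\mu}(q,t^{-1})s_\lambda=\sum_\pi b_{\mu\pi}(q,t)m_\pi .$$ Thus $a_{\mu\nu}(t,q^{-1})$ and $b_{\mu\pi}(t,q)$ are obtained from $a_{\mu\nu}(q,t)$, $b_{\mu\pi}(q,t)$ by substituting $(q,t)\mapsto(t,q^{-1})$ and $(q,t)\mapsto(t,q)$ respectively; the claimed identity is an identity of rational functions in $q,t$. Expansion matrix: conjugacy classes $\mathcal{W}_\mu$ of $W=S_n$ are indexed by partitions $\mu$ of $n$ (cycle type); $s_i$ are the adjacent transpositions and $\ell(w)$ the length (number of inversions) of $w\in S_n$. The numbers $\kappa_{\nu,w}$ ($\nu\vdash n$, $w\in S_n$), polynomials in $q$, are determined by: (a) $\kappa_{\nu,\gamma_\mu}=\delta_{\mu\nu}$ if $\gamma_\mu$ is a minimal length element of $\mathcal{W}_\mu$; (b) $\kappa_{\nu,s_iw}=\kappa_{\nu,ws_i}$ if $\ell(s_iw)=\ell(ws_i)$ and $\ell(s_iw)=\ell(w)+1$; (c) $\kappa_{\nu,s_iws_i}=q\kappa_{\nu,w}+(q-1)\kappa_{\nu,ws_i}$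 if $\ell(s_iws_i)=\ell(w)+2$. (Equivalently, $\kappa_\nu=\sum_w\kappa_{\nu,w}q^{-\ell(w)}T_{w^{-1}}$ is the Geck–Rouquier basis of the center of the Iwahori–Hecke algebra of $S_n$ with parameter $q$, where $T_{s_i}^2=(q-1)T_{s_i}+q$.) Contraction matrix: $C_{w,\pi}=1$ if $w\in W_\pi$ and $C_{w,\pi}=0$ if $w\notin W_\pi$, where $W_\pi=S_{\pi_1}\times\cdots\times S_{\pi_\ell}\subseteq S_n$ is the Young subgroup for $\pi=(\pi_1,\ldots,\pi_\ell)$ (permuting consecutive blocks of sizes $\pi_1,\dots,\pi_\ell$). $[k]=1+q+\cdots+q^{k-1}$, $[k]!=[k][k-1]\cdots[1]$, $[\pi]!=[\pi_1]!\cdots[\pi_\ell]!$. *)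

theory Defs
  imports
    "HOL-Library.Multiset"
    "HOL-Computational_Algebra.Computational_Algebra"
    "HOL-Computational_Algebra.Field_as_Ring"
    "HOL-Combinatorics.Combinatorics"
    "Jordan_Normal_Form.Determinant"
begin

section \<open>Partitions\<close>

definition is_partition :: "nat list \<Rightarrow> bool" where
  "is_partition \<mu> \<longleftrightarrow> sorted_wrt (\<ge>) \<mu> \<and> (\<forall>k\<in>set \<mu>. 0 < k)"

definition partitions_of :: "nat \<Rightarrow> nat list set" where
  "partitions_of n = {\<mu>. is_partition \<mu> \<and> sum_list \<mu> = n}"

definition dominates :: "nat list \<Rightarrow> nat list \<Rightarrow> bool" where
  "dominates \<mu> \<nu> \<longleftrightarrow> sum_list \<mu> = sum_list \<nu> \<and> (\<forall>k. sum_list (take k \<nu>) \<le> sum_list (take k \<mu>))"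

text \<open>List positions start at 0, so the factor \<open>i\<close> here is the usual \<open>i - 1\<close>.\<close>

definition n_stat :: "nat list \<Rightarrow> nat" where
  "n_stat \<mu> = (\<Sum>i<length \<mu>. i * \<mu> ! i)"

text \<open>Boxes are pairs (row, column), both counted from 0.\<close>

definition boxes :: "nat list \<Rightarrow> (nat \<times> nat) set" where
  "boxes \<mu> = {(i, j). i < length \<mu> \<and> j < \<mu> ! i}"

definition arm :: "nat list \<Rightarrow> nat \<times> nat \<Rightarrow> nat" where
  "arm \<mu> = (\<lambda>(i, j). card {j'. j < j' \<and> (i, j') \<in> boxes \<mu>})"

definition leg :: "nat list \<Rightarrow> nat \<times> nat \<Rightarrow> nat" where
  "leg \<mu> = (\<lambda>(i, j). card {i'. i < i' \<and> (i', j) \<in> boxes \<mu>})"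

definition z_part :: "nat list \<Rightarrow> nat" where
  "z_part \<alpha> = (\<Prod>i\<in>set \<alpha>. i ^ count_list \<alpha> i * fact (count_list \<alpha> i))"

section \<open>The field of rational functions in q and t\<close>

text \<open>In \<open>rat poly poly\<close> the inner variable is \<open>q\<close> and the outer variable is \<open>t\<close>.\<close>

type_synonym ratfun = "rat poly poly fract"

definition q_var :: ratfun where "q_var = to_fract [:[:0, 1:]:]"
definition t_var :: ratfun where "t_var = to_fract [:0, 1:]"

definition eval_qt :: "ratfun \<Rightarrow> ratfun \<Rightarrow> rat poly poly \<Rightarrow> ratfun" where
  "eval_qt u v g = poly (map_poly (\<lambda>c. poly (map_poly (\<lambda>r. to_fract [:[:r:]:]) c) u) g) v"

text \<open>\<open>subst_qt u v f\<close> is \<open>f(u, v)\<close>, computed from the representation of \<open>f\<close> in lowest terms.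
  It is meaningful when the denominator does not vanish at \<open>(u, v)\<close>, which is always the case
  when \<open>u\<close> and \<open>v\<close> are algebraically independent.\<close>

definition subst_qt :: "ratfun \<Rightarrow> ratfun \<Rightarrow> ratfun \<Rightarrow> ratfun" where
  "subst_qt u v f = (let (a, b) = quot_of_fract f in eval_qt u v a / eval_qt u v b)"

section \<open>Formal series in countably many variables\<close>

text \<open>A multiset \<open>M\<close> of naturals stands for the monomial in which the variable with index \<open>i\<close>
  has exponent \<open>count M i\<close>; a formal series is its family of coefficients.\<close>

typedef 'a xseries = "UNIV :: (nat multiset \<Rightarrow> 'a) set"
  morphisms xcoeff Xseries ..

setup_lifting type_definition_xseries

lemma xseries_eqI: "(\<And>M. xcoeff f M = xcoeff g M) \<Longrightarrow> f = g"
  by (metis ext xcoeff_inject)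

lemma finite_submultisets: "finite {A. A \<subseteq># (M :: 'b multiset)}"
proof (induction M)
  case empty
  have "{A. A \<subseteq># {#}} = {{#} :: 'b multiset}" by auto
  then show ?case by simp
next
  case (add x M)
  have "{A. A \<subseteq># add_mset x M} \<subseteq> {A. A \<subseteq># M} \<union> add_mset x ` {A. A \<subseteq># M}"
  proof
    fix A assume "A \<in> {A. A \<subseteq># add_mset x M}"
    then have A: "A \<subseteq># add_mset x M" by simp
    show "A \<in> {A. A \<subseteq># M} \<union> add_mset x ` {A. A \<subseteq># M}"
    proof (cases "x \<in># A")
      case True
      then obtain B where B: "A = add_mset x B" by (meson mset_add)
      then show ?thesis using A by auto
    next
      case False
      then have "A \<subseteq># M"
        using A by (metis add_mset_remove_trivial diff_single_trivial diff_subset_eq_self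
          subset_mset.order_trans subset_eq_diff_conv add_mset_add_single)
      then show ?thesis by simp
    qed
  qed
  then show ?case using add.IH by (meson finite_UnI finite_imageI finite_subset)
qed

lemma sum_submultisets_swap:
  fixes F :: "nat multiset \<Rightarrow> nat multiset \<Rightarrow> nat multiset \<Rightarrow> 'a::comm_monoid_add"
  shows "(\<Sum>A | A \<subseteq># M. \<Sum>B | B \<subseteq># A. F B (A - B) (M - A))
       = (\<Sum>B | B \<subseteq># M. \<Sum>C | C \<subseteq># M - B. F B C (M - B - C))"
proof -
  have "(\<Sum>A | A \<subseteq># M. \<Sum>B | B \<subseteq># A. F B (A - B) (M - A))
      = (\<Sum>(A, B)\<in>Sigma {A. A \<subseteq># M} (\<lambda>A. {B. B \<subseteq># A}). F B (A - B) (M - A))"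
    by (intro sum.Sigma) (auto simp: finite_submultisets)
  also have "\<dots> = (\<Sum>(B, C)\<in>Sigma {B. B \<subseteq># M} (\<lambda>B. {C. C \<subseteq># M - B}). F B C (M - B - C))"
  proof (rule sum.reindex_bij_witness[where i = "\<lambda>(B, C). (B + C, B)" and j = "\<lambda>(A, B). (B, A - B)"])
    fix p assume "p \<in> Sigma {A. A \<subseteq># M} (\<lambda>A. {B. B \<subseteq># A})"
    then obtain A B where p: "p = (A, B)" "A \<subseteq># M" "B \<subseteq># A" by auto
    show "(case case p of (A, B) \<Rightarrow> (B, A - B) of (B, C) \<Rightarrow> (B + C, B)) = p"
      using p by simp
    show "(case p of (A, B) \<Rightarrow> (B, A - B)) \<in> Sigma {B. B \<subseteq># M} (\<lambda>B. {C. C \<subseteq># M - B})"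
      using p by (auto simp: subseteq_mset_def diff_le_mono intro: order_trans)
    show "(case case p of (A, B) \<Rightarrow> (B, A - B) of (B, C) \<Rightarrow> F B C (M - B - C))
        = (case p of (A, B) \<Rightarrow> F B (A - B) (M - A))"
      using p by simp
  next
    fix p assume "p \<in> Sigma {B. B \<subseteq># M} (\<lambda>B. {C. C \<subseteq># M - B})"
    then obtain B C where p: "p = (B, C)" "B \<subseteq># M" "C \<subseteq># M - B" by auto
    show "(case case p of (B, C) \<Rightarrow> (B + C, B) of (A, B) \<Rightarrow> (B, A - B)) = p"
      using p by simp
    have "B + C \<subseteq># M"
      using p by (metis subset_mset.add_diff_inverse subset_mset.add_left_mono)
    then show "(case p of (B, C) \<Rightarrow> (B + C, B)) \<in> Sigma {A. A \<subseteq># M} (\<lambda>A. {B. B \<subseteq># A})"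
      using p by simp
  qed
  also have "\<dots> = (\<Sum>B | B \<subseteq># M. \<Sum>C | C \<subseteq># M - B. F B C (M - B - C))"
    by (intro sum.Sigma[symmetric]) (auto simp: finite_submultisets)
  finally show ?thesis .
qed

instantiation xseries :: (comm_ring_1) comm_ring_1
begin

lift_definition zero_xseries :: "'a xseries" is "\<lambda>_. 0" .
lift_definition one_xseries :: "'a xseries" is "\<lambda>M. if M = {#} then 1 else 0" .
lift_definition plus_xseries :: "'a xseries \<Rightarrow> 'a xseries \<Rightarrow> 'a xseries" is "\<lambda>f g M. f M + g M" .
lift_definition minus_xseries :: "'a xseries \<Rightarrow> 'a xseries \<Rightarrow> 'a xseries" is "\<lambda>f g M. f M - g M" .
lift_definition uminus_xseries :: "'a xseries \<Rightarrow> 'a xseries" is "\<lambda>f M. - f M" .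
lift_definition times_xseries :: "'a xseries \<Rightarrow> 'a xseries \<Rightarrow> 'a xseries"
  is "\<lambda>f g M. \<Sum>A | A \<subseteq># M. f A * g (M - A)" .

instance
proof
  fix a b c :: "'a xseries"
  show "a * b * c = a * (b * c)"
  proof (rule xseries_eqI)
    fix M
    have "xcoeff (a * b * c) M
        = (\<Sum>A | A \<subseteq># M. \<Sum>B | B \<subseteq># A. xcoeff a B * xcoeff b (A - B) * xcoeff c (M - A))"
      by (simp add: times_xseries.rep_eq sum_distrib_right)
    also have "\<dots> = (\<Sum>B | B \<subseteq># M. \<Sum>C | C \<subseteq># M - B.
        xcoeff a B * xcoeff b C * xcoeff c (M - B - C))"
      by (rule sum_submultisets_swap)
    also have "\<dots> = xcoeff (a * (b * c)) M"
      by (simp add: times_xseries.rep_eq sum_distrib_left mult.assoc)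
    finally show "xcoeff (a * b * c) M = xcoeff (a * (b * c)) M" .
  qed
  have diff_diff: "M - (M - A) = A" if "A \<subseteq># M" for A M :: "nat multiset"
    using that by (simp add: multiset_eq_iff subseteq_mset_def)
  show "a * b = b * a"
  proof (rule xseries_eqI)
    fix M
    show "xcoeff (a * b) M = xcoeff (b * a) M"
      unfolding times_xseries.rep_eq
      by (rule sum.reindex_bij_witness[where i = "\<lambda>A. M - A" and j = "\<lambda>A. M - A"])
        (auto simp: diff_diff mult.commute)
  qed
  show "1 * a = a"
  proof (rule xseries_eqI)
    fix M
    have "xcoeff (1 * a) M = (\<Sum>A | A \<subseteq># M. if A = {#} then xcoeff a M else 0)"
      unfolding times_xseries.rep_eq one_xseries.rep_eq by (rule sum.cong) auto
    also have "\<dots> = xcoeff a M"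
      by (simp add: sum.delta finite_submultisets)
    finally show "xcoeff (1 * a) M = xcoeff a M" .
  qed
  show "(a + b) * c = a * c + b * c"
    by (rule xseries_eqI)
      (simp add: times_xseries.rep_eq plus_xseries.rep_eq distrib_right sum.distrib)
  show "(0 :: 'a xseries) \<noteq> 1"
    by (metis one_xseries.rep_eq zero_xseries.rep_eq zero_neq_one)
qed (rule xseries_eqI; simp add: plus_xseries.rep_eq zero_xseries.rep_eq minus_xseries.rep_eq
      uminus_xseries.rep_eq algebra_simps)+

end

lift_definition xscale :: "'a::comm_ring_1 \<Rightarrow> 'a xseries \<Rightarrow> 'a xseries" is "\<lambda>c f M. c * f M" .

global_interpretation xser: vector_space "xscale :: 'a::field \<Rightarrow> _"
  by standard (rule xseries_eqI; simp add: xscale.rep_eq plus_xseries.rep_eq algebra_simps)+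

section \<open>Symmetric functions\<close>

definition mono_sym :: "nat list \<Rightarrow> ratfun xseries" where
  "mono_sym \<nu> = Xseries (\<lambda>M. of_bool (image_mset (count M) (mset_set (set_mset M)) = mset \<nu>))"

definition power_sum :: "nat \<Rightarrow> ratfun xseries" where
  "power_sum r = Xseries (\<lambda>M. of_bool (\<exists>i. M = replicate_mset r i))"

definition power_sym :: "nat list \<Rightarrow> ratfun xseries" where
  "power_sym \<alpha> = prod_list (map power_sum \<alpha>)"

text \<open>For a one-variable series \<open>F\<close> with constant coefficient 1, \<open>prod_coeff F r\<close> is the
  coefficient of \<open>y ^ r\<close> in the infinite product of all \<open>F (x\<^sub>i y)\<close>: the monomial \<open>M\<close> arises only by
  picking the term of degree \<open>count M i\<close> from the factor with index \<open>i\<close>, for each \<open>i\<close>.\<close>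

definition prod_coeff :: "ratfun fps \<Rightarrow> int \<Rightarrow> ratfun xseries" where
  "prod_coeff F r = Xseries (\<lambda>M. if int (size M) = r
     then (\<Prod>i\<in>set_mset M. fps_nth F (count M i)) else 0)"

definition complete_sym :: "int \<Rightarrow> ratfun xseries" where
  "complete_sym = prod_coeff (1 / (1 - fps_X))"

definition q_sym :: "int \<Rightarrow> ratfun xseries" where
  "q_sym = prod_coeff ((1 - fps_const t_var * fps_X) / (1 - fps_X))"

text \<open>Schur functions by the Jacobi-Trudi determinant, of which the big Schur
  function is the \<open>t\<close>-analogue.\<close>

definition schur :: "nat list \<Rightarrow> ratfun xseries" where
  "schur \<alpha> = det (mat (length \<alpha>) (length \<alpha>)
     (\<lambda>(i, j). complete_sym (int (\<alpha> ! i) - int i + int j)))"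

definition big_schur :: "nat list \<Rightarrow> ratfun xseries" where
  "big_schur \<alpha> = det (mat (length \<alpha>) (length \<alpha>)
     (\<lambda>(i, j). q_sym (int (\<alpha> ! i) - int i + int j)))"

text \<open>\<open>coord B f \<alpha>\<close> is the coefficient of \<open>B \<alpha>\<close> in the expansion of \<open>f\<close> in the basis formed by
  the \<open>B \<alpha>\<close>, with \<open>\<alpha>\<close> running over all partitions.\<close>

definition coord :: "(nat list \<Rightarrow> ratfun xseries) \<Rightarrow> ratfun xseries \<Rightarrow> nat list \<Rightarrow> ratfun" where
  "coord B f \<alpha> = xser.representation (B ` Collect is_partition) f (B \<alpha>)"

section \<open>Macdonald polynomials\<close>

definition qt_inner :: "ratfun xseries \<Rightarrow> ratfun xseries \<Rightarrow> ratfun" where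
  "qt_inner f g = (\<Sum>\<alpha> | is_partition \<alpha> \<and> coord power_sym f \<alpha> \<noteq> 0.
     coord power_sym f \<alpha> * coord power_sym g \<alpha> *
     (of_nat (z_part \<alpha>) * (\<Prod>k\<leftarrow>\<alpha>. (1 - q_var ^ k) / (1 - t_var ^ k))))"

text \<open>\<open>P \<mu>\<close> equals \<open>mono_sym \<mu>\<close> plus a combination of the \<open>mono_sym \<nu>\<close> with \<open>\<nu>\<close> strictly below \<open>\<mu>\<close> in
  dominance order, and the \<open>P \<mu>\<close> are pairwise orthogonal. Exactly one family has
  these properties on partitions (values at other lists are irrelevant).\<close>

definition is_macdonald_P :: "(nat list \<Rightarrow> ratfun xseries) \<Rightarrow> bool" where
  "is_macdonald_P P \<longleftrightarrow>
     (\<forall>\<mu>. is_partition \<mu> \<longrightarrow>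
        P \<mu> - mono_sym \<mu> \<in> xser.span (mono_sym ` {\<nu>. is_partition \<nu> \<and> dominates \<mu> \<nu> \<and> \<nu> \<noteq> \<mu>})) \<and>
     (\<forall>\<alpha> \<mu>. is_partition \<alpha> \<longrightarrow> is_partition \<mu> \<longrightarrow> \<alpha> \<noteq> \<mu> \<longrightarrow> qt_inner (P \<alpha>) (P \<mu>) = 0)"

definition macdonald_J :: "(nat list \<Rightarrow> ratfun xseries) \<Rightarrow> nat list \<Rightarrow> ratfun xseries" where
  "macdonald_J P \<mu> =
     xscale (\<Prod>s\<in>boxes \<mu>. 1 - q_var ^ arm \<mu> s * t_var ^ (leg \<mu> s + 1)) (P \<mu>)"

definition a_coeff :: "(nat list \<Rightarrow> ratfun xseries) \<Rightarrow> nat list \<Rightarrow> nat list \<Rightarrow> ratfun" where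
  "a_coeff P \<mu> = coord (\<lambda>\<nu>. xscale ((1 - t_var) ^ length \<nu>) (mono_sym \<nu>)) (macdonald_J P \<mu>)"

definition K_coeff :: "(nat list \<Rightarrow> ratfun xseries) \<Rightarrow> nat list \<Rightarrow> nat list \<Rightarrow> ratfun" where
  "K_coeff P \<alpha> \<mu> = coord big_schur (macdonald_J P \<mu>) \<alpha>"

definition macdonald_H :: "(nat list \<Rightarrow> ratfun xseries) \<Rightarrow> nat list \<Rightarrow> ratfun xseries" where
  "macdonald_H P \<mu> = (\<Sum>\<alpha>\<in>partitions_of (sum_list \<mu>).
     xscale (t_var ^ n_stat \<mu> * subst_qt q_var (inverse t_var) (K_coeff P \<alpha> \<mu>)) (schur \<alpha>))"

definition b_coeff :: "(nat list \<Rightarrow> ratfun xseries) \<Rightarrow> nat list \<Rightarrow> nat list \<Rightarrow> ratfun" where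
  "b_coeff P \<mu> = coord mono_sym (macdonald_H P \<mu>)"

section \<open>The symmetric group\<close>

text \<open>The group \<open>S\<^sub>n\<close> consists of the functions \<open>w\<close> with \<open>w permutes {1..n}\<close>; the product
  is composition.\<close>

definition conj_class :: "nat \<Rightarrow> nat list \<Rightarrow> (nat \<Rightarrow> nat) set" where
  "conj_class n \<mu> = {w. w permutes {1..n} \<and>
     image_mset card (mset_set (orbit w ` {1..n})) = mset \<mu>}"

definition perm_length :: "nat \<Rightarrow> (nat \<Rightarrow> nat) \<Rightarrow> nat" where
  "perm_length n w = card {(i, j). 1 \<le> i \<and> i < j \<and> j \<le> n \<and> w j < w i}"

definition adj_transp :: "nat \<Rightarrow> nat \<Rightarrow> nat" where
  "adj_transp i = transpose i (i + 1)"

definition min_length_elem :: "nat \<Rightarrow> nat list \<Rightarrow> (nat \<Rightarrow> nat) \<Rightarrow> bool" where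
  "min_length_elem n \<mu> w \<longleftrightarrow> w \<in> conj_class n \<mu> \<and>
     (\<forall>v\<in>conj_class n \<mu>. perm_length n w \<le> perm_length n v)"

text \<open>The Hecke parameter \<open>q\<close> is the indeterminate \<open>[:0, 1:]\<close> of \<open>rat poly\<close>.\<close>

definition is_expansion_matrix :: "nat \<Rightarrow> (nat list \<Rightarrow> (nat \<Rightarrow> nat) \<Rightarrow> rat poly) \<Rightarrow> bool" where
  "is_expansion_matrix n \<kappa> \<longleftrightarrow> (\<forall>\<nu>\<in>partitions_of n.
     (\<forall>\<mu>\<in>partitions_of n. \<forall>w. min_length_elem n \<mu> w \<longrightarrow> \<kappa> \<nu> w = (if \<mu> = \<nu> then 1 else 0)) \<and>
     (\<forall>w i. w permutes {1..n} \<longrightarrow> 1 \<le> i \<longrightarrow> i < n \<longrightarrow>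
        (let s = adj_transp i in
          (perm_length n (s \<circ> w) = perm_length n (w \<circ> s) \<and>
           perm_length n (s \<circ> w) = perm_length n w + 1 \<longrightarrow>
             \<kappa> \<nu> (s \<circ> w) = \<kappa> \<nu> (w \<circ> s)) \<and>
          (perm_length n (s \<circ> w \<circ> s) = perm_length n w + 2 \<longrightarrow>
             \<kappa> \<nu> (s \<circ> w \<circ> s) = [:0, 1:] * \<kappa> \<nu> w + ([:0, 1:] - 1) * \<kappa> \<nu> (w \<circ> s)))))"

definition young_subgroup :: "nat \<Rightarrow> nat list \<Rightarrow> (nat \<Rightarrow> nat) set" where
  "young_subgroup n \<pi> = {w. w permutes {1..n} \<and>
     (\<forall>k<length \<pi>. let B = {sum_list (take k \<pi>) <.. sum_list (take (k + 1) \<pi>)} in w ` B = B)}"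

definition contraction :: "nat \<Rightarrow> (nat \<Rightarrow> nat) \<Rightarrow> nat list \<Rightarrow> ratfun" where
  "contraction n w \<pi> = (if w \<in> young_subgroup n \<pi> then 1 else 0)"

definition q_int :: "nat \<Rightarrow> ratfun" where
  "q_int k = (\<Sum>i<k. q_var ^ i)"

definition q_fact :: "nat \<Rightarrow> ratfun" where
  "q_fact k = (\<Prod>i=1..k. q_int i)"

definition q_fact_part :: "nat list \<Rightarrow> ratfun" where
  "q_fact_part \<pi> = (\<Prod>k\<leftarrow>\<pi>. q_fact k)"

end

theory Submission
  imports Defs
begin

text \<open>Both sides are linear in \<open>J\<^sub>\<mu>\<close>, and the identity says that two linear functionals of \<open>J\<^sub>\<mu>\<close> agree.
They agree because both are computed by the same recursion, which removes one part of \<open>\<pi>\<close> at a time.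

The Hecke algebra side. Combine the \<open>\<kappa>\<^sub>\<nu>\<close> with their coefficients into one function \<open>f\<close> on
\<open>S\<^sub>n\<close>. The defining relations of the expansion matrix say that \<open>f\<close> is a trace on the Hecke algebra,
that is \<open>f(T\<^sub>s T\<^sub>w) = f(T\<^sub>w T\<^sub>s)\<close> (\<open>expansion_matrix_imp_hecke_trace\<close>), and they prescribe its value at the
Coxeter elements of Young subgroups, which have minimal length in their classes
(\<open>coxeter_min_length\<close>). The sum over the Young subgroup of \<open>\<pi>\<close> is the trace of a product of
symmetrizers, the sums of all \<open>T\<^sub>w\<close> over a symmetric group. Write the symmetrizer of \<open>S\<^sub>a\<close> as the one
of \<open>S\<^bsub>a-1\<^esub>\<close> times the sum of the coset representatives \<open>s\<^bsub>a-1\<^esub> \<dots> s\<^sub>j\<close>. The trace property moves the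
factors \<open>s\<^bsub>a-2\<^esub> \<dots> s\<^sub>j\<close> around to the symmetrizer of \<open>S\<^bsub>a-1\<^esub>\<close>, which absorbs each of them as a factor \<open>q\<close>.
Iterating this splits a Coxeter block of every size \<open>k\<close> off the symmetrizer
(\<open>young_sum_append_Suc\<close>): if \<open>\<Gamma>(\<rho>, c)\<close> is the normalized trace of the symmetrizers with sizes
\<open>\<rho>\<close> and Coxeter blocks with sizes \<open>c\<close>, then
\<open>[a] \<Gamma>(\<rho> a, c) = \<Sum>\<^sub>k \<Gamma>(\<rho> (a - k), k c)\<close> with \<open>k\<close> from 1 to \<open>a\<close>.

The symmetric function side. The coefficients \<open>K\<close> expand \<open>J\<^sub>\<mu>\<close> in big Schur functions, and the same
coefficients, after a substitution, expand the modified polynomial in Schur functions. The two families are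
the same Jacobi-Trudi determinant in the \<open>q\<^sub>r\<close> and in the complete functions \<open>h\<^sub>r\<close>. A coefficient
of a product of the \<open>q\<^sub>r\<close> counts contingency tables with weights, hence is symmetric in the row and
the column sums (\<open>prod_list_coeff_duality\<close>; this is the symmetry of the Cauchy kernel). So one
linear functional gives the coefficient of \<open>x\<^sup>c\<close> in \<open>J\<^sub>\<mu>\<close> at the product of the \<open>q\<^sub>k\<close> with \<open>k\<close> in
\<open>c\<close>, and the coefficient of \<open>x\<^sup>\<pi>\<close> in the Schur expansion at the product of the \<open>h\<^sub>k\<close> with \<open>k\<close> in
\<open>\<pi>\<close> (\<open>schur_functional_prod_list_coeff\<close>). The generating functions of \<open>h\<close> and \<open>q\<close> satisfy
\<open>H(y) = Q(y) H(ty)\<close>, that is \<open>(1 - t\<^sup>a) h\<^sub>a = \<Sum>\<^sub>k t\<^bsup>a-k\<^esup> h\<^bsub>a-k\<^esub> q\<^sub>k\<close> (\<open>h_recursion\<close>). After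
\<open>t \<mapsto> 1/q\<close> and scaling by \<open>q\<^bsup>|c|\<^esup> / (q - 1)\<^bsup>l(c)\<^esup>\<close> this is the recursion for \<open>\<Gamma>\<close>
(\<open>subst_mixed_sum_append_Suc\<close>), the initial values agree, and the recursion has only one
solution (\<open>block_recursion_unique\<close>).

Two points need preparation. The coefficients \<open>K\<close> are defined by a basis expansion, so the big Schur functions have
to be shown to be a basis (\<open>graded_basis_big_schur\<close>). And the substitutions in \<open>q\<close> and \<open>t\<close> have to be
shown to be field homomorphisms, which needs the algebraic independence of the substituted elements.\<close>

unbundle no m_inv_syntax

section \<open>Substitutions in rational functions\<close>

lemma to_fract_power: "to_fract (x ^ k) = to_fract x ^ k"
  by (induction k) auto

lemma comm_ring_homI:
  fixes h :: "'a::comm_ring_1 \<Rightarrow> 'b::comm_ring_1"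
  assumes "h 0 = 0" "h 1 = 1" "\<And>a b. h (a + b) = h a + h b" "\<And>a b. h (a * b) = h a * h b"
  shows "comm_ring_hom h"
  by unfold_locales (use assms in auto)

text \<open>Horner's rule; with it every later statement about evaluation is an induction on the polynomial.\<close>

lemma poly_map_poly_pCons:
  assumes "comm_ring_hom h"
  shows "poly (map_poly h (pCons a p)) x = h a + x * poly (map_poly h p) x"
proof -
  interpret comm_ring_hom h by fact
  show ?thesis by (simp add: map_poly_pCons)
qed

lemma comm_ring_hom_poly_map_poly:
  fixes h :: "'a::comm_ring_1 \<Rightarrow> 'b::comm_ring_1"
  assumes h: "comm_ring_hom h" shows "comm_ring_hom (\<lambda>p. poly (map_poly h p) x)"
proof -
  interpret h: comm_ring_hom h by fact
  let ?e = "\<lambda>p. poly (map_poly h p) x"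
  note e_pCons = poly_map_poly_pCons[OF h, of _ _ x]
  have add: "?e (p + r) = ?e p + ?e r" for p r
  proof (induction p r rule: poly_induct2)
    case (pCons a p b r)
    then show ?case by (simp only: add_pCons e_pCons h.hom_add) (simp add: algebra_simps)
  qed simp
  have smult: "?e (Polynomial.smult a p) = h a * ?e p" for a p
  proof (induction p)
    case (pCons b p)
    then show ?case by (simp only: smult_pCons e_pCons h.hom_mult) (simp add: algebra_simps)
  qed simp
  have mult: "?e (p * r) = ?e p * ?e r" for p r
  proof (induction p)
    case (pCons a p)
    then show ?case by (simp only: mult_pCons_left add smult e_pCons h.hom_zero) (simp add: algebra_simps)
  qed simp
  have "?e 1 = 1" unfolding one_pCons e_pCons by simp
  then show ?thesis by (intro comm_ring_homI) (simp_all add: add mult)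
qed

definition const_rat :: "rat \<Rightarrow> ratfun" where "const_rat r = to_fract [:[:r:]:]"

definition eval_q :: "ratfun \<Rightarrow> rat poly \<Rightarrow> ratfun" where "eval_q u c = poly (map_poly const_rat c) u"

lemma eval_qt_eval_q: "eval_qt u v g = poly (map_poly (eval_q u) g) v"
  by (simp only: eval_qt_def eval_q_def[abs_def] const_rat_def[abs_def])

lemma hom_const_rat: "comm_ring_hom const_rat"
  by (rule comm_ring_homI) (simp_all add: const_rat_def pCons_one flip: to_fract_add to_fract_mult)

lemma hom_eval_q: "comm_ring_hom (eval_q u)"
  unfolding eval_q_def[abs_def] by (rule comm_ring_hom_poly_map_poly[OF hom_const_rat])

lemma hom_eval_qt: "comm_ring_hom (eval_qt u v)"
  unfolding eval_qt_eval_q[abs_def] by (rule comm_ring_hom_poly_map_poly[OF hom_eval_q])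

lemma eval_q_pCons: "eval_q u (pCons a c) = const_rat a + u * eval_q u c"
  unfolding eval_q_def by (rule poly_map_poly_pCons[OF hom_const_rat])

lemma eval_q_0 [simp]: "eval_q u 0 = 0"
  by (simp add: eval_q_def)

lemma eval_qt_pCons: "eval_qt u v (pCons c g) = eval_q u c + v * eval_qt u v g"
  unfolding eval_qt_eval_q by (rule poly_map_poly_pCons[OF hom_eval_q])

lemma eval_qt_0 [simp]: "eval_qt u v 0 = 0"
  by (simp add: eval_qt_eval_q)

lemma const_rat_0 [simp]: "const_rat 0 = 0" and const_rat_1 [simp]: "const_rat 1 = 1"
  by (simp_all add: const_rat_def pCons_one)

lemma eval_qt_vars: "eval_qt u v [:[:0, 1:]:] = u" "eval_qt u v [:0, 1:] = v" "eval_qt u v [:[:r:]:] = const_rat r"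
  by (simp_all add: eval_qt_pCons eval_q_pCons one_pCons)

lemma const_poly_hom: "comm_ring_hom (\<lambda>c. to_fract [:c:] :: ratfun)"
  by (rule comm_ring_homI) (simp_all add: pCons_one flip: to_fract_add to_fract_mult)

lemma eval_q_q_var: "eval_q q_var c = to_fract [:c:]"
proof (induction c)
  case (pCons a c)
  have "[:pCons a c:] = [:[:a:]:] + [:[:0, 1:]:] * [:c:]" by simp
  then show ?case
    unfolding eval_q_pCons pCons.IH by (simp only: q_var_def const_rat_def to_fract_add to_fract_mult)
qed simp

lemma eval_qt_vars_id: "eval_qt q_var t_var g = to_fract g"
proof (induction g)
  case (pCons c g)
  have "pCons c g = [:c:] + [:0, 1:] * g" by simp
  then show ?case
    unfolding eval_qt_pCons pCons.IH eval_q_q_var by (simp only: t_var_def to_fract_add to_fract_mult)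
qed simp

lemma t_var_nonzero: "t_var \<noteq> 0" and q_var_nonzero: "q_var \<noteq> 0"
  by (simp_all add: t_var_def q_var_def)

text \<open>Evaluating at \<open>1/t\<close> instead of \<open>t\<close> reverses the list of coefficients, up to a power of \<open>t\<close>.\<close>

lemma eval_qt_q_inverse_t_nonzero:
  assumes "g \<noteq> 0" shows "eval_qt q_var (inverse t_var) g \<noteq> 0"
proof
  assume zero: "eval_qt q_var (inverse t_var) g = 0"
  have e0: "eval_q q_var c = 0 \<longleftrightarrow> c = 0" for c by (simp add: eval_q_q_var)
  let ?p = "map_poly (eval_q q_var) g"
  have deg: "degree ?p = degree g"
    by (rule degree_map_poly) (simp add: e0)
  have "reflect_poly ?p = map_poly (eval_q q_var) (reflect_poly g)"
    by (rule poly_eqI) (simp add: coeff_reflect_poly coeff_map_poly deg e0)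
  then have "to_fract (reflect_poly g) = poly (reflect_poly ?p) t_var"
    by (simp only: eval_qt_vars_id[symmetric] eval_qt_eval_q)
  also have "\<dots> = t_var ^ degree ?p * poly ?p (inverse t_var)"
    by (rule poly_reflect_poly_nz[OF t_var_nonzero])
  also have "\<dots> = 0" using zero by (simp add: eval_qt_eval_q)
  finally show False using assms by simp
qed

text \<open>The automorphism of the polynomial ring that exchanges its two variables.\<close>

definition swap_vars :: "rat poly poly \<Rightarrow> rat poly poly" where
  "swap_vars g = poly (map_poly (map_poly (\<lambda>r. [:r:])) g) [:[:0, 1:]:]"

lemma hom_map_poly_const: "comm_ring_hom (map_poly (\<lambda>r :: rat. [:r:]))"
proof -
  have c: "comm_ring_hom (\<lambda>r :: rat. [:r:])"
    by (rule comm_ring_homI) (simp_all add: pCons_one)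
  have c': "comm_ring_hom (\<lambda>r :: rat. [:[:r:]:])"
    by (rule comm_ring_homI) (simp_all add: pCons_one)
  have "poly (map_poly (\<lambda>r. [:[:r:]:]) p) [:0, 1:] = map_poly (\<lambda>r :: rat. [:r:]) p" for p
  proof (induction p)
    case (pCons a p)
    show ?case unfolding poly_map_poly_pCons[OF c'] pCons.IH by (simp add: map_poly_pCons)
  qed simp
  then show ?thesis using comm_ring_hom_poly_map_poly[OF c', of "[:0, 1:]"] by simp
qed

lemma hom_swap_vars: "comm_ring_hom swap_vars"
  unfolding swap_vars_def[abs_def] by (rule comm_ring_hom_poly_map_poly[OF hom_map_poly_const])

lemma swap_vars_pCons: "swap_vars (pCons c g) = map_poly (\<lambda>r. [:r:]) c + [:[:0, 1:]:] * swap_vars g"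
  unfolding swap_vars_def by (rule poly_map_poly_pCons[OF hom_map_poly_const])

lemma swap_vars_0 [simp]: "swap_vars 0 = 0"
  by (simp add: swap_vars_def)

lemma swap_vars_map_poly_const: "swap_vars (map_poly (\<lambda>r. [:r:]) c) = [:c:]"
proof (induction c)
  case (pCons a c)
  have "map_poly (\<lambda>r. [:r:]) (pCons a c) = pCons [:a:] (map_poly (\<lambda>r. [:r:]) c)"
    by (simp add: map_poly_pCons)
  then show ?case by (simp add: swap_vars_pCons pCons.IH map_poly_pCons)
qed simp

lemma swap_vars_involution: "swap_vars (swap_vars g) = g"
proof (induction g)
  case (pCons c g)
  interpret comm_ring_hom swap_vars by (rule hom_swap_vars)
  have "swap_vars [:[:0, 1:]:] = [:0, 1:]"
    by (simp add: swap_vars_pCons map_poly_pCons one_pCons)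
  then show ?case
    by (simp only: swap_vars_pCons hom_add hom_mult swap_vars_map_poly_const pCons.IH) simp
qed simp

lemma eval_q_t_var: "eval_q t_var c = to_fract (map_poly (\<lambda>r. [:r:]) c)"
proof (induction c)
  case (pCons a c)
  have "map_poly (\<lambda>r. [:r:]) (pCons a c) = [:[:a:]:] + [:0, 1:] * map_poly (\<lambda>r. [:r:]) c"
    by (simp add: map_poly_pCons)
  then show ?case
    unfolding eval_q_pCons pCons.IH by (simp only: t_var_def const_rat_def to_fract_add to_fract_mult)
qed simp

lemma eval_qt_t_q: "eval_qt t_var q_var g = to_fract (swap_vars g)"
proof (induction g)
  case (pCons c g)
  show ?case
    unfolding eval_qt_pCons pCons.IH eval_q_t_var swap_vars_pCons
    by (simp only: q_var_def to_fract_add to_fract_mult)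
qed simp

lemma eval_qt_t_q_nonzero:
  assumes "g \<noteq> 0" shows "eval_qt t_var q_var g \<noteq> 0"
proof
  assume "eval_qt t_var q_var g = 0"
  then have "swap_vars g = 0" by (simp add: eval_qt_t_q)
  then have "swap_vars (swap_vars g) = 0" by simp
  with assms show False by (simp add: swap_vars_involution)
qed

text \<open>Algebraic independence of \<open>u\<close> and \<open>v\<close> over the rationals.\<close>

definition independent_pair :: "ratfun \<Rightarrow> ratfun \<Rightarrow> bool" where
  "independent_pair u v \<longleftrightarrow> (\<forall>g. g \<noteq> 0 \<longrightarrow> eval_qt u v g \<noteq> 0)"

lemma fract_as_quotient: "\<exists>a b. b \<noteq> 0 \<and> f = to_fract a / to_fract b" for f :: ratfun
proof -
  have "quot_to_fract (quot_of_fract f) = f" by simp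
  then show ?thesis
    by (intro exI[of _ "fst (quot_of_fract f)"] exI[of _ "snd (quot_of_fract f)"])
      (simp add: quot_to_fract_def case_prod_beta Fract_conv_to_fract)
qed

text \<open>The substitution is defined from the representation in lowest terms; this frees it from the choice of the
representation.\<close>

lemma subst_qt_quotient:
  assumes uv: "independent_pair u v" and b: "b \<noteq> 0"
  shows "subst_qt u v (to_fract a / to_fract b) = eval_qt u v a / eval_qt u v b"
proof -
  interpret comm_ring_hom "eval_qt u v" by (rule hom_eval_qt)
  let ?f = "to_fract a / to_fract b"
  obtain c d where cd: "quot_of_fract ?f = (c, d)" by fastforce
  have d: "d \<noteq> 0" using snd_quot_of_fract_nonzero[of ?f] cd by simp
  have "quot_to_fract (quot_of_fract ?f) = ?f" by simp
  then have "to_fract c / to_fract d = ?f"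
    unfolding cd by (simp add: quot_to_fract_def Fract_conv_to_fract)
  then have "to_fract (c * b) = to_fract (a * d)"
    using b d by (simp add: frac_eq_eq)
  then have "c * b = a * d" by (simp only: to_fract_eq_iff)
  then have "eval_qt u v c * eval_qt u v b = eval_qt u v a * eval_qt u v d" by (simp flip: hom_mult)
  then have "eval_qt u v c / eval_qt u v d = eval_qt u v a / eval_qt u v b"
    using uv b d by (simp add: independent_pair_def frac_eq_eq)
  then show ?thesis by (simp add: subst_qt_def cd)
qed

lemma subst_qt_to_fract:
  assumes "independent_pair u v" shows "subst_qt u v (to_fract a) = eval_qt u v a"
proof -
  interpret comm_ring_hom "eval_qt u v" by (rule hom_eval_qt)
  show ?thesis using subst_qt_quotient[OF assms, of 1 a] by simp
qed

lemma hom_subst_qt: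
  assumes uv: "independent_pair u v" shows "comm_ring_hom (subst_qt u v)"
proof (rule comm_ring_homI)
  interpret E: comm_ring_hom "eval_qt u v" by (rule hom_eval_qt)
  show "subst_qt u v 0 = 0" "subst_qt u v 1 = 1"
    using subst_qt_to_fract[OF uv, of 0] subst_qt_to_fract[OF uv, of 1] by simp_all
  fix f g :: ratfun
  obtain a b where f: "b \<noteq> 0" "f = to_fract a / to_fract b" using fract_as_quotient by blast
  obtain c d where g: "d \<noteq> 0" "g = to_fract c / to_fract d" using fract_as_quotient by blast
  have nz: "eval_qt u v b \<noteq> 0" "eval_qt u v d \<noteq> 0" using uv f g by (auto simp: independent_pair_def)
  have bd: "b * d \<noteq> 0" using f g by simp
  note quot = subst_qt_quotient[OF uv bd] subst_qt_quotient[OF uv f(1)] subst_qt_quotient[OF uv g(1)]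
  have sum: "f + g = to_fract (a * d + c * b) / to_fract (b * d)"
    using f g by (simp add: add_frac_eq)
  show "subst_qt u v (f + g) = subst_qt u v f + subst_qt u v g"
    unfolding sum unfolding f(2) g(2) quot by (simp only: E.hom_add E.hom_mult add_frac_eq[OF nz])
  have prod: "f * g = to_fract (a * c) / to_fract (b * d)" using f g by simp
  show "subst_qt u v (f * g) = subst_qt u v f * subst_qt u v g"
    unfolding prod unfolding f(2) g(2) quot by (simp only: E.hom_mult times_divide_times_eq)
qed

lemma subst_qt_vars:
  assumes "independent_pair u v"
  shows "subst_qt u v q_var = u" "subst_qt u v t_var = v" "subst_qt u v (const_rat r) = const_rat r"
  unfolding q_var_def t_var_def const_rat_def
  by (simp_all only: subst_qt_to_fract[OF assms] eval_qt_vars) (simp only: const_rat_def)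

lemma hom_inverse:
  fixes h :: "ratfun \<Rightarrow> ratfun"
  assumes "comm_ring_hom h" shows "h (inverse f) = inverse (h f)"
proof (cases "f = 0")
  case False
  interpret comm_ring_hom h by fact
  have "h f * h (inverse f) = 1" using False by (simp flip: hom_mult)
  then show ?thesis by (metis inverse_unique)
next
  interpret comm_ring_hom h by fact
  case True then show ?thesis by simp
qed

lemma hom_nonzero:
  fixes h :: "ratfun \<Rightarrow> ratfun"
  assumes "comm_ring_hom h" "f \<noteq> 0" shows "h f \<noteq> 0"
proof
  interpret comm_ring_hom h by fact
  assume "h f = 0"
  then have "h (f * inverse f) = 0" by (simp add: hom_mult)
  with assms(2) show False by simp
qed

lemma independent_pair_q_inverse_t: "independent_pair q_var (inverse t_var)"
  unfolding independent_pair_def using eval_qt_q_inverse_t_nonzero by blast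

lemma independent_pair_t_q: "independent_pair t_var q_var"
  unfolding independent_pair_def using eval_qt_t_q_nonzero by blast

lemma subst_qt_eval_qt:
  assumes h: "independent_pair u v"
  shows "subst_qt u v (eval_qt x y g) = eval_qt (subst_qt u v x) (subst_qt u v y) g"
proof -
  interpret comm_ring_hom "subst_qt u v" by (rule hom_subst_qt[OF h])
  have inner: "subst_qt u v (eval_q x c) = eval_q (subst_qt u v x) c" for c
  proof (induction c)
    case (pCons a c)
    then show ?case by (simp only: eval_q_pCons hom_add hom_mult subst_qt_vars(3)[OF h])
  qed simp
  show ?thesis
  proof (induction g)
    case (pCons c g)
    then show ?case by (simp only: eval_qt_pCons hom_add hom_mult inner)
  qed simp
qed

lemma subst_t_q_inverse_t:
  "subst_qt t_var q_var (inverse t_var) = inverse q_var"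
  by (simp only: hom_inverse[OF hom_subst_qt[OF independent_pair_t_q]] subst_qt_vars[OF independent_pair_t_q])

text \<open>The pair arises from \<open>(q, 1/t)\<close> by exchanging the variables, and a field homomorphism is injective.\<close>

lemma independent_pair_t_inverse_q: "independent_pair t_var (inverse q_var)"
  unfolding independent_pair_def
proof (intro allI impI)
  fix g :: "rat poly poly" assume "g \<noteq> 0"
  then have "subst_qt t_var q_var (eval_qt q_var (inverse t_var) g) \<noteq> 0"
    by (intro hom_nonzero[OF hom_subst_qt[OF independent_pair_t_q]] eval_qt_q_inverse_t_nonzero)
  then show "eval_qt t_var (inverse q_var) g \<noteq> 0"
    by (simp only: subst_qt_eval_qt[OF independent_pair_t_q] subst_t_q_inverse_t
        subst_qt_vars[OF independent_pair_t_q] simp_thms)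
qed

lemma subst_qt_compose:
  "subst_qt t_var q_var (subst_qt q_var (inverse t_var) f) = subst_qt t_var (inverse q_var) f"
proof -
  interpret S: comm_ring_hom "subst_qt t_var q_var" by (rule hom_subst_qt[OF independent_pair_t_q])
  obtain a b where f: "b \<noteq> 0" "f = to_fract a / to_fract b" using fract_as_quotient by blast
  have eval: "subst_qt t_var q_var (eval_qt q_var (inverse t_var) g) = eval_qt t_var (inverse q_var) g" for g
    by (simp only: subst_qt_eval_qt[OF independent_pair_t_q] subst_t_q_inverse_t
        subst_qt_vars[OF independent_pair_t_q])
  show ?thesis
    unfolding f(2) subst_qt_quotient[OF independent_pair_q_inverse_t f(1)]
      subst_qt_quotient[OF independent_pair_t_inverse_q f(1)]
    by (simp only: divide_inverse S.hom_mult hom_inverse[OF hom_subst_qt[OF independent_pair_t_q]] eval)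
qed

section \<open>Trace functions on the Hecke algebra of the symmetric group\<close>

definition inversions :: "nat \<Rightarrow> (nat \<Rightarrow> nat) \<Rightarrow> (nat \<times> nat) set" where
  "inversions n w = {(i, j). 1 \<le> i \<and> i < j \<and> j \<le> n \<and> w j < w i}"

lemma perm_length_inversions: "perm_length n w = card (inversions n w)"
  by (simp add: perm_length_def inversions_def)

lemma finite_inversions [simp]: "finite (inversions n w)"
  by (rule finite_subset[of _ "{1..n} \<times> {1..n}"]) (auto simp: inversions_def)

lemma adj_transp_simps [simp]:
  "adj_transp i i = Suc i" "adj_transp i (Suc i) = i"
  "j \<noteq> i \<Longrightarrow> j \<noteq> Suc i \<Longrightarrow> adj_transp i j = j"
  by (auto simp: adj_transp_def transpose_def)

lemma adj_transp_if: "adj_transp i j = (if j = i then Suc i else if j = Suc i then i else j)"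
  by auto

lemma adj_transp_involution [simp]: "adj_transp i (adj_transp i j) = j"
  by (auto simp: adj_transp_if)

lemma adj_transp_comp_self [simp]: "adj_transp i \<circ> adj_transp i = id"
  by (simp add: fun_eq_iff)

lemma adj_transp_comp_cancel [simp]: "adj_transp i \<circ> (adj_transp i \<circ> w) = w"
  by (simp add: fun_eq_iff)

lemma inj_adj_transp: "inj (adj_transp i)"
  by (metis adj_transp_involution injI)

lemma inv_adj_transp [simp]: "inv (adj_transp i) = adj_transp i"
  by (simp add: inv_unique_comp)

lemma adj_transp_permutes:
  assumes "i \<in> A" "Suc i \<in> A" shows "adj_transp i permutes A"
  unfolding adj_transp_def using assms by (simp add: permutes_swap_id)

lemma adj_transp_less:
  assumes "a < b" "\<not> (a = i \<and> b = Suc i)" shows "adj_transp i a < adj_transp i b"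
  using assms by (auto simp: adj_transp_if)

text \<open>The transposition acts on positions, so it carries the inversions of \<open>w\<close> to all inversions of the product
except the new one at \<open>(i, i + 1)\<close>.\<close>

lemma perm_length_mult_right:
  assumes w: "w permutes {1..n}" and i: "1 \<le> i" "i < n" and less: "w i < w (Suc i)"
  shows "perm_length n (w \<circ> adj_transp i) = perm_length n w + 1"
proof -
  let ?s = "adj_transp i"
  have range: "1 \<le> ?s a \<and> ?s a \<le> n" if "1 \<le> a" "a \<le> n" for a
    using that i by (auto simp: adj_transp_if)
  have eq: "inversions n (w \<circ> ?s) = insert (i, Suc i) (map_prod ?s ?s ` inversions n w)"
  proof (intro equalityI subsetI)
    fix p assume "p \<in> inversions n (w \<circ> ?s)"
    then obtain a b where p: "p = (a, b)" "1 \<le> a" "a < b" "b \<le> n" "w (?s b) < w (?s a)"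
      by (auto simp: inversions_def)
    show "p \<in> insert (i, Suc i) (map_prod ?s ?s ` inversions n w)"
    proof (cases "a = i \<and> b = Suc i")
      case False
      then have "(?s a, ?s b) \<in> inversions n w"
        using p range[of a] range[of b] adj_transp_less[of a b i] by (auto simp: inversions_def)
      then show ?thesis using p(1) by (force intro!: image_eqI)
    qed (use p in auto)
  next
    fix p assume p: "p \<in> insert (i, Suc i) (map_prod ?s ?s ` inversions n w)"
    show "p \<in> inversions n (w \<circ> ?s)"
    proof (cases "p = (i, Suc i)")
      case True then show ?thesis using i less by (auto simp: inversions_def)
    next
      case False
      then obtain a b where ab: "(a, b) \<in> inversions n w" "p = (?s a, ?s b)" using p by auto
      have "\<not> (a = i \<and> b = Suc i)" using ab less by (auto simp: inversions_def)
      then show ?thesis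
        using ab range[of a] range[of b] adj_transp_less[of a b i] by (auto simp: inversions_def)
    qed
  qed
  have "(i, Suc i) \<notin> map_prod ?s ?s ` inversions n w"
  proof
    assume "(i, Suc i) \<in> map_prod ?s ?s ` inversions n w"
    then obtain a b where "(a, b) \<in> inversions n w" "i = ?s a" "Suc i = ?s b" by auto
    then show False by (auto simp: inversions_def adj_transp_if split: if_splits)
  qed
  moreover have "inj_on (map_prod ?s ?s) (inversions n w)"
    by (intro inj_on_subset[OF map_prod_inj_on[OF inj_adj_transp inj_adj_transp]]) auto
  ultimately show ?thesis
    unfolding perm_length_inversions eq by (simp add: card_image)
qed

lemma perm_length_inv:
  assumes w: "w permutes {1..n}" shows "perm_length n (inv w) = perm_length n w"
proof -
  have range: "1 \<le> w a" "w a \<le> n" if "1 \<le> a" "a \<le> n" for a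
    using permutes_in_image[OF w, of a] that by auto
  have range': "1 \<le> inv w a" "inv w a \<le> n" if "1 \<le> a" "a \<le> n" for a
    using permutes_in_image[OF permutes_inv[OF w], of a] that by auto
  show ?thesis unfolding perm_length_inversions
    by (rule bij_betw_same_card[of "\<lambda>(a, b). (inv w b, inv w a)"],
        rule bij_betw_byWitness[where f' = "\<lambda>(a, b). (w b, w a)"])
      (use range[simplified] range'[simplified] permutes_inverses[OF w] in \<open>auto simp: inversions_def\<close>)
qed

lemma perm_length_mult_left:
  assumes w: "w permutes {1..n}" and i: "1 \<le> i" "i < n" and less: "inv w i < inv w (Suc i)"
  shows "perm_length n (adj_transp i \<circ> w) = perm_length n w + 1"
proof -
  have s: "adj_transp i permutes {1..n}" using i by (intro adj_transp_permutes) auto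
  have "inv (adj_transp i \<circ> w) = inv w \<circ> adj_transp i"
    using o_inv_distrib[OF permutes_bij[OF s] permutes_bij[OF w]] by simp
  then show ?thesis
    using perm_length_mult_right[OF permutes_inv[OF w] i less] perm_length_inv[OF w]
      perm_length_inv[OF permutes_compose[OF w s]] by simp
qed

text \<open>With \<open>f(T\<^sub>w)\<close> for \<open>f w\<close>, this is the equation \<open>f(T\<^sub>w T\<^sub>s) = f(T\<^sub>s T\<^sub>w)\<close> for a simple reflection \<open>s\<close> and
\<open>ws\<close> longer than \<open>w\<close>: then \<open>T\<^sub>w T\<^sub>s = T\<^bsub>ws\<^esub>\<close>, while \<open>T\<^sub>s T\<^sub>w\<close> has to be expanded by the quadratic relation
if \<open>sw\<close> is shorter than \<open>w\<close>. Ascents of \<open>w\<close> and of its inverse express the comparisons of lengths.\<close>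

definition hecke_trace :: "'a::comm_ring_1 \<Rightarrow> nat \<Rightarrow> ((nat \<Rightarrow> nat) \<Rightarrow> 'a) \<Rightarrow> bool" where
  "hecke_trace q n f \<longleftrightarrow> (\<forall>w i. w permutes {1..n} \<longrightarrow> 1 \<le> i \<longrightarrow> i < n \<longrightarrow> w i < w (Suc i) \<longrightarrow>
     f (w \<circ> adj_transp i) =
       (if inv w i < inv w (Suc i) then f (adj_transp i \<circ> w)
        else (q - 1) * f w + q * f (adj_transp i \<circ> w)))"

lemma hecke_traceD:
  assumes "hecke_trace q n f" "w permutes {1..n}" "1 \<le> i" "i < n" "w i < w (Suc i)"
  shows "inv w i < inv w (Suc i) \<Longrightarrow> f (w \<circ> adj_transp i) = f (adj_transp i \<circ> w)"
    and "inv w i > inv w (Suc i) \<Longrightarrow>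
           f (w \<circ> adj_transp i) = (q - 1) * f w + q * f (adj_transp i \<circ> w)"
  using assms unfolding hecke_trace_def by auto

text \<open>If \<open>sw\<close> is longer than \<open>w\<close>, this is relation (b). If it is shorter, relation (c) at \<open>v = sw\<close> gives
\<open>\<kappa>(ws) = \<kappa>(svs) = q \<kappa>(v) + (q - 1) \<kappa>(vs)\<close>, and \<open>\<kappa>(vs) = \<kappa>(sv) = \<kappa>(w)\<close> by relation (b).\<close>

lemma expansion_matrix_imp_hecke_trace:
  assumes \<kappa>: "is_expansion_matrix n \<kappa>" and \<nu>: "\<nu> \<in> partitions_of n"
  shows "hecke_trace [:0, 1:] n (\<kappa> \<nu>)"
  unfolding hecke_trace_def
proof (intro allI impI)
  fix w i assume w: "w permutes {1..n}" and i: "1 \<le> i" "i < n" and less: "w i < w (Suc i)"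
  let ?s = "adj_transp i"
  have s: "?s permutes {1..n}" using i by (intro adj_transp_permutes) auto
  have rel: "perm_length n (?s \<circ> v) = perm_length n (v \<circ> ?s) \<Longrightarrow>
      perm_length n (?s \<circ> v) = perm_length n v + 1 \<Longrightarrow> \<kappa> \<nu> (?s \<circ> v) = \<kappa> \<nu> (v \<circ> ?s)"
    "perm_length n (?s \<circ> v \<circ> ?s) = perm_length n v + 2 \<Longrightarrow>
      \<kappa> \<nu> (?s \<circ> v \<circ> ?s) = [:0, 1:] * \<kappa> \<nu> v + ([:0, 1:] - 1) * \<kappa> \<nu> (v \<circ> ?s)"
    if "v permutes {1..n}" for v
    using \<kappa> \<nu> that i unfolding is_expansion_matrix_def by (auto simp: Let_def)
  have right: "perm_length n (w \<circ> ?s) = perm_length n w + 1"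
    by (rule perm_length_mult_right[OF w i less])
  show "\<kappa> \<nu> (w \<circ> ?s) = (if inv w i < inv w (Suc i) then \<kappa> \<nu> (?s \<circ> w)
      else ([:0, 1:] - 1) * \<kappa> \<nu> w + [:0, 1:] * \<kappa> \<nu> (?s \<circ> w))"
  proof (cases "inv w i < inv w (Suc i)")
    case True
    then show ?thesis using rel(1)[OF w] right perm_length_mult_left[OF w i True] by simp
  next
    case False
    \<comment> \<open>The element \<open>v\<close> is shorter than \<open>w\<close>, and \<open>svs\<close> is longer than \<open>v\<close> by two.\<close>
    define v where "v = ?s \<circ> w"
    have v: "v permutes {1..n}" unfolding v_def by (rule permutes_compose[OF w s])
    have inv_v: "inv v = inv w \<circ> ?s"
      unfolding v_def using o_inv_distrib[OF permutes_bij[OF s] permutes_bij[OF w]] by simp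
    have "inv w i \<noteq> inv w (Suc i)"
      using permutes_inj[OF permutes_inv[OF w]] by (metis injD n_not_Suc_n)
    then have vless: "inv v i < inv v (Suc i)" using False inv_v by simp
    \<comment> \<open>Otherwise \<open>s\<close> would reverse the ascent of \<open>w\<close> at \<open>i\<close>.\<close>
    have "\<not> (w i = i \<and> w (Suc i) = Suc i)"
      using False permutes_inverses[OF w] by (metis lessI)
    then have vright: "v i < v (Suc i)"
      unfolding v_def using adj_transp_less[OF less] by auto
    have l1: "perm_length n (v \<circ> ?s) = perm_length n v + 1"
      by (rule perm_length_mult_right[OF v i vright])
    have l2: "perm_length n (?s \<circ> v) = perm_length n v + 1"
      by (rule perm_length_mult_left[OF v i vless])
    have sv: "?s \<circ> v = w" by (simp add: v_def)
    have "perm_length n (?s \<circ> v \<circ> ?s) = perm_length n v + 2"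
      unfolding sv right using l2 sv by simp
    from rel(2)[OF v this] rel(1)[OF v _ l2] l1 l2 sv False v_def
    show ?thesis by (simp add: add.commute)
  qed
qed

text \<open>The family \<open>x\<close> stands for a sum of basis elements \<open>T\<^sub>x\<close> that is invariant under left multiplication of
its indices by \<open>s\<close>. Such a sum is an eigenvector of left multiplication by \<open>T\<^sub>s\<close> with
eigenvalue \<open>q\<close>, and under a trace the right factor \<open>T\<^sub>s\<close> may be moved to the left. The proof pairs \<open>x\<close> with
\<open>sx\<close>. The ascents make \<open>T\<^sub>x T\<^sub>s\<close> a basis element.\<close>

lemma sum_hecke_trace_mult_right:
  fixes q :: "'a::comm_ring_1"
  assumes f: "hecke_trace q n f" and I: "finite I" "\<And>a. a \<in> I \<Longrightarrow> x a permutes {1..n}"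
    and i: "1 \<le> i" "i < n"
    and \<tau>: "\<And>a. a \<in> I \<Longrightarrow> \<tau> a \<in> I" "\<And>a. a \<in> I \<Longrightarrow> \<tau> (\<tau> a) = a"
      "\<And>a. a \<in> I \<Longrightarrow> x (\<tau> a) = adj_transp i \<circ> x a"
    and ascent: "\<And>a. a \<in> I \<Longrightarrow> x a i < x a (Suc i)"
  shows "(\<Sum>a\<in>I. f (x a \<circ> adj_transp i)) = q * (\<Sum>a\<in>I. f (x a))"
proof -
  let ?s = "adj_transp i"
  let ?U = "{a \<in> I. inv (x a) i < inv (x a) (Suc i)}"
  let ?D = "{a \<in> I. inv (x a) i > inv (x a) (Suc i)}"
  have neq: "inv (x a) i \<noteq> inv (x a) (Suc i)" if "a \<in> I" for a
    using permutes_inj[OF permutes_inv[OF I(2)[OF that]]] by (metis injD n_not_Suc_n)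
  have s: "?s permutes {1..n}" using i by (intro adj_transp_permutes) auto
  have inv_s: "inv (x (\<tau> a)) = inv (x a) \<circ> ?s" if "a \<in> I" for a
    using o_inv_distrib[OF permutes_bij[OF s] permutes_bij[OF I(2)[OF that]]] \<tau>(3)[OF that] by simp
  have I_split: "I = ?U \<union> ?D" using neq by (auto simp: neq_iff)
  have split: "sum g I = sum g ?U + sum g ?D" for g :: "_ \<Rightarrow> 'a"
    by (subst I_split, rule sum.union_disjoint) (use I(1) in auto)
  have swap: "sum g ?D = (\<Sum>a\<in>?U. g (\<tau> a))" for g :: "_ \<Rightarrow> 'a"
    by (rule sum.reindex_bij_witness[where i = \<tau> and j = \<tau>]) (use \<tau>(1,2) inv_s in auto)
  have "(\<Sum>a\<in>I. f (x a \<circ> ?s)) = (\<Sum>a\<in>?U. f (x a \<circ> ?s) + f (x (\<tau> a) \<circ> ?s))"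
    unfolding split swap sum.distrib ..
  also have "\<dots> = (\<Sum>a\<in>?U. q * (f (x a) + f (x (\<tau> a))))"
  proof (rule sum.cong)
    fix a assume a: "a \<in> ?U"
    then have aI: "a \<in> I" and \<tau>I: "\<tau> a \<in> I" using \<tau>(1) by auto
    have 1: "f (x a \<circ> ?s) = f (x (\<tau> a))"
      using hecke_traceD(1)[OF f I(2)[OF aI] i ascent[OF aI]] a \<tau>(3)[OF aI] by simp
    have "?s \<circ> x (\<tau> a) = x a" using \<tau>(3)[OF aI] by simp
    then have "f (x (\<tau> a) \<circ> ?s) = (q - 1) * f (x (\<tau> a)) + q * f (x a)"
      using hecke_traceD(2)[OF f I(2)[OF \<tau>I] i ascent[OF \<tau>I]] inv_s[OF aI] a by simp
    with 1 show "f (x a \<circ> ?s) + f (x (\<tau> a) \<circ> ?s) = q * (f (x a) + f (x (\<tau> a)))"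
      by (simp add: algebra_simps)
  qed simp
  also have "\<dots> = q * (\<Sum>a\<in>I. f (x a))"
    unfolding split swap sum.distrib by (simp add: sum_distrib_left distrib_left sum.distrib)
  finally show ?thesis .
qed

section \<open>Peeling a symmetrizer\<close>

text \<open>The Coxeter element \<open>s\<^sub>k s\<^bsub>k+1\<^esub> \<dots> s\<^bsub>k+b-1\<^esub>\<close>.\<close>

definition up_cycle :: "nat \<Rightarrow> nat \<Rightarrow> nat \<Rightarrow> nat" where
  "up_cycle k b = (\<lambda>x. if k \<le> x \<and> x < k + b then Suc x else if x = k + b then k else x)"

text \<open>The product \<open>s\<^bsub>k-1\<^esub> \<dots> s\<^bsub>j+1\<^esub> s\<^sub>j\<close>, a minimal coset representative: it moves \<open>j\<close> to the end of the block and keeps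
the order of the other entries.\<close>

definition down_cycle :: "nat \<Rightarrow> nat \<Rightarrow> nat \<Rightarrow> nat" where
  "down_cycle j k = (\<lambda>x. if x = j then k else if j < x \<and> x \<le> k then x - 1 else x)"

lemma up_cycle_0 [simp]: "up_cycle k 0 = id"
  by (auto simp: up_cycle_def)

lemma down_cycle_refl [simp]: "down_cycle k k = id"
  by (auto simp: down_cycle_def)

lemma up_cycle_Suc: "up_cycle k (Suc b) = adj_transp k \<circ> up_cycle (Suc k) b"
  by (auto simp: up_cycle_def adj_transp_if fun_eq_iff)

lemma down_cycle_rec_right:
  assumes "j < k" shows "down_cycle j k = down_cycle (Suc j) k \<circ> adj_transp j"
  using assms by (auto simp: down_cycle_def adj_transp_if fun_eq_iff)

lemma down_cycle_Suc:
  assumes "j \<le> k" shows "down_cycle j (Suc k) = adj_transp k \<circ> down_cycle j k"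
  using assms by (auto simp: down_cycle_def adj_transp_if fun_eq_iff)

lemma down_up_cycle:
  assumes "j \<le> k"
  shows "down_cycle j k \<circ> up_cycle j (k - j) = id" "up_cycle j (k - j) \<circ> down_cycle j k = id"
  using assms by (auto simp: down_cycle_def up_cycle_def fun_eq_iff)

lemma up_cycle_permutes: "up_cycle k b permutes {k..k+b}"
proof (rule bij_imp_permutes)
  have "k \<le> k + b" by simp
  from down_up_cycle[OF this] show "bij_betw (up_cycle k b) {k..k+b} {k..k+b}"
    by (intro bij_betw_byWitness[where f' = "down_cycle k (k + b)"])
      (auto simp: fun_eq_iff up_cycle_def down_cycle_def)
qed (auto simp: up_cycle_def)

lemma down_cycle_permutes:
  assumes "j \<le> k" shows "down_cycle j k permutes {j..k}"
proof (rule bij_imp_permutes)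
  from down_up_cycle[OF assms] show "bij_betw (down_cycle j k) {j..k} {j..k}"
    using assms by (intro bij_betw_byWitness[where f' = "up_cycle j (k - j)"])
      (auto simp: fun_eq_iff up_cycle_def down_cycle_def)
qed (use assms in \<open>auto simp: down_cycle_def\<close>)

lemma permutes_disjoint_commute:
  assumes p: "p permutes A" and r: "r permutes B" and "A \<inter> B = {}" shows "p \<circ> r = r \<circ> p"
proof (rule ext)
  fix x
  have "p x \<in> A" if "x \<in> A" using that permutes_in_image[OF p] by simp
  moreover have "r x \<in> B" if "x \<in> B" using that permutes_in_image[OF r] by simp
  ultimately show "(p \<circ> r) x = (r \<circ> p) x"
    using \<open>A \<inter> B = {}\<close> permutes_not_in[OF p] permutes_not_in[OF r]
    by (metis comp_apply disjoint_iff)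
qed

abbreviation block_perms :: "nat \<Rightarrow> nat \<Rightarrow> (nat \<Rightarrow> nat) set" where
  "block_perms m a \<equiv> {w. w permutes {m<..m+a}}"

text \<open>A permutation of a block is determined by the position \<open>j\<close> of the last value and by the
permutation of the smaller block that remains when this value is moved to the end.\<close>

lemma sum_block_perms_Suc:
  fixes g :: "(nat \<Rightarrow> nat) \<Rightarrow> 'a::comm_monoid_add"
  shows "(\<Sum>w\<in>block_perms m (Suc a). g w)
       = (\<Sum>j\<in>{m<..m + Suc a}. \<Sum>w\<in>block_perms m a. g (w \<circ> down_cycle j (m + Suc a)))"
proof -
  let ?k = "m + Suc a"
  have "(\<Sum>j\<in>{m<..?k}. \<Sum>w\<in>block_perms m a. g (w \<circ> down_cycle j ?k))
      = (\<Sum>(j, w)\<in>{m<..?k} \<times> block_perms m a. g (w \<circ> down_cycle j ?k))"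
    by (rule sum.cartesian_product)
  also have "\<dots> = (\<Sum>w\<in>block_perms m (Suc a). g w)"
  proof (rule sum.reindex_bij_witness[where j = "\<lambda>(j, w). w \<circ> down_cycle j ?k"
        and i = "\<lambda>w. (inv w ?k, w \<circ> up_cycle (inv w ?k) (?k - inv w ?k))"])
    fix p assume "p \<in> {m<..?k} \<times> block_perms m a"
    then obtain j w where p: "p = (j, w)" "m < j" "j \<le> ?k" and w: "w permutes {m<..m+a}" by auto
    have w': "w permutes {m<..?k}" by (rule permutes_subset[OF w]) auto
    have d: "down_cycle j ?k permutes {m<..?k}"
      by (rule permutes_subset[OF down_cycle_permutes]) (use p in auto)
    have wd: "w \<circ> down_cycle j ?k permutes {m<..?k}" by (rule permutes_compose[OF d w'])
    have "w ?k = ?k" using permutes_not_in[OF w] by simp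
    then have "(w \<circ> down_cycle j ?k) j = ?k" by (simp add: down_cycle_def)
    then have j: "inv (w \<circ> down_cycle j ?k) ?k = j" using permutes_inverses(2)[OF wd] by metis
    show "(case p of (j, w) \<Rightarrow> w \<circ> down_cycle j ?k) \<in> block_perms m (Suc a)" using p wd by simp
    have "w \<circ> down_cycle j ?k \<circ> up_cycle j (?k - j) = w"
      using down_up_cycle(1)[OF p(3)] by (metis comp_assoc comp_id)
    then show "(inv (case p of (j, w) \<Rightarrow> w \<circ> down_cycle j ?k) ?k, (case p of (j, w) \<Rightarrow> w \<circ> down_cycle j ?k) \<circ>
        up_cycle (inv (case p of (j, w) \<Rightarrow> w \<circ> down_cycle j ?k) ?k) (?k - inv (case p of (j, w) \<Rightarrow> w \<circ> down_cycle j ?k) ?k)) = p"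
      using p j by simp
  next
    fix w assume "w \<in> block_perms m (Suc a)"
    then have w: "w permutes {m<..?k}" by simp
    let ?j = "inv w ?k"
    have j: "m < ?j" "?j \<le> ?k"
      using permutes_in_image[OF permutes_inv[OF w], of ?k] by auto
    have wj: "w ?j = ?k" using permutes_inverses(1)[OF w] by simp
    have u: "up_cycle ?j (?k - ?j) permutes {m<..?k}"
      by (rule permutes_subset[OF up_cycle_permutes]) (use j in auto)
    have "w \<circ> up_cycle ?j (?k - ?j) permutes {m<..?k}" by (rule permutes_compose[OF u w])
    moreover have "(w \<circ> up_cycle ?j (?k - ?j)) ?k = ?k" using wj j by (simp add: up_cycle_def)
    ultimately have "w \<circ> up_cycle ?j (?k - ?j) permutes {m<..m+a}"
      by (elim permutes_superset) (auto simp: not_le less_Suc_eq_le le_Suc_eq)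
    then show "(inv w ?k, w \<circ> up_cycle (inv w ?k) (?k - inv w ?k)) \<in> {m<..?k} \<times> block_perms m a"
      using j by simp
    show "(case (inv w ?k, w \<circ> up_cycle (inv w ?k) (?k - inv w ?k)) of (j, w) \<Rightarrow> w \<circ> down_cycle j ?k) = w"
      using down_up_cycle(2)[OF j(2)] by (simp add: comp_assoc)
  qed auto
  finally show ?thesis ..
qed

text \<open>The set \<open>U\<close> collects the factors on the first \<open>m\<close> points, later a Young subgroup, which commute with the
symmetrizer on the points after \<open>m\<close> that is being peeled.\<close>

locale trace_sums =
  fixes n m :: nat and U :: "(nat \<Rightarrow> nat) set" and f :: "(nat \<Rightarrow> nat) \<Rightarrow> ratfun"
  assumes trace: "hecke_trace q_var n f" and U: "\<And>u. u \<in> U \<Longrightarrow> u permutes {1..m}"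
begin

definition block_sum :: "nat \<Rightarrow> (nat \<Rightarrow> nat) \<Rightarrow> ratfun" where
  "block_sum a y = (\<Sum>u\<in>U. \<Sum>w\<in>block_perms m a. f (u \<circ> w \<circ> y))"

lemma finite_U: "finite U"
  by (rule finite_subset[of _ "{u. u permutes {1..m}}"]) (use U finite_permutations in auto)

text \<open>Each simple factor of the cycle is absorbed by the symmetrizer of the block by
\<open>sum_hecke_trace_mult_right\<close>. The remaining element has an ascent at \<open>j\<close>: it keeps \<open>j\<close> inside the first \<open>a\<close> places
of the block and sends \<open>j + 1\<close> to the point just after them.\<close>

lemma block_sum_down_cycle:
  assumes y: "y permutes {m + Suc a + b<..n}" and n: "m + Suc a + b \<le> n"
    and j: "m < j" "j \<le> m + a"
  shows "block_sum a (up_cycle (m + a) (Suc b) \<circ> y \<circ> down_cycle j (m + a))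
       = q_var ^ (m + a - j) * block_sum a (up_cycle (m + a) (Suc b) \<circ> y)"
  using j(2,1)
proof (induction j rule: inc_induct)
  case (step j)
  let ?v = "up_cycle (m + a) (Suc b) \<circ> y"
  let ?z = "?v \<circ> down_cycle (Suc j) (m + a)"
  let ?s = "adj_transp j"
  let ?x = "\<lambda>(u, w). u \<circ> w \<circ> ?z"
  have jm: "m < j" "j < m + a" using step by auto
  have "up_cycle (m + a) (Suc b) permutes {1..n}"
    by (rule permutes_subset[OF up_cycle_permutes]) (use n jm in auto)
  moreover have "y permutes {1..n}" by (rule permutes_subset[OF y]) auto
  moreover have "down_cycle (Suc j) (m + a) permutes {1..n}"
    by (rule permutes_subset[OF down_cycle_permutes]) (use n jm in auto)
  ultimately have z: "?z permutes {1..n}" by (intro permutes_compose)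
  have zj: "?z j = j"
    using permutes_not_in[OF y, of j] jm by (simp add: down_cycle_def up_cycle_def)
  have zSj: "?z (Suc j) = m + Suc a"
    using permutes_not_in[OF y, of "m + a"] jm by (simp add: down_cycle_def up_cycle_def)
  have "(\<Sum>p\<in>U \<times> block_perms m a. f (?x p \<circ> ?s)) = q_var * (\<Sum>p\<in>U \<times> block_perms m a. f (?x p))"
  proof (rule sum_hecke_trace_mult_right[OF trace, where \<tau> = "\<lambda>(u, w). (u, ?s \<circ> w)"])
    show "finite (U \<times> block_perms m a)"
      using finite_U finite_permutations[of "{m<..m+a}"] by simp
    show "1 \<le> j" "j < n" using jm n by auto
    have s: "?s permutes {m<..m+a}" by (rule adj_transp_permutes) (use jm in auto)
    fix p assume "p \<in> U \<times> block_perms m a"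
    then obtain u w where p: "p = (u, w)" and u: "u \<in> U" and w: "w permutes {m<..m+a}" by auto
    have "u permutes {1..n}" by (rule permutes_subset[OF U[OF u]]) (use n in auto)
    moreover have "w permutes {1..n}" by (rule permutes_subset[OF w]) (use n in auto)
    ultimately show "?x p permutes {1..n}" using p z by (auto intro!: permutes_compose)
    show "(case p of (u, w) \<Rightarrow> (u, ?s \<circ> w)) \<in> U \<times> block_perms m a"
      using p u permutes_compose[OF w s] by simp
    show "(case case p of (u, w) \<Rightarrow> (u, ?s \<circ> w) of (u, w) \<Rightarrow> (u, ?s \<circ> w)) = p" using p by simp
    have "?s \<circ> u = u \<circ> ?s" by (rule permutes_disjoint_commute[OF s U[OF u]]) auto
    then show "?x (case p of (u, w) \<Rightarrow> (u, ?s \<circ> w)) = ?s \<circ> ?x p"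
      using p by (simp add: comp_assoc[symmetric])
    have "w j \<in> {m<..m+a}" using permutes_in_image[OF w] jm by simp
    then have "?x p j \<le> m + a"
      using p zj permutes_not_in[OF U[OF u], of "w j"] by simp
    moreover have "?x p (Suc j) = m + Suc a"
      using p zSj permutes_not_in[OF U[OF u], of "m + Suc a"] permutes_not_in[OF w, of "m + Suc a"]
      by simp
    ultimately show "?x p j < ?x p (Suc j)" by simp
  qed
  then have "block_sum a (?z \<circ> ?s) = q_var * block_sum a ?z"
    by (simp add: block_sum_def sum.cartesian_product case_prod_beta comp_assoc)
  moreover have "?z \<circ> ?s = ?v \<circ> down_cycle j (m + a)"
    using down_cycle_rec_right[OF jm(2)] by (simp add: comp_assoc)
  moreover have "m + a - j = Suc (m + a - Suc j)" using jm by simp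
  moreover have "block_sum a ?z = q_var ^ (m + a - Suc j) * block_sum a ?v"
    using step.IH jm by (simp add: comp_def)
  ultimately show ?case by (simp add: mult.assoc comp_def)
qed simp

text \<open>The coset representatives of the smaller block in the larger one are the cycles \<open>s\<^bsub>m+a\<^esub> \<dots> s\<^sub>j\<close>. The
trivial one gives the first summand. In the others the factor \<open>s\<^bsub>m+a\<^esub>\<close> prolongs the Coxeter element that
follows the block, and the rest commutes past it and contributes a power of \<open>q\<close>.\<close>

lemma block_sum_peel:
  assumes y: "y permutes {m + Suc a + b<..n}" and n: "m + Suc a + b \<le> n"
  shows "block_sum (Suc a) (up_cycle (m + Suc a) b \<circ> y)
       = block_sum a (up_cycle (m + Suc a) b \<circ> y)
         + q_int a * block_sum a (up_cycle (m + a) (Suc b) \<circ> y)"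
proof -
  let ?k = "m + Suc a"
  let ?v = "up_cycle ?k b \<circ> y"
  have "block_sum (Suc a) ?v = (\<Sum>j\<in>{m<..?k}. block_sum a (down_cycle j ?k \<circ> ?v))"
    unfolding block_sum_def sum_block_perms_Suc
    by (subst sum.swap) (simp add: comp_assoc)
  also have "{m<..?k} = insert ?k {m<..m+a}" by auto
  also have "(\<Sum>j\<in>insert ?k {m<..m+a}. block_sum a (down_cycle j ?k \<circ> ?v))
      = block_sum a ?v + (\<Sum>j\<in>{m<..m+a}. block_sum a (down_cycle j ?k \<circ> ?v))"
    by (subst sum.insert) auto
  also have "(\<Sum>j\<in>{m<..m+a}. block_sum a (down_cycle j ?k \<circ> ?v))
      = (\<Sum>j\<in>{m<..m+a}. q_var ^ (m + a - j) * block_sum a (up_cycle (m + a) (Suc b) \<circ> y))"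
  proof (rule sum.cong)
    fix j assume j: "j \<in> {m<..m+a}"
    have "?v permutes {m + a<..n}"
      by (rule permutes_compose; rule permutes_subset[OF y] permutes_subset[OF up_cycle_permutes])
        (use n in auto)
    then have "down_cycle j (m + a) \<circ> ?v = ?v \<circ> down_cycle j (m + a)"
      using j by (intro permutes_disjoint_commute[OF down_cycle_permutes[of j "m + a"]]) auto
    then have "down_cycle j ?k \<circ> ?v = up_cycle (m + a) (Suc b) \<circ> y \<circ> down_cycle j (m + a)"
      using j by (simp add: down_cycle_Suc up_cycle_Suc comp_assoc)
    then show "block_sum a (down_cycle j ?k \<circ> ?v)
        = q_var ^ (m + a - j) * block_sum a (up_cycle (m + a) (Suc b) \<circ> y)"
      using block_sum_down_cycle[OF y n] j by simp
  qed simp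
  also have "\<dots> = q_int a * block_sum a (up_cycle (m + a) (Suc b) \<circ> y)"
    unfolding q_int_def sum_distrib_right
    by (rule sum.reindex_bij_witness[where i = "\<lambda>i. m + a - i" and j = "\<lambda>j. m + a - j"]) auto
  finally show ?thesis .
qed

end

section \<open>Sums over Young subgroups\<close>

lemma to_fract_sum: "to_fract (\<Sum>i\<in>A. g i) = (\<Sum>i\<in>A. to_fract (g i))"
  by (induction A rule: infinite_finite_induct) auto

lemma const_poly_sum: "[:\<Sum>i\<in>A. g i:] = (\<Sum>i\<in>A. [:g i:])"
  by (rule poly_eqI) (simp add: coeff_sum coeff_pCons split: nat.split)

lemma q_int_nonzero: assumes "k > 0" shows "q_int k \<noteq> 0"
proof -
  have power: "q_var ^ i = to_fract [:monom 1 i:]" for i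
  proof (induction i)
    case (Suc i)
    have "q_var ^ Suc i = to_fract ([:[:0, 1:]:] * [:monom 1 i:])"
      by (simp only: power_Suc Suc.IH) (simp only: q_var_def to_fract_mult)
    also have "[:[:0, 1:]:] * [:monom (1::rat) i:] = [:monom 1 (Suc i):]"
      by (simp add: monom_Suc)
    finally show ?case .
  qed (simp add: pCons_one)
  have "q_int k = to_fract [:\<Sum>i<k. monom 1 i:]"
    unfolding q_int_def power const_poly_sum to_fract_sum ..
  moreover have "coeff (\<Sum>i<k. monom (1::rat) i) 0 = 1"
    using assms by (simp add: coeff_sum sum.delta)
  ultimately show ?thesis by (metis coeff_0 pCons_eq_0_iff to_fract_eq_0_iff zero_neq_one)
qed

lemma q_fact_Suc: "q_fact (Suc k) = q_fact k * q_int (Suc k)"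
  by (simp add: q_fact_def)

lemma q_fact_0 [simp]: "q_fact 0 = 1"
  by (simp add: q_fact_def)

context trace_sums begin

text \<open>The peeling step, iterated: in the second summand of \<open>block_sum_peel\<close> the Coxeter block has grown by one point.\<close>

lemma block_sum_expand:
  assumes "y permutes {m + Suc a + b<..n}" "m + Suc a + b \<le> n"
  shows "block_sum (Suc a) (up_cycle (m + Suc a) b \<circ> y) / q_fact a
       = (\<Sum>i\<le>a. block_sum i (up_cycle (Suc (m + i)) (a + b - i) \<circ> y) / q_fact i)"
  using assms
proof (induction a arbitrary: b)
  case 0
  then show ?case using block_sum_peel[OF 0] by (simp add: q_int_def comp_def)
next
  case (Suc a)
  have eq: "m + Suc (Suc a) + b = m + Suc a + Suc b" by simp
  have "block_sum (Suc (Suc a)) (up_cycle (m + Suc (Suc a)) b \<circ> y) / q_fact (Suc a)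
      = block_sum (Suc a) (up_cycle (m + Suc (Suc a)) b \<circ> y) / q_fact (Suc a)
        + block_sum (Suc a) (up_cycle (m + Suc a) (Suc b) \<circ> y) / q_fact a"
    unfolding block_sum_peel[OF Suc.prems] q_fact_Suc
    using q_int_nonzero[of "Suc a"] by (simp add: add_divide_distrib)
  then show ?case using Suc.IH[of "Suc b"] Suc.prems by (simp add: eq add.commute comp_def)
qed

end

text \<open>The Coxeter element of the Young subgroup with block sizes \<open>c\<close>, placed on the last points of \<open>{1..n}\<close>, so
that the points before them stay free for symmetrizers and new blocks can be added in front.\<close>

fun coxeter :: "nat \<Rightarrow> nat list \<Rightarrow> nat \<Rightarrow> nat" where
  "coxeter n [] = id"
| "coxeter n (k # c) = up_cycle (Suc n - sum_list c - k) (k - 1) \<circ> coxeter n c"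

lemma coxeter_permutes:
  assumes "0 \<notin> set c" "sum_list c \<le> n" shows "coxeter n c permutes {n - sum_list c<..n}"
  using assms
proof (induction c)
  case (Cons k c)
  have "coxeter n c permutes {n - sum_list (k # c)<..n}"
    using Cons by (intro permutes_subset[OF Cons.IH]) auto
  moreover have "up_cycle (Suc n - sum_list c - k) (k - 1) permutes {n - sum_list (k # c)<..n}"
    using Cons.prems by (intro permutes_subset[OF up_cycle_permutes]) auto
  ultimately show ?case unfolding coxeter.simps by (rule permutes_compose)
qed auto

lemma young_subgroup_permutes: "u \<in> young_subgroup n \<rho> \<Longrightarrow> u permutes {1..n}"
  by (simp add: young_subgroup_def)

lemma young_subgroup_append:
  "v \<in> young_subgroup (sum_list \<rho> + a) (\<rho> @ [a]) \<longleftrightarrow>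
     (\<exists>u\<in>young_subgroup (sum_list \<rho>) \<rho>. \<exists>w\<in>block_perms (sum_list \<rho>) a. v = u \<circ> w)"
  (is "?L \<longleftrightarrow> ?R")
proof
  let ?m = "sum_list \<rho>"
  let ?B = "\<lambda>k. {sum_list (take k \<rho>) <.. sum_list (take (k + 1) \<rho>)}"
  have B: "?B k \<subseteq> {1..?m}" for k
  proof -
    have "sum_list (take (k + 1) \<rho>) + sum_list (drop (k + 1) \<rho>) = ?m"
      by (metis append_take_drop_id sum_list_append)
    then show ?thesis by auto
  qed
  {
    assume L: ?L
    then have v: "v permutes {1..?m+a}" by (simp add: young_subgroup_def)
    have blk: "v ` ?B k = ?B k" if "k < length \<rho>" for k
    proof -
      have "k < length (\<rho> @ [a])" using that by simp
      with L have "v ` {sum_list (take k (\<rho> @ [a])) <.. sum_list (take (k + 1) (\<rho> @ [a]))}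
          = {sum_list (take k (\<rho> @ [a])) <.. sum_list (take (k + 1) (\<rho> @ [a]))}"
        unfolding young_subgroup_def Let_def by blast
      then show ?thesis using that by simp
    qed
    have "length \<rho> < length (\<rho> @ [a])" by simp
    with L have "v ` {sum_list (take (length \<rho>) (\<rho> @ [a])) <.. sum_list (take (length \<rho> + 1) (\<rho> @ [a]))}
          = {sum_list (take (length \<rho>) (\<rho> @ [a])) <.. sum_list (take (length \<rho> + 1) (\<rho> @ [a]))}"
      unfolding young_subgroup_def Let_def by blast
    then have top: "v ` {?m<..?m+a} = {?m<..?m+a}" by simp
    have "{1..?m} = {1..?m+a} - {?m<..?m+a}" by auto
    then have bot: "v ` {1..?m} = {1..?m}"
      using image_set_diff[OF permutes_inj[OF v], of "{1..?m+a}" "{?m<..?m+a}"] top permutes_image[OF v]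
      by simp
    have inj: "inj_on v A" for A using permutes_inj_on[OF v] .
    let ?u = "perm_restrict v {1..?m}" and ?w = "perm_restrict v {?m<..?m+a}"
    have u: "?u permutes {1..?m}"
      by (rule bij_imp_permutes)
        (use inj[of "{1..?m}"] bot in \<open>auto simp: bij_betw_def perm_restrict_def inj_on_def image_def\<close>)
    have w: "?w permutes {?m<..?m+a}"
      by (rule bij_imp_permutes)
        (use inj[of "{?m<..?m+a}"] top in \<open>auto simp: bij_betw_def perm_restrict_def inj_on_def image_def\<close>)
    have "?u ` ?B k = ?B k" if "k < length \<rho>" for k
    proof -
      have "?u ` ?B k = v ` ?B k" by (rule image_cong) (use B[of k] in \<open>auto simp: perm_restrict_def\<close>)
      then show ?thesis using blk[OF that] by simp
    qed
    with u have "?u \<in> young_subgroup ?m \<rho>" by (simp add: young_subgroup_def Let_def)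
    moreover have "v = ?u \<circ> ?w"
    proof
      fix x
      have "v x \<in> {?m<..?m+a}" if "x \<in> {?m<..?m+a}" using top that by blast
      then show "v x = (?u \<circ> ?w) x"
        using permutes_not_in[OF v, of x] by (auto simp: perm_restrict_def)
    qed
    ultimately show ?R using w by auto
  next
    assume ?R
    then obtain u w where u: "u \<in> young_subgroup ?m \<rho>" and w: "w permutes {?m<..?m+a}"
      and v: "v = u \<circ> w" by auto
    have u': "u permutes {1..?m}" using u by (rule young_subgroup_permutes)
    have "v permutes {1..?m+a}" unfolding v
      by (rule permutes_compose; rule permutes_subset[OF u'] permutes_subset[OF w]) auto
    moreover have "v ` ?B k = ?B k" if "k < length \<rho>" for k
    proof -
      have "v ` ?B k = u ` ?B k"
        unfolding v by (rule image_cong) (use B[of k] permutes_not_in[OF w] in auto)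
      then show ?thesis using u that by (auto simp: young_subgroup_def Let_def)
    qed
    moreover have "v ` {?m<..?m+a} = {?m<..?m+a}"
    proof -
      have "v ` {?m<..?m+a} = w ` {?m<..?m+a}"
      proof (rule image_cong)
        fix x assume "x \<in> {?m<..?m+a}"
        then have "w x \<in> {?m<..?m+a}" using permutes_in_image[OF w] by blast
        then show "v x = w x" unfolding v using permutes_not_in[OF u'] by auto
      qed simp
      then show ?thesis using permutes_image[OF w] by simp
    qed
    ultimately show ?L unfolding young_subgroup_def Let_def
      by (auto simp: less_Suc_eq)
  }
qed

lemma Sigma_bex: "(\<exists>z\<in>A \<times> B. Q z) \<longleftrightarrow> (\<exists>x\<in>A. \<exists>y\<in>B. Q (x, y))"
  by auto

lemma sum_young_subgroup_append:
  fixes g :: "(nat \<Rightarrow> nat) \<Rightarrow> 'a::comm_monoid_add"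
  shows "(\<Sum>v\<in>young_subgroup (sum_list \<rho> + a) (\<rho> @ [a]). g v)
       = (\<Sum>u\<in>young_subgroup (sum_list \<rho>) \<rho>. \<Sum>w\<in>block_perms (sum_list \<rho>) a. g (u \<circ> w))"
proof -
  let ?m = "sum_list \<rho>"
  let ?Y = "young_subgroup ?m \<rho>"
  have inj: "inj_on (\<lambda>(u, w). u \<circ> w) (?Y \<times> block_perms ?m a)"
  proof (rule inj_onI; clarify)
    fix u w u' w' assume u: "u \<in> ?Y" "u' \<in> ?Y" and w: "w permutes {?m<..?m+a}" "w' permutes {?m<..?m+a}"
      and eq: "u \<circ> w = u' \<circ> w'"
    have u': "u permutes {1..?m}" "u' permutes {1..?m}" using u young_subgroup_permutes by auto
    have "u x = u' x \<and> w x = w' x" for x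
    proof (cases "x \<in> {?m<..?m+a}")
      case True
      then have "w x \<in> {?m<..?m+a}" "w' x \<in> {?m<..?m+a}"
        using permutes_in_image[OF w(1)] permutes_in_image[OF w(2)] by simp_all
      then show ?thesis
        using fun_cong[OF eq, of x] True u'[THEN permutes_not_in] by simp
    next
      case False
      then show ?thesis using fun_cong[OF eq, of x] w[THEN permutes_not_in] by simp
    qed
    then show "u = u' \<and> w = w'" by auto
  qed
  have "young_subgroup (?m + a) (\<rho> @ [a]) = (\<lambda>(u, w). u \<circ> w) ` (?Y \<times> block_perms ?m a)"
  proof (rule Set.set_eqI)
    fix v
    show "v \<in> young_subgroup (?m + a) (\<rho> @ [a]) \<longleftrightarrow> v \<in> (\<lambda>(u, w). u \<circ> w) ` (?Y \<times> block_perms ?m a)"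
      unfolding young_subgroup_append image_iff by (simp only: Sigma_bex case_prod_conv)
  qed
  then have "(\<Sum>v\<in>young_subgroup (?m + a) (\<rho> @ [a]). g v)
      = (\<Sum>p\<in>?Y \<times> block_perms ?m a. (g \<circ> (\<lambda>(u, w). u \<circ> w)) p)"
    by (simp only: sum.reindex[OF inj])
  also have "\<dots> = (\<Sum>(u, w)\<in>?Y \<times> block_perms ?m a. g (u \<circ> w))"
    by (rule sum.cong) auto
  finally show ?thesis by (simp only: sum.cartesian_product)
qed

text \<open>The trace of the symmetrizers of the blocks of \<open>\<rho>\<close> on the first points times the Coxeter element with blocks
\<open>c\<close> on the last points, normalized so that the recursion in the size of a block becomes homogeneous.\<close>

definition young_sum :: "((nat \<Rightarrow> nat) \<Rightarrow> ratfun) \<Rightarrow> nat \<Rightarrow> nat list \<Rightarrow> nat list \<Rightarrow> ratfun" where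
  "young_sum f n \<rho> c = (\<Sum>u\<in>young_subgroup (sum_list \<rho>) \<rho>. f (u \<circ> coxeter n c)) / q_fact_part \<rho>"

lemma young_sum_Nil: "young_sum f n [] c = f (coxeter n c)"
  by (simp add: young_sum_def young_subgroup_def q_fact_part_def)

lemma young_sum_append:
  "young_sum f n (\<rho> @ [a]) c = (\<Sum>u\<in>young_subgroup (sum_list \<rho>) \<rho>.
     \<Sum>w\<in>block_perms (sum_list \<rho>) a. f (u \<circ> w \<circ> coxeter n c)) / (q_fact_part \<rho> * q_fact a)"
  unfolding young_sum_def by (simp add: sum_young_subgroup_append q_fact_part_def)

lemma young_sum_append_0: "young_sum f n (\<rho> @ [0]) c = young_sum f n \<rho> c"
  by (simp add: young_sum_append) (simp add: young_sum_def)

text \<open>The basic recursion: a symmetrizer of size \<open>a + 1\<close> becomes a symmetrizer of size \<open>i\<close> and a Coxeter block with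
the other \<open>a + 1 - i\<close> points.\<close>

lemma young_sum_append_Suc:
  assumes f: "hecke_trace q_var n f" and n: "sum_list \<rho> + Suc a + sum_list c = n" and c: "0 \<notin> set c"
  shows "q_int (Suc a) * young_sum f n (\<rho> @ [Suc a]) c
       = (\<Sum>i\<le>a. young_sum f n (\<rho> @ [i]) (Suc (a - i) # c))"
proof -
  let ?m = "sum_list \<rho>"
  interpret trace_sums n ?m "young_subgroup ?m \<rho>" f
    by standard (use f young_subgroup_permutes in auto)
  have as_block_sum: "young_sum f n (\<rho> @ [i]) c' = block_sum i (coxeter n c') / q_fact i / q_fact_part \<rho>" for i c'
    by (simp add: young_sum_append block_sum_def)
  have y: "coxeter n c permutes {?m + Suc a + 0<..n}"
    using coxeter_permutes[OF c, of n] n by (metis add.right_neutral add_diff_cancel_right' le_add2)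
  have "q_int (Suc a) * young_sum f n (\<rho> @ [Suc a]) c
      = block_sum (Suc a) (up_cycle (?m + Suc a) 0 \<circ> coxeter n c) / q_fact a / q_fact_part \<rho>"
    using q_int_nonzero[of "Suc a"] by (simp add: as_block_sum q_fact_Suc)
  also have "\<dots> = (\<Sum>i\<le>a. block_sum i (up_cycle (Suc (?m + i)) (a - i) \<circ> coxeter n c) / q_fact i) / q_fact_part \<rho>"
    using block_sum_expand[OF y] n by simp
  also have "\<dots> = (\<Sum>i\<le>a. young_sum f n (\<rho> @ [i]) (Suc (a - i) # c))"
    unfolding sum_divide_distrib as_block_sum
  proof (rule sum.cong)
    fix i assume "i \<in> {..a}"
    then have "Suc n - sum_list c - Suc (a - i) = Suc (?m + i)" using n by auto
    then show "block_sum i (up_cycle (Suc (?m + i)) (a - i) \<circ> coxeter n c) / q_fact i / q_fact_part \<rho>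
        = block_sum i (coxeter n (Suc (a - i) # c)) / q_fact i / q_fact_part \<rho>" by simp
  qed simp
  finally show ?thesis .
qed

section \<open>Coxeter elements of Young subgroups have minimal length\<close>

lemma orbit_up_cycle:
  assumes "x \<in> {k..k+b}" shows "orbit (up_cycle k b) x = {k..k+b}"
proof -
  have step: "up_cycle k b y = Suc y" if "k \<le> y" "y < k + b" for y
    using that by (simp add: up_cycle_def)
  have iter: "(up_cycle k b ^^ i) k = k + i" if "i \<le> b" for i
    using that
  proof (induction i)
    case (Suc i)
    then show ?case using step[of "k + i"] by simp
  qed simp
  have "up_cycle k b (k + b) = k" by (simp add: up_cycle_def)
  then have period: "(up_cycle k b ^^ Suc b) k = k" using iter[OF order_refl] by simp
  have k: "k \<in> orbit (up_cycle k b) k"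
    unfolding orbit_altdef by (intro CollectI exI[of _ "Suc b"] conjI zero_less_Suc period[symmetric])
  have "{k..k+b} \<subseteq> orbit (up_cycle k b) k"
  proof
    fix y assume "y \<in> {k..k+b}"
    then have "(up_cycle k b ^^ (y - k)) k = y" using iter[of "y - k"] by auto
    with funpow_in_orbit[OF k, of "y - k"] show "y \<in> orbit (up_cycle k b) k" by simp
  qed
  moreover have "orbit (up_cycle k b) k \<subseteq> {k..k+b}"
    by (rule permutes_orbit_subset[OF up_cycle_permutes]) simp
  ultimately have "{k..k+b} = orbit (up_cycle k b) k" by (rule equalityI)
  then have "cyclic_on (up_cycle k b) {k..k+b}"
    unfolding cyclic_on_def by (meson atLeastAtMost_iff le_add1 order_refl)
  then show ?thesis using assms by (rule orbit_cyclic_eq3)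
qed

lemma cycle_type_coxeter:
  assumes "0 \<notin> set c" "sum_list c \<le> n"
  shows "image_mset card (mset_set (orbit (coxeter n c) ` {n - sum_list c<..n})) = mset c"
  using assms
proof (induction c)
  case Nil
  have "{n - sum_list []<..n} = {}" by simp
  then show ?case by (simp only: image_empty mset_set.empty image_mset_empty mset.simps)
next
  case (Cons k c)
  have k: "k > 0" and c: "0 \<notin> set c" "sum_list c \<le> n" using Cons.prems by auto
  define m where "m = n - sum_list (k # c)"
  have m: "Suc n - sum_list c - k = Suc m" "n - sum_list c = m + k"
    using Cons.prems by (simp_all add: m_def)
  let ?v = "coxeter n c" and ?u = "up_cycle (Suc m) (k - 1)"
  let ?A = "{m + k<..n}" and ?B = "{Suc m..Suc m + (k - 1)}"
  have v: "?v permutes ?A" using coxeter_permutes[OF c] m by simp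
  have u: "?u permutes ?B" by (rule up_cycle_permutes)
  have split: "{n - sum_list (k # c)<..n} = ?B \<union> ?A" and disj: "?A \<inter> ?B = {}"
    unfolding m_def[symmetric] using k m c by auto
  have orb_B: "orbit (?u \<circ> ?v) x = ?B" if x: "x \<in> ?B" for x
  proof -
    have "orbit ?u x = orbit (?u \<circ> ?v) x"
    proof (rule orbit_cong0[OF x])
      show "?u \<in> ?B \<rightarrow> ?B" using permutes_in_image[OF u] by auto
      fix y assume "y \<in> ?B"
      then have "y \<notin> ?A" using disj by blast
      then show "?u y = (?u \<circ> ?v) y" using permutes_not_in[OF v] by simp
    qed
    then show ?thesis using orbit_up_cycle[OF x] by simp
  qed
  have orb_A: "orbit (?u \<circ> ?v) x = orbit ?v x" if x: "x \<in> ?A" for x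
  proof -
    have "orbit ?v x = orbit (?u \<circ> ?v) x"
    proof (rule orbit_cong0[OF x])
      show vA: "?v \<in> ?A \<rightarrow> ?A" using permutes_in_image[OF v] by auto
      fix y assume "y \<in> ?A"
      then have "?v y \<notin> ?B" using vA disj by blast
      then show "?v y = (?u \<circ> ?v) y" using permutes_not_in[OF u] by simp
    qed
    then show ?thesis by simp
  qed
  have "orbit (?u \<circ> ?v) ` (?B \<union> ?A) = (\<lambda>_. ?B) ` ?B \<union> orbit ?v ` ?A"
    unfolding image_Un using orb_A orb_B by (intro arg_cong2[of _ _ _ _ "(\<union>)"] image_cong) auto
  also have "(\<lambda>_. ?B) ` ?B = {?B}" by (rule image_constant_conv[THEN trans]) simp
  finally have image: "orbit (coxeter n (k # c)) ` {n - sum_list (k # c)<..n} = insert ?B (orbit ?v ` ?A)"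
    unfolding split coxeter.simps m by (simp only: Un_insert_left Un_empty_left)
  have new: "?B \<notin> orbit ?v ` ?A"
  proof
    assume "?B \<in> orbit ?v ` ?A"
    then obtain x where "x \<in> ?A" "?B = orbit ?v x" by blast
    then have "?B \<subseteq> ?A" using permutes_orbit_subset[OF v, of x] by simp
    with disj have "?B = {}" by blast
    then show False by simp
  qed
  have "image_mset card (mset_set (insert ?B (orbit ?v ` ?A)))
      = add_mset (card ?B) (image_mset card (mset_set (orbit ?v ` ?A)))"
    by (subst mset_set.insert[OF _ new]) (rule finite_imageI[OF finite_greaterThanAtMost], rule image_mset_add_mset)
  also have "card ?B = k" using k by simp
  also have "image_mset card (mset_set (orbit ?v ` ?A)) = mset c"
    using Cons.IH[OF c] unfolding m .
  finally have A: "image_mset card (mset_set (insert ?B (orbit ?v ` ?A))) = add_mset k (mset c)" .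
  have B: "image_mset card (mset_set (orbit (coxeter n (k # c)) ` {n - sum_list (k # c)<..n})) = add_mset k (mset c)"
    by (subst image) (rule A)
  have C: "mset (k # c) = add_mset k (mset c)" by (rule mset.simps)
  show ?case by (rule trans[OF B C[symmetric]])
qed

text \<open>For \<open>i < n\<close> these are the indices of the simple reflections that occur in the reduced words of \<open>v\<close>.\<close>

definition moved_prefixes :: "nat \<Rightarrow> (nat \<Rightarrow> nat) \<Rightarrow> nat set" where
  "moved_prefixes n v = {i \<in> {1..n}. v ` {1..i} \<noteq> {1..i}}"

text \<open>Removing a descent shortens \<open>v\<close> by one and loses at most one prefix, because the transposition of \<open>i\<close> and
\<open>i + 1\<close> preserves every other prefix.\<close>

lemma card_moved_prefixes_le:
  assumes "v permutes {1..n}" shows "card (moved_prefixes n v) \<le> perm_length n v"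
  using assms
proof (induction "perm_length n v" arbitrary: v rule: less_induct)
  case less
  note v = less.prems
  show ?case
  proof (cases "\<exists>i. 1 \<le> i \<and> i < n \<and> v (Suc i) < v i")
    case True
    then obtain i where i: "1 \<le> i" "i < n" "v (Suc i) < v i" by auto
    let ?s = "adj_transp i"
    let ?v = "v \<circ> ?s"
    have s: "?s permutes {1..n}" using i by (intro adj_transp_permutes) auto
    have v': "?v permutes {1..n}" by (rule permutes_compose[OF s v])
    have vv: "v = ?v \<circ> ?s" by (simp add: comp_assoc)
    have len: "perm_length n v = perm_length n ?v + 1"
      by (subst vv, rule perm_length_mult_right[OF v' i(1,2)]) (use i in simp)
    have "moved_prefixes n v \<subseteq> insert i (moved_prefixes n ?v)"
    proof
      fix j assume j: "j \<in> moved_prefixes n v"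
      show "j \<in> insert i (moved_prefixes n ?v)"
      proof (cases "j = i")
        case False
        have "?s permutes {1..j}" if "i \<le> j"
          using that False i by (intro adj_transp_permutes) auto
        moreover have "?s ` {1..j} = (\<lambda>x. x) ` {1..j}" if "j < i"
          using that by (intro image_cong) (auto simp: adj_transp_if)
        ultimately have "?s ` {1..j} = {1..j}" using permutes_image by (cases "i \<le> j") auto
        then have "?v ` {1..j} = v ` {1..j}" by (simp only: image_comp[symmetric])
        then show ?thesis using j by (simp add: moved_prefixes_def)
      qed simp
    qed
    then have "card (moved_prefixes n v) \<le> card (insert i (moved_prefixes n ?v))"
      by (rule card_mono[rotated]) (simp add: moved_prefixes_def)
    also have "\<dots> \<le> Suc (card (moved_prefixes n ?v))" by (rule card_insert_le_m1[THEN order_trans]) auto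
    also have "\<dots> \<le> perm_length n v" using less.hyps[OF _ v'] len by simp
    finally show ?thesis .
  next
    case False
    have step: "v i < v (Suc i)" if "1 \<le> i" "i < n" for i
    proof -
      have "v i \<noteq> v (Suc i)" using permutes_inj[OF v] by (metis injD n_not_Suc_n)
      then show ?thesis using False that by (metis linorder_neqE_nat)
    qed
    have "1 \<le> i \<Longrightarrow> i \<le> n \<Longrightarrow> i \<le> v i" for i
    proof (induction i)
      case (Suc i)
      show ?case
      proof (cases "i = 0")
        case True
        then show ?thesis using permutes_in_image[OF v, of "Suc i"] Suc.prems by simp
      next
        case False
        then show ?thesis using Suc step[of i] by simp
      qed
    qed simp
    then have "v = id" by (intro permutes_natset_ge[OF v]) auto
    then show ?thesis by (simp add: moved_prefixes_def)
  qed
qed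

text \<open>A prefix that \<open>v\<close> preserves is a union of orbits, so the orbits of the last points of these prefixes are
pairwise distinct.\<close>

lemma card_orbits_ge:
  assumes v: "v permutes {1..n}"
  shows "n \<le> card (orbit v ` {1..n}) + card (moved_prefixes n v)"
proof -
  let ?F = "{1..n} - moved_prefixes n v"
  have below: "orbit v i \<noteq> orbit v j" if "i \<in> ?F" "j \<in> ?F" "i < j" for i j
  proof -
    have fixed: "v ` {1..i} = {1..i}" using that by (auto simp: moved_prefixes_def)
    have "orbit v i \<subseteq> {1..i}"
    proof
      fix y assume "y \<in> orbit v i"
      then show "y \<in> {1..i}" by induction (use fixed that in auto)
    qed
    moreover have "j \<in> orbit v j"
      by (rule permutation_self_in_orbit) (use v in \<open>auto simp: permutation_permutes\<close>)
    ultimately show ?thesis using that by auto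
  qed
  then have "inj_on (orbit v) ?F" by (rule linorder_inj_onI) auto
  then have "card ?F = card (orbit v ` ?F)" by (simp add: card_image)
  also have "\<dots> \<le> card (orbit v ` {1..n})" by (intro card_mono) auto
  finally have "card ?F \<le> card (orbit v ` {1..n})" .
  moreover have "card ?F = n - card (moved_prefixes n v)"
    by (subst card_Diff_subset) (auto simp: moved_prefixes_def)
  ultimately show ?thesis by simp
qed

lemma conj_class_length_ge:
  assumes "v \<in> conj_class n \<mu>" shows "n \<le> length \<mu> + perm_length n v"
proof -
  have v: "v permutes {1..n}" and "image_mset card (mset_set (orbit v ` {1..n})) = mset \<mu>"
    using assms by (auto simp: conj_class_def)
  then have "card (orbit v ` {1..n}) = length \<mu>"
    by (metis size_image_mset size_mset size_mset_set)
  then show ?thesis using card_orbits_ge[OF v] card_moved_prefixes_le[OF v] by simp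
qed

lemma perm_length_up_cycle_le:
  assumes w: "w permutes {1..n}" and k: "1 \<le> k" "k + b \<le> n"
  shows "perm_length n (up_cycle k b \<circ> w) \<le> perm_length n w + b"
  using k
proof (induction b arbitrary: k)
  case (Suc b)
  let ?w = "up_cycle (Suc k) b \<circ> w" and ?s = "adj_transp k"
  have w': "?w permutes {1..n}"
    by (rule permutes_compose[OF w], rule permutes_subset[OF up_cycle_permutes]) (use Suc.prems in auto)
  have s: "?s permutes {1..n}" using Suc.prems by (intro adj_transp_permutes) auto
  have "perm_length n (?s \<circ> ?w) \<le> perm_length n ?w + 1"
  proof (cases "inv ?w k < inv ?w (Suc k)")
    case True
    then show ?thesis using perm_length_mult_left[OF w' _ _ True] Suc.prems by simp
  next
    case False
    have sw: "?s \<circ> ?w permutes {1..n}" by (rule permutes_compose[OF w' s])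
    have inv: "inv (?s \<circ> ?w) = inv ?w \<circ> ?s"
      using o_inv_distrib[OF permutes_bij[OF s] permutes_bij[OF w']] by simp
    have "inv ?w k \<noteq> inv ?w (Suc k)"
      using permutes_inj[OF permutes_inv[OF w']] by (metis injD n_not_Suc_n)
    then have "inv (?s \<circ> ?w) k < inv (?s \<circ> ?w) (Suc k)" unfolding inv using False by simp
    from perm_length_mult_left[OF sw _ _ this] Suc.prems
    have "perm_length n (?s \<circ> (?s \<circ> ?w)) = perm_length n (?s \<circ> ?w) + 1" by simp
    then show ?thesis by (simp only: adj_transp_comp_cancel)
  qed
  also have "perm_length n ?w \<le> perm_length n w + b"
    using Suc.IH[of "Suc k"] Suc.prems by (simp add: comp_def)
  finally show ?case by (simp add: up_cycle_Suc comp_def)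
qed simp

lemma perm_length_coxeter_le:
  assumes "0 \<notin> set c" "sum_list c \<le> n"
  shows "perm_length n (coxeter n c) + length c \<le> sum_list c"
  using assms
proof (induction c)
  case Nil
  have "inversions n (\<lambda>x. x) = {}" by (auto simp: inversions_def)
  then show ?case by (simp add: perm_length_inversions id_def)
next
  case (Cons k c)
  have c: "0 \<notin> set c" "sum_list c \<le> n" and k: "k > 0" using Cons.prems by auto
  have "coxeter n c permutes {1..n}"
    by (rule permutes_subset[OF coxeter_permutes[OF c]]) auto
  then have "perm_length n (coxeter n (k # c)) \<le> perm_length n (coxeter n c) + (k - 1)"
    unfolding coxeter.simps by (rule perm_length_up_cycle_le) (use Cons.prems k in auto)
  then show ?case using Cons.IH[OF c] k by (simp add: comp_def)
qed

text \<open>The length of a permutation is at least \<open>n\<close> minus the number of its cycles, and the Coxeter element, a product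
of \<open>n - l(c)\<close> simple reflections, attains this bound.\<close>

lemma coxeter_min_length:
  assumes c: "0 \<notin> set c" "sum_list c = n" and \<mu>: "mset \<mu> = mset c"
  shows "min_length_elem n \<mu> (coxeter n c)"
proof -
  have "coxeter n c permutes {1..n}"
    by (rule permutes_subset[OF coxeter_permutes]) (use c in auto)
  moreover have "{n - sum_list c<..n} = {1..n}" using c by auto
  ultimately have "coxeter n c \<in> conj_class n \<mu>"
    using cycle_type_coxeter[of c n] c \<mu> by (simp add: conj_class_def)
  moreover have "perm_length n (coxeter n c) + length \<mu> \<le> n"
    using perm_length_coxeter_le[of c n] c mset_eq_length[OF \<mu>] by simp
  moreover have "perm_length n (coxeter n c) \<le> perm_length n v" if "v \<in> conj_class n \<mu>" for v
    using calculation(2) conj_class_length_ge[OF that] by simp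
  ultimately show ?thesis unfolding min_length_elem_def by (intro conjI ballI)
qed

section \<open>Infinite products and contingency tables\<close>

text \<open>Induction on the variables that occur in a monomial.\<close>

lemma multiset_support_induct [case_names empty add]:
  assumes "P {#}" and step: "\<And>M c i. i \<notin># M \<Longrightarrow> c > 0 \<Longrightarrow> P M \<Longrightarrow> P (M + replicate_mset c i)"
  shows "P M"
proof (induction "card (set_mset M)" arbitrary: M rule: less_induct)
  case less
  show ?case
  proof (cases "M = {#}")
    case False
    then obtain i where i: "i \<in># M" by auto
    let ?N = "filter_mset (\<lambda>j. j \<noteq> i) M"
    have "set_mset ?N \<subset> set_mset M" using i by auto
    then have "card (set_mset ?N) < card (set_mset M)" by (intro psubset_card_mono) auto
    then have "P (?N + replicate_mset (count M i) i)" using i by (intro step less) auto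
    moreover have "?N + replicate_mset (count M i) i = M" by (rule multiset_eqI) auto
    ultimately show ?thesis by simp
  qed (use assms in simp)
qed

text \<open>The coefficient of the monomial \<open>M\<close> in the product of all \<open>F(x\<^sub>i)\<close>. The index type is arbitrary because
the cells of a contingency table will serve as indices too.\<close>

definition fweight :: "'a::comm_ring_1 fps \<Rightarrow> 'b multiset \<Rightarrow> 'a" where
  "fweight F M = (\<Prod>i\<in>set_mset M. fps_nth F (count M i))"

lemma fweight_empty [simp]: "fweight F {#} = 1"
  by (simp add: fweight_def)

lemma fweight_disjoint_add:
  assumes "set_mset M \<inter> set_mset N = {}"
  shows "fweight F (M + N) = fweight F M * fweight F N"
proof -
  have zero: "x \<in># M \<Longrightarrow> count N x = 0" "x \<in># N \<Longrightarrow> count M x = 0" for x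
    using assms by (meson count_eq_zero_iff disjoint_iff)+
  have "fweight F (M + N) = (\<Prod>i\<in>set_mset M. fps_nth F (count (M + N) i))
      * (\<Prod>i\<in>set_mset N. fps_nth F (count (M + N) i))"
    unfolding fweight_def set_mset_union by (rule prod.union_disjoint) (use assms in auto)
  also have "(\<Prod>i\<in>set_mset M. fps_nth F (count (M + N) i)) = fweight F M"
    unfolding fweight_def
    by (rule prod.cong) (simp_all add: zero)
  also have "(\<Prod>i\<in>set_mset N. fps_nth F (count (M + N) i)) = fweight F N"
    unfolding fweight_def
    by (rule prod.cong) (simp_all add: zero)
  finally show ?thesis .
qed

lemma fweight_replicate: "fps_nth F 0 = 1 \<Longrightarrow> fweight F (replicate_mset c i) = fps_nth F c"
  by (cases "c = 0") (auto simp: fweight_def)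

lemma fweight_add_replicate:
  assumes "fps_nth F 0 = 1" "i \<notin># M"
  shows "fweight F (M + replicate_mset c i) = fps_nth F c * fweight F M"
proof -
  have "set_mset M \<inter> set_mset (replicate_mset c i) = {}" using assms by (auto split: if_splits)
  then show ?thesis by (simp add: fweight_disjoint_add fweight_replicate assms mult.commute)
qed

lemma fweight_image_inj: "inj_on f (set_mset M) \<Longrightarrow> fweight F (image_mset f M) = fweight F M"
  unfolding fweight_def set_image_mset
proof (subst prod.reindex, simp, rule prod.cong)
  assume inj: "inj_on f (set_mset M)"
  fix i assume i: "i \<in># M"
  have "f -` {f i} \<inter> set_mset M = {i}" using inj i by (auto dest: inj_onD)
  then show "((\<lambda>i. fps_nth F (count (image_mset f M) i)) \<circ> f) i = fps_nth F (count M i)"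
    by (simp add: count_image_mset)
qed simp

lemma sum_submultisets_add_replicate:
  fixes g :: "'b multiset \<Rightarrow> 'a::comm_monoid_add"
  assumes "i \<notin># M"
  shows "(\<Sum>A | A \<subseteq># M + replicate_mset c i. g A)
       = (\<Sum>a\<le>c. \<Sum>A | A \<subseteq># M. g (A + replicate_mset a i))"
proof -
  have "(\<Sum>a\<le>c. \<Sum>A | A \<subseteq># M. g (A + replicate_mset a i))
      = (\<Sum>(a, A)\<in>{..c} \<times> {A. A \<subseteq># M}. g (A + replicate_mset a i))"
    by (rule sum.cartesian_product)
  also have "\<dots> = (\<Sum>A | A \<subseteq># M + replicate_mset c i. g A)"
  proof (rule sum.reindex_bij_witness[where j = "\<lambda>(a, A). A + replicate_mset a i"
        and i = "\<lambda>A. (count A i, filter_mset (\<lambda>j. j \<noteq> i) A)"])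
    fix p assume "p \<in> {..c} \<times> {A. A \<subseteq># M}"
    then obtain a A where p: "p = (a, A)" "a \<le> c" "A \<subseteq># M" by auto
    have A: "count A i = 0" using p(3) assms by (meson count_eq_zero_iff mset_subset_eqD)
    then have "filter_mset (\<lambda>j. j \<noteq> i) (A + replicate_mset a i) = A"
      by (intro multiset_eqI) auto
    then show "(count (case p of (a, A) \<Rightarrow> A + replicate_mset a i) i,
        filter_mset (\<lambda>j. j \<noteq> i) (case p of (a, A) \<Rightarrow> A + replicate_mset a i)) = p"
      using p A by simp
    have "replicate_mset a i \<subseteq># replicate_mset c i" using p by (simp add: subseteq_mset_def)
    then show "(case p of (a, A) \<Rightarrow> A + replicate_mset a i) \<in> {A. A \<subseteq># M + replicate_mset c i}"
      using subset_mset.add_mono[OF p(3)] p(1) by simp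
  next
    fix A assume "A \<in> {A. A \<subseteq># M + replicate_mset c i}"
    then have sub: "A \<subseteq># M + replicate_mset c i" by simp
    have A: "count A j \<le> count (M + replicate_mset c i) j" for j
      by (rule mset_subset_eq_count[OF sub])
    have "count A i \<le> c" using A[of i] assms by (simp add: not_in_iff)
    moreover have "count A j \<le> count M j" if "j \<noteq> i" for j using A[of j] that by simp
    then have "filter_mset (\<lambda>j. j \<noteq> i) A \<subseteq># M" unfolding subseteq_mset_def by auto
    ultimately show "(count A i, filter_mset (\<lambda>j. j \<noteq> i) A) \<in> {..c} \<times> {A. A \<subseteq># M}" by simp
    show "(case (count A i, filter_mset (\<lambda>j. j \<noteq> i) A) of (a, A) \<Rightarrow> A + replicate_mset a i) = A"
      by (auto intro: multiset_eqI)
  qed auto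
  finally show ?thesis ..
qed

text \<open>Multiplicativity of the infinite product, one variable at a time.\<close>

lemma fweight_mult:
  fixes M :: "'b multiset"
  assumes F: "fps_nth F 0 = 1" and G: "fps_nth G 0 = 1"
  shows "fweight (F * G) M = (\<Sum>A | A \<subseteq># M. fweight F A * fweight G (M - A))"
proof (induction M rule: multiset_support_induct)
  case empty
  have "{A. A \<subseteq># ({#} :: 'b multiset)} = {{#}}" by auto
  then show ?case by simp
next
  case (add M c i)
  have FG: "fps_nth (F * G) 0 = 1" using F G by simp
  have "(\<Sum>A | A \<subseteq># M + replicate_mset c i. fweight F A * fweight G (M + replicate_mset c i - A))
      = (\<Sum>a\<le>c. \<Sum>A | A \<subseteq># M. fps_nth F a * fps_nth G (c - a) * (fweight F A * fweight G (M - A)))"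
    unfolding sum_submultisets_add_replicate[OF add.hyps(1)]
  proof (intro sum.cong refl)
    fix a A assume a: "a \<in> {..c}" and A: "A \<in> {A. A \<subseteq># M}"
    have i: "i \<notin># A" "i \<notin># M - A"
      using A add.hyps(1) by (auto dest: mset_subset_eqD in_diffD)
    have "M + replicate_mset c i - (A + replicate_mset a i) = (M - A) + replicate_mset (c - a) i"
      using A a by (intro multiset_eqI) (auto simp: subseteq_mset_def)
    then show "fweight F (A + replicate_mset a i) * fweight G (M + replicate_mset c i - (A + replicate_mset a i))
        = fps_nth F a * fps_nth G (c - a) * (fweight F A * fweight G (M - A))"
      using i F G by (simp add: fweight_add_replicate)
  qed
  also have "\<dots> = fps_nth (F * G) c * fweight (F * G) M"
    unfolding add.IH by (simp add: fps_mult_nth sum_product atLeast0AtMost)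
  finally show ?case by (simp only: fweight_add_replicate[OF FG add.hyps(1)])
qed

lemma xcoeff_prod_coeff: "xcoeff (prod_coeff F r) M = (if int (size M) = r then fweight F M else 0)"
  by (simp only: prod_coeff_def fweight_def Xseries_inverse[OF UNIV_I])

lemma xcoeff_sum: "xcoeff (\<Sum>i\<in>A. g i) M = (\<Sum>i\<in>A. xcoeff (g i) M)"
  by (induction A rule: infinite_finite_induct) (auto simp: zero_xseries.rep_eq plus_xseries.rep_eq)

lemma prod_coeff_neg [simp]: "r < 0 \<Longrightarrow> prod_coeff F r = 0"
  by (rule xseries_eqI) (simp add: xcoeff_prod_coeff zero_xseries.rep_eq)

lemma prod_coeff_0 [simp]: "prod_coeff F 0 = 1"
  by (rule xseries_eqI) (simp add: xcoeff_prod_coeff one_xseries.rep_eq)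

lemma prod_coeff_mult:
  assumes F: "fps_nth F 0 = 1" and G: "fps_nth G 0 = 1"
  shows "prod_coeff (F * G) (int n) = (\<Sum>k\<le>n. prod_coeff F (int k) * prod_coeff G (int (n - k)))"
proof (rule xseries_eqI)
  fix M
  have "xcoeff (\<Sum>k\<le>n. prod_coeff F (int k) * prod_coeff G (int (n - k))) M
      = (\<Sum>A | A \<subseteq># M. \<Sum>k\<le>n. if k = size A then if size M = n then fweight F A * fweight G (M - A) else 0 else 0)"
    unfolding xcoeff_sum times_xseries.rep_eq
    by (subst sum.swap, intro sum.cong refl)
      (auto simp: xcoeff_prod_coeff size_Diff_submset dest: size_mset_mono)
  also have "\<dots> = (\<Sum>A | A \<subseteq># M. if size M = n then fweight F A * fweight G (M - A) else 0)"
    by (intro sum.cong refl) (auto dest: size_mset_mono)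
  also have "\<dots> = xcoeff (prod_coeff (F * G) (int n)) M"
    by (simp add: xcoeff_prod_coeff fweight_mult[OF F G])
  finally show "xcoeff (prod_coeff (F * G) (int n)) M
      = xcoeff (\<Sum>k\<le>n. prod_coeff F (int k) * prod_coeff G (int (n - k))) M" ..
qed

text \<open>A contingency table with row sums \<open>R\<close> and column sums \<open>M\<close>, encoded as the multiset of its cells, each
repeated as often as its entry says; transposition is then the exchange of the components of the pairs.\<close>

definition contingency :: "'b multiset \<Rightarrow> 'c multiset \<Rightarrow> ('b \<times> 'c) multiset set" where
  "contingency R M = {D. image_mset fst D = R \<and> image_mset snd D = M}"

lemma finite_contingency: "finite (contingency R M)"
proof (rule finite_subset)
  show "contingency R M \<subseteq> {D. D \<subseteq># repeat_mset (size R) (mset_set (set_mset R \<times> set_mset M))}"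
  proof
    fix D assume "D \<in> contingency R M"
    then have D: "image_mset fst D = R" "image_mset snd D = M" by (auto simp: contingency_def)
    have "count D p \<le> count (repeat_mset (size R) (mset_set (set_mset R \<times> set_mset M))) p" for p
    proof (cases "p \<in># D")
      case True
      then have "p \<in> set_mset R \<times> set_mset M" using D by (cases p) force
      moreover have "count D p \<le> size R" using count_le_size[of D p] D(1) by (metis size_image_mset)
      ultimately show ?thesis by simp
    qed (simp add: not_in_iff)
    then show "D \<in> {D. D \<subseteq># repeat_mset (size R) (mset_set (set_mset R \<times> set_mset M))}"
      by (simp add: subseteq_mset_def)
  qed
qed (rule finite_submultisets)

text \<open>To choose a monomial from each factor such that the product is \<open>M\<close> means to choose the rows of a table. The proof
adds one row \<open>j\<close> at a time.\<close>

lemma xcoeff_prod_prod_coeff: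
  fixes R :: "'b multiset"
  shows "xcoeff (\<Prod>j\<in>set_mset R. prod_coeff F (int (count R j))) M = (\<Sum>D\<in>contingency R M. fweight F D)"
proof (induction R arbitrary: M rule: multiset_support_induct)
  case empty
  have eq: "contingency ({#} :: 'b multiset) M = (if M = {#} then {{#}} else {})"
    by (auto simp: contingency_def)
  show ?case unfolding eq by (simp add: one_xseries.rep_eq)
next
  case (add R c j)
  let ?Q = "\<lambda>R. \<Prod>j\<in>set_mset R. prod_coeff F (int (count R j))"
  let ?row = "image_mset (Pair j)"
  have "?Q (R + replicate_mset c j) = prod_coeff F (int c) * (\<Prod>k\<in>set_mset R. prod_coeff F (int (count (R + replicate_mset c j) k)))"
    using add.hyps by (simp add: not_in_iff)
  also have "(\<Prod>k\<in>set_mset R. prod_coeff F (int (count (R + replicate_mset c j) k))) = ?Q R"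
    by (rule prod.cong) (use add.hyps in auto)
  finally have "xcoeff (?Q (R + replicate_mset c j)) M
      = (\<Sum>A | A \<subseteq># M. (if size A = c then fweight F A else 0) * (\<Sum>D\<in>contingency R (M - A). fweight F D))"
    by (simp add: times_xseries.rep_eq xcoeff_prod_coeff add.IH)
  also have "\<dots> = (\<Sum>A | A \<subseteq># M \<and> size A = c. \<Sum>D\<in>contingency R (M - A). fweight F A * fweight F D)"
    unfolding sum_distrib_left
    by (rule sum.mono_neutral_cong_right) (auto simp: finite_submultisets)
  also have "\<dots> = (\<Sum>(A, D)\<in>(SIGMA A:{A. A \<subseteq># M \<and> size A = c}. contingency R (M - A)). fweight F A * fweight F D)"
    by (rule sum.Sigma) (auto intro: finite_contingency finite_subset[OF _ finite_submultisets])
  also have "\<dots> = (\<Sum>D\<in>contingency (R + replicate_mset c j) M. fweight F D)"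
  proof (rule sum.reindex_bij_witness[where j = "\<lambda>(A, D). D + ?row A"
        and i = "\<lambda>D. (image_mset snd (filter_mset (\<lambda>p. fst p = j) D), filter_mset (\<lambda>p. fst p \<noteq> j) D)"])
    fix p assume "p \<in> (SIGMA A:{A. A \<subseteq># M \<and> size A = c}. contingency R (M - A))"
    then obtain A D where p: "p = (A, D)" "A \<subseteq># M" "size A = c"
      and D: "image_mset fst D = R" "image_mset snd D = M - A" by (auto simp: contingency_def)
    have jD: "(j, b) \<notin># D" for b using D(1) add.hyps(1) by (metis fst_conv image_eqI set_image_mset)
    have "filter_mset (\<lambda>p. fst p = j) (D + ?row A) = ?row A" "filter_mset (\<lambda>p. fst p \<noteq> j) (D + ?row A) = D"
      using jD by (auto intro!: multiset_eqI simp: count_eq_zero_iff)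
    then show "(image_mset snd (filter_mset (\<lambda>p. fst p = j) (case p of (A, D) \<Rightarrow> D + ?row A)),
        filter_mset (\<lambda>p. fst p \<noteq> j) (case p of (A, D) \<Rightarrow> D + ?row A)) = p"
      using p by (simp add: multiset.map_comp comp_def)
    show "(case p of (A, D) \<Rightarrow> D + ?row A) \<in> contingency (R + replicate_mset c j) M"
      using p D by (simp add: contingency_def multiset.map_comp comp_def image_mset_const_eq)
    have "set_mset D \<inter> set_mset (?row A) = {}" using jD by auto
    then show "fweight F (case p of (A, D) \<Rightarrow> D + ?row A) = (case p of (A, D) \<Rightarrow> fweight F A * fweight F D)"
      using p by (simp add: fweight_disjoint_add fweight_image_inj inj_on_def mult.commute)
  next
    fix D assume "D \<in> contingency (R + replicate_mset c j) M"
    then have D: "image_mset fst D = R + replicate_mset c j" "image_mset snd D = M"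
      by (auto simp: contingency_def)
    let ?D1 = "filter_mset (\<lambda>p. fst p = j) D" and ?D2 = "filter_mset (\<lambda>p. fst p \<noteq> j) D"
    have split: "D = ?D1 + ?D2" by (rule multiset_partition)
    have "image_mset (Pair j) (image_mset snd ?D1) = image_mset id ?D1"
      unfolding multiset.map_comp by (rule image_mset_cong) auto
    then have row: "?row (image_mset snd ?D1) = ?D1" by simp
    then show "(case (image_mset snd ?D1, ?D2) of (A, D) \<Rightarrow> D + ?row A) = D"
      using split by (simp add: add.commute)
    have "image_mset fst ?D1 = filter_mset (\<lambda>k. k = j) (image_mset fst D)"
      by (simp add: filter_mset_image_mset)
    also have "\<dots> = replicate_mset c j" unfolding D(1) using add.hyps(1)
      by (intro multiset_eqI) (auto simp: not_in_iff)
    finally have "size ?D1 = c" by (metis size_image_mset size_replicate_mset)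
    moreover have "image_mset fst ?D2 = filter_mset (\<lambda>k. k \<noteq> j) (image_mset fst D)"
      by (simp add: filter_mset_image_mset)
    then have "image_mset fst ?D2 = R" unfolding D(1) using add.hyps(1)
      by (simp, intro multiset_eqI) (auto simp: not_in_iff)
    moreover have M: "M = image_mset snd ?D1 + image_mset snd ?D2"
      using D(2) split by (metis image_mset_union)
    ultimately show "(image_mset snd ?D1, ?D2) \<in> (SIGMA A:{A. A \<subseteq># M \<and> size A = c}. contingency R (M - A))"
      by (simp add: contingency_def)
  qed
  finally show ?case .
qed

text \<open>Transposition of tables preserves the weight.\<close>

lemma prod_coeff_duality:
  "xcoeff (\<Prod>j\<in>set_mset R. prod_coeff F (int (count R j))) M
     = xcoeff (\<Prod>i\<in>set_mset M. prod_coeff F (int (count M i))) R"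
  unfolding xcoeff_prod_prod_coeff
  by (rule sum.reindex_bij_witness[where i = "image_mset prod.swap" and j = "image_mset prod.swap"])
    (auto simp: contingency_def multiset.map_comp comp_def fweight_image_inj)

text \<open>The monomial with exponent vector \<open>c\<close>.\<close>

definition monom_of :: "nat list \<Rightarrow> nat multiset" where
  "monom_of c = (\<Sum>i<length c. replicate_mset (c ! i) i)"

lemma count_monom_of: "count (monom_of c) i = (if i < length c then c ! i else 0)"
  by (simp add: monom_of_def count_sum sum.delta)

lemma set_monom_of: "set_mset (monom_of c) = {i. i < length c \<and> c ! i \<noteq> 0}"
  by (auto simp: set_mset_def count_monom_of split: if_splits)

definition prod_list_coeff :: "ratfun fps \<Rightarrow> nat list \<Rightarrow> ratfun xseries" where
  "prod_list_coeff F c = prod_list (map (\<lambda>r. prod_coeff F (int r)) c)"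

lemma prod_list_coeff_monom_of:
  "prod_list_coeff F c = (\<Prod>i\<in>set_mset (monom_of c). prod_coeff F (int (count (monom_of c) i)))"
proof -
  have "prod_list_coeff F c = (\<Prod>i<length c. prod_coeff F (int (c ! i)))"
    unfolding prod_list_coeff_def prod.list_conv_set_nth by (simp add: atLeast0LessThan)
  also have "\<dots> = (\<Prod>i\<in>set_mset (monom_of c). prod_coeff F (int (c ! i)))"
    by (rule prod.mono_neutral_right) (auto simp: set_monom_of)
  also have "\<dots> = (\<Prod>i\<in>set_mset (monom_of c). prod_coeff F (int (count (monom_of c) i)))"
    by (rule prod.cong) (auto simp: set_monom_of count_monom_of)
  finally show ?thesis .
qed

lemma prod_list_coeff_duality:
  "xcoeff (prod_list_coeff F r) (monom_of c) = xcoeff (prod_list_coeff F c) (monom_of r)"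
  unfolding prod_list_coeff_monom_of by (rule prod_coeff_duality)

section \<open>Complete and big complete symmetric functions\<close>

definition h_fps :: "ratfun fps" where "h_fps = 1 / (1 - fps_X)"
definition q_fps :: "ratfun fps" where "q_fps = (1 - fps_const t_var * fps_X) / (1 - fps_X)"

lemma complete_sym_h_fps: "complete_sym = prod_coeff h_fps"
  by (simp only: complete_sym_def h_fps_def)

lemma q_sym_q_fps: "q_sym = prod_coeff q_fps"
  by (simp only: q_sym_def q_fps_def)

lemma one_minus_fps_X_nonzero: "(1 - fps_X :: 'a::field fps) \<noteq> 0"
proof
  assume "(1 - fps_X :: 'a fps) = 0"
  then have "fps_nth (1 - fps_X :: 'a fps) 0 = 0" by simp
  then show False by simp
qed

lemma h_fps_eq: "h_fps = Abs_fps (\<lambda>_. 1)"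
proof -
  have "1 = Abs_fps (\<lambda>_. 1) * (1 - fps_X :: ratfun fps)"
    by (rule fps_ext) (simp add: right_diff_distrib fps_X_mult_right_nth)
  then have "h_fps = Abs_fps (\<lambda>_. 1) * (1 - fps_X) / (1 - fps_X)" by (simp only: h_fps_def)
  then show ?thesis by (simp only: nonzero_mult_div_cancel_right[OF one_minus_fps_X_nonzero])
qed

lemma q_fps_eq: "q_fps = Abs_fps (\<lambda>k. if k = 0 then 1 else 1 - t_var)"
proof -
  let ?Q = "Abs_fps (\<lambda>k. if k = 0 then 1 else 1 - t_var)"
  have "1 - fps_const t_var * fps_X = ?Q * (1 - fps_X)"
    by (rule fps_ext) (auto simp: right_diff_distrib fps_X_mult_right_nth)
  then show ?thesis by (simp only: q_fps_def nonzero_mult_div_cancel_right[OF one_minus_fps_X_nonzero])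
qed

lemma h_fps_nth [simp]: "fps_nth h_fps k = 1"
  unfolding h_fps_eq by simp

lemma q_fps_nth: "fps_nth q_fps k = (if k = 0 then 1 else 1 - t_var)"
  unfolding q_fps_eq by simp

text \<open>The factorization \<open>H(y) = Q(y) H(ty)\<close> for one variable.\<close>

lemma h_fps_factor: "h_fps = q_fps * Abs_fps (\<lambda>k. t_var ^ k)"
proof -
  let ?T = "Abs_fps (\<lambda>k. t_var ^ k)"
  have T: "(1 - fps_const t_var * fps_X) * ?T = 1"
  proof (rule fps_ext)
    fix k show "fps_nth ((1 - fps_const t_var * fps_X) * ?T) k = fps_nth 1 k"
      by (cases k) (simp_all add: left_diff_distrib mult.assoc)
  qed
  have "q_fps * (1 - fps_X) = 1 - fps_const t_var * fps_X"
    unfolding q_fps_eq by (rule fps_ext) (auto simp: right_diff_distrib fps_X_mult_right_nth)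
  then have "q_fps * (1 - fps_X) * ?T = 1" by (simp only: T)
  then have "h_fps = q_fps * ?T * (1 - fps_X) / (1 - fps_X)" by (simp only: h_fps_def mult_ac)
  then show ?thesis by (simp only: nonzero_mult_div_cancel_right[OF one_minus_fps_X_nonzero])
qed

lemma xscale_mult_left: "xscale c f * g = xscale c (f * g)"
  by (rule xseries_eqI) (simp add: times_xseries.rep_eq xscale.rep_eq sum_distrib_left mult.assoc)

lemma xscale_mult_right: "f * xscale c g = xscale c (f * g)"
  by (metis mult.commute xscale_mult_left)

lemma prod_coeff_geometric:
  "prod_coeff (Abs_fps (\<lambda>k. t_var ^ k)) (int r) = xscale (t_var ^ r) (prod_coeff h_fps (int r))"
proof (rule xseries_eqI)
  fix M :: "nat multiset"
  have "fweight (Abs_fps (\<lambda>k. t_var ^ k)) M = t_var ^ size M"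
    by (simp add: fweight_def power_sum size_multiset_overloaded_eq)
  then show "xcoeff (prod_coeff (Abs_fps (\<lambda>k. t_var ^ k)) (int r)) M
      = xcoeff (xscale (t_var ^ r) (prod_coeff h_fps (int r))) M"
    by (simp add: xcoeff_prod_coeff xscale.rep_eq fweight_def)
qed

lemma h_recursion:
  "xscale (1 - t_var ^ Suc a) (prod_coeff h_fps (int (Suc a)))
     = (\<Sum>i\<le>a. xscale (t_var ^ i) (prod_coeff h_fps (int i) * prod_coeff q_fps (int (Suc (a - i)))))"
proof -
  let ?h = "\<lambda>i. prod_coeff h_fps (int i)" and ?q = "\<lambda>i. prod_coeff q_fps (int i)"
  let ?T = "Abs_fps (\<lambda>k. t_var ^ k)"
  have "?h (Suc a) = (\<Sum>k\<le>Suc a. ?q k * prod_coeff ?T (int (Suc a - k)))"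
    by (subst h_fps_factor, rule prod_coeff_mult) (simp_all add: q_fps_nth)
  also have "\<dots> = (\<Sum>k\<le>Suc a. xscale (t_var ^ (Suc a - k)) (?h (Suc a - k) * ?q k))"
    by (simp only: prod_coeff_geometric xscale_mult_right mult.commute)
  also have "\<dots> = (\<Sum>i\<le>Suc a. xscale (t_var ^ i) (?h i * ?q (Suc a - i)))"
    by (rule sum.reindex_bij_witness[where i = "\<lambda>i. Suc a - i" and j = "\<lambda>i. Suc a - i"]) auto
  also have "\<dots> = (\<Sum>i\<le>a. xscale (t_var ^ i) (?h i * ?q (Suc a - i))) + xscale (t_var ^ Suc a) (?h (Suc a))"
    by (simp only: sum.atMost_Suc diff_self_eq_0 of_nat_0 prod_coeff_0 mult_1_right)
  finally have "?h (Suc a) - xscale (t_var ^ Suc a) (?h (Suc a)) = (\<Sum>i\<le>a. xscale (t_var ^ i) (?h i * ?q (Suc a - i)))"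
    by (simp only: diff_eq_eq)
  \<comment> \<open>The term with \<open>k = 0\<close> is a multiple of the left-hand side and has been moved there.\<close>
  also have "?h (Suc a) - xscale (t_var ^ Suc a) (?h (Suc a)) = xscale (1 - t_var ^ Suc a) (?h (Suc a))"
    by (simp only: xser.scale_left_diff_distrib xser.scale_one)
  also have "(\<Sum>i\<le>a. xscale (t_var ^ i) (?h i * ?q (Suc a - i)))
      = (\<Sum>i\<le>a. xscale (t_var ^ i) (?h i * ?q (Suc (a - i))))"
    by (intro sum.cong) (auto simp: Suc_diff_le)
  finally show ?thesis .
qed

lemma xcoeff_power_sum_mult:
  assumes "k > 0"
  shows "xcoeff (power_sum k * g) M = (\<Sum>i | i \<in># M \<and> k \<le> count M i. xcoeff g (M - replicate_mset k i))"
proof -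
  have inj: "inj_on (replicate_mset k) {i. i \<in># M \<and> k \<le> count M i}"
    using assms by (auto simp: inj_on_def replicate_mset_eq_iff)
  have "xcoeff (power_sum k * g) M
      = (\<Sum>A | A \<subseteq># M. of_bool (\<exists>i. A = replicate_mset k i) * xcoeff g (M - A))"
    by (simp only: times_xseries.rep_eq power_sum_def Xseries_inverse[OF UNIV_I])
  also have "\<dots> = (\<Sum>A\<in>replicate_mset k ` {i. i \<in># M \<and> k \<le> count M i}. xcoeff g (M - A))"
  proof (rule sum.mono_neutral_cong_right[OF finite_submultisets])
    show "replicate_mset k ` {i. i \<in># M \<and> k \<le> count M i} \<subseteq> {A. A \<subseteq># M}"
      by (auto simp: count_le_replicate_mset_subset_eq)
    show "\<forall>A\<in>{A. A \<subseteq># M} - replicate_mset k ` {i. i \<in># M \<and> k \<le> count M i}.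
        of_bool (\<exists>i. A = replicate_mset k i) * xcoeff g (M - A) = 0"
    proof
      fix A assume A: "A \<in> {A. A \<subseteq># M} - replicate_mset k ` {i. i \<in># M \<and> k \<le> count M i}"
      have False if "A = replicate_mset k i" for i
      proof -
        have "k \<le> count M i" using A that by (simp add: count_le_replicate_mset_subset_eq)
        moreover then have "i \<in># M" using assms by (meson count_greater_zero_iff less_le_trans)
        ultimately show False using A that by blast
      qed
      then have "\<not> (\<exists>i. A = replicate_mset k i)" by blast
      then show "of_bool (\<exists>i. A = replicate_mset k i) * xcoeff g (M - A) = 0" by simp
    qed
  qed auto
  also have "\<dots> = (\<Sum>i | i \<in># M \<and> k \<le> count M i. xcoeff g (M - replicate_mset k i))"
    unfolding sum.reindex[OF inj] by simp
  finally show ?thesis .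
qed

text \<open>Newton's identity for one variable, from the logarithmic derivative of \<open>(1 - ty) / (1 - y)\<close>.\<close>

lemma newton_weights:
  "(\<Sum>k=1..c. (1 - t_var ^ k) * fps_nth q_fps (c - k)) = of_nat c * fps_nth q_fps c"
proof (cases c)
  case (Suc m)
  have A: "(\<Sum>k=1..c. (1 - t_var ^ k) * fps_nth q_fps (c - k))
      = (1 - t_var) * (\<Sum>k=1..m. 1 - t_var ^ k) + (1 - t_var ^ c)"
    unfolding Suc sum_distrib_left by (simp add: q_fps_nth mult.commute)
  have B: "(1 - t_var) * (\<Sum>k=1..m. 1 - t_var ^ k) = (1 - t_var) * of_nat m - (t_var - t_var ^ Suc m)" for m
    by (induction m) (simp_all add: algebra_simps)
  show ?thesis unfolding A B by (simp add: Suc q_fps_nth algebra_simps)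
qed simp

text \<open>In the coefficient of a monomial, the power sums select one variable, so that the sum splits into the identities
for the single variables.\<close>

lemma newton_identity:
  "xscale (of_nat n) (prod_coeff q_fps (int n))
     = (\<Sum>k=1..n. xscale (1 - t_var ^ k) (power_sum k * prod_coeff q_fps (int (n - k))))"
proof (rule xseries_eqI)
  fix M :: "nat multiset"
  let ?w = "\<lambda>i. fweight q_fps (filter_mset (\<lambda>j. j \<noteq> i) M)"
  have w: "fweight q_fps (M - replicate_mset k i) = fps_nth q_fps (count M i - k) * ?w i" for k i
  proof -
    have "M - replicate_mset k i = filter_mset (\<lambda>j. j \<noteq> i) M + replicate_mset (count M i - k) i"
      by (rule multiset_eqI) auto
    then show ?thesis by (simp only:) (rule fweight_add_replicate, simp_all add: q_fps_nth)
  qed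
  have per: "(\<Sum>k=1..count M i. (1 - t_var ^ k) * fps_nth q_fps (count M i - k) * ?w i)
      = of_nat (count M i) * fweight q_fps M" for i
    unfolding sum_distrib_right[symmetric] newton_weights
    using w[of 0 i] by (simp only: replicate_mset_0 diff_zero mult.assoc)
  have total: "(\<Sum>i\<in>set_mset M. of_nat (count M i) * fweight q_fps M) = of_nat (size M) * fweight q_fps M"
    by (simp only: sum_distrib_right[symmetric] size_multiset_overloaded_eq of_nat_sum)
  have size: "(k \<le> n \<and> size (M - replicate_mset k i) = n - k) \<longleftrightarrow> size M = n" if "k \<le> count M i" for k i
  proof -
    have "replicate_mset k i \<subseteq># M" using that by (simp add: count_le_replicate_mset_subset_eq)
    then have "size (M - replicate_mset k i) = size M - k" "k \<le> size M"
      using size_mset_mono by (fastforce simp: size_Diff_submset)+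
    then show ?thesis by auto
  qed
  have "xcoeff (\<Sum>k=1..n. xscale (1 - t_var ^ k) (power_sum k * prod_coeff q_fps (int (n - k)))) M
      = (\<Sum>k=1..n. \<Sum>i | i \<in># M \<and> k \<le> count M i. (1 - t_var ^ k) *
          (if size (M - replicate_mset k i) = n - k then fweight q_fps (M - replicate_mset k i) else 0))"
    unfolding xcoeff_sum
  proof (intro sum.cong refl)
    fix k assume "k \<in> {1..n}"
    then have k: "k > 0" by simp
    show "xcoeff (xscale (1 - t_var ^ k) (power_sum k * prod_coeff q_fps (int (n - k)))) M
        = (\<Sum>i | i \<in># M \<and> k \<le> count M i. (1 - t_var ^ k) *
            (if size (M - replicate_mset k i) = n - k then fweight q_fps (M - replicate_mset k i) else 0))"
      unfolding xscale.rep_eq xcoeff_power_sum_mult[OF k] xcoeff_prod_coeff of_nat_eq_iff sum_distrib_left ..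
  qed
  also have "\<dots> = (\<Sum>k=1..n. \<Sum>i | i \<in># M \<and> k \<le> count M i.
      if size M = n then (1 - t_var ^ k) * fps_nth q_fps (count M i - k) * ?w i else 0)"
    by (intro sum.cong refl) (use size in \<open>auto simp: w mult.assoc\<close>)
  also have "\<dots> = (if size M = n then \<Sum>k=1..n. \<Sum>i | i \<in># M \<and> k \<le> count M i.
      (1 - t_var ^ k) * fps_nth q_fps (count M i - k) * ?w i else 0)"
    by simp
  also have "\<dots> = (if size M = n then \<Sum>i\<in>set_mset M. \<Sum>k=1..count M i.
      (1 - t_var ^ k) * fps_nth q_fps (count M i - k) * ?w i else 0)"
  proof (intro if_cong refl)
    assume n: "size M = n"
    have le: "count M i \<le> n" for i unfolding n[symmetric] by (rule count_le_size)
    have "(\<Sum>k=1..n. \<Sum>i | i \<in># M \<and> k \<le> count M i. (1 - t_var ^ k) * fps_nth q_fps (count M i - k) * ?w i)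
        = (\<Sum>i\<in>set_mset M. \<Sum>k\<in>{k \<in> {1..n}. k \<le> count M i}. (1 - t_var ^ k) * fps_nth q_fps (count M i - k) * ?w i)"
      by (rule sum.swap_restrict) auto
    also have "\<dots> = (\<Sum>i\<in>set_mset M. \<Sum>k=1..count M i. (1 - t_var ^ k) * fps_nth q_fps (count M i - k) * ?w i)"
    proof (intro sum.cong refl)
      fix i show "{k \<in> {1..n}. k \<le> count M i} = {1..count M i}" using le[of i] by auto
    qed
    finally show "(\<Sum>k=1..n. \<Sum>i | i \<in># M \<and> k \<le> count M i. (1 - t_var ^ k) * fps_nth q_fps (count M i - k) * ?w i)
        = (\<Sum>i\<in>set_mset M. \<Sum>k=1..count M i. (1 - t_var ^ k) * fps_nth q_fps (count M i - k) * ?w i)" .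
  qed
  also have "\<dots> = (if size M = n then \<Sum>i\<in>set_mset M. of_nat (count M i) * fweight q_fps M else 0)"
    unfolding per ..
  also have "\<dots> = (if size M = n then of_nat n * fweight q_fps M else 0)"
    unfolding total by auto
  also have "\<dots> = xcoeff (xscale (of_nat n) (prod_coeff q_fps (int n))) M"
    by (simp add: xscale.rep_eq xcoeff_prod_coeff)
  finally show "xcoeff (xscale (of_nat n) (prod_coeff q_fps (int n))) M
      = xcoeff (\<Sum>k=1..n. xscale (1 - t_var ^ k) (power_sum k * prod_coeff q_fps (int (n - k)))) M" ..
qed

section \<open>Monomial symmetric functions\<close>

definition exponents :: "nat multiset \<Rightarrow> nat multiset" where
  "exponents M = image_mset (count M) (mset_set (set_mset M))"

lemma xcoeff_mono_sym: "xcoeff (mono_sym \<nu>) M = of_bool (exponents M = mset \<nu>)"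
  by (simp only: mono_sym_def exponents_def Xseries_inverse[OF UNIV_I])

lemma size_eq_sum_exponents: "size M = sum_mset (exponents M)"
  by (simp add: exponents_def size_multiset_overloaded_eq sum_unfold_sum_mset)

lemma zero_notin_exponents: "0 \<notin># exponents M"
  by (auto simp: exponents_def count_eq_zero_iff)

lemma exponents_monom_of:
  assumes "0 \<notin> set c" shows "exponents (monom_of c) = mset c"
proof -
  have pos: "c ! i \<noteq> 0" if "i < length c" for i using assms nth_mem[OF that] by metis
  have "set_mset (monom_of c) = {..<length c}"
    using pos by (auto simp: set_monom_of)
  then have "exponents (monom_of c) = image_mset (\<lambda>i. c ! i) (mset_set {..<length c})"
    unfolding exponents_def by (simp only:) (rule image_mset_cong, simp add: count_monom_of)
  also have "\<dots> = mset (map (\<lambda>i. c ! i) [0..<length c])"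
    by (simp only: mset_map mset_upt atLeast0LessThan)
  finally show ?thesis by (simp only: map_nth)
qed

lemma partition_zero_notin: "is_partition \<alpha> \<Longrightarrow> 0 \<notin> set \<alpha>"
  by (auto simp: is_partition_def)

lemma partition_eqI:
  assumes "is_partition \<alpha>" "is_partition \<beta>" "mset \<alpha> = mset \<beta>" shows "\<alpha> = \<beta>"
proof -
  have "sorted (rev \<alpha>)" "sorted (rev \<beta>)"
    using assms by (simp_all add: is_partition_def sorted_wrt_rev)
  then have "rev \<alpha> = rev \<beta>" using assms(3) by (metis mset_rev properties_for_sort)
  then show ?thesis by simp
qed

definition to_partition :: "nat multiset \<Rightarrow> nat list" where
  "to_partition N = rev (sorted_list_of_multiset N)"

lemma mset_to_partition [simp]: "mset (to_partition N) = N"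
  by (simp add: to_partition_def)

lemma to_partition_is_partition: "0 \<notin># N \<Longrightarrow> is_partition (to_partition N)"
  by (auto simp: to_partition_def is_partition_def sorted_wrt_rev sorted_sorted_list_of_multiset
      intro: gr0I)

lemma to_partition_partitions_of: "0 \<notin># N \<Longrightarrow> to_partition N \<in> partitions_of (sum_mset N)"
  by (simp add: partitions_of_def to_partition_is_partition flip: sum_mset_sum_list)

lemma finite_partitions_of: "finite (partitions_of n)"
proof (rule finite_subset)
  show "partitions_of n \<subseteq> {xs. set xs \<subseteq> {..n} \<and> length xs \<le> n}"
  proof
    fix xs assume "xs \<in> partitions_of n"
    then have xs: "sum_list xs = n" "\<forall>k\<in>set xs. 0 < k" by (auto simp: partitions_of_def is_partition_def)
    have "x \<le> n" if "x \<in> set xs" for x using member_le_sum_list[OF that] xs by simp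
    moreover have "length xs \<le> sum_list xs" using xs(2) by (induction xs) auto
    ultimately show "xs \<in> {xs. set xs \<subseteq> {..n} \<and> length xs \<le> n}" using xs by auto
  qed
  show "finite {xs. set xs \<subseteq> {..n} \<and> length xs \<le> n}" by (rule finite_lists_length_le) simp
qed

text \<open>A series is symmetric if its coefficients depend only on the multiset of exponents; this
expresses invariance under permutations of the variables.\<close>

definition homogeneous_symmetric :: "nat \<Rightarrow> ratfun xseries \<Rightarrow> bool" where
  "homogeneous_symmetric n f \<longleftrightarrow> (\<forall>M. size M \<noteq> n \<longrightarrow> xcoeff f M = 0) \<and>
     (\<forall>M N. exponents M = exponents N \<longrightarrow> xcoeff f M = xcoeff f N)"

lemma homogeneous_symmetric_expand:
  assumes "homogeneous_symmetric n f"
  shows "f = (\<Sum>\<nu>\<in>partitions_of n. xscale (xcoeff f (monom_of \<nu>)) (mono_sym \<nu>))"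
proof (rule xseries_eqI)
  fix M
  let ?\<alpha> = "to_partition (exponents M)"
  have zero: "xcoeff f A = 0" if "size A \<noteq> n" for A
    using assms that unfolding homogeneous_symmetric_def by blast
  have symm: "xcoeff f A = xcoeff f B" if "exponents A = exponents B" for A B
    using assms that unfolding homogeneous_symmetric_def by blast
  have \<alpha>: "is_partition ?\<alpha>" by (rule to_partition_is_partition[OF zero_notin_exponents])
  have eq: "exponents M = mset \<nu> \<longleftrightarrow> \<nu> = ?\<alpha>" if "\<nu> \<in> partitions_of n" for \<nu>
  proof
    assume "exponents M = mset \<nu>"
    then have "mset \<nu> = mset ?\<alpha>" by simp
    then show "\<nu> = ?\<alpha>" using that by (intro partition_eqI[OF _ \<alpha>]) (simp_all add: partitions_of_def)
  qed simp
  have "xcoeff (\<Sum>\<nu>\<in>partitions_of n. xscale (xcoeff f (monom_of \<nu>)) (mono_sym \<nu>)) M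
      = (\<Sum>\<nu>\<in>partitions_of n. if \<nu> = ?\<alpha> then xcoeff f (monom_of \<nu>) else 0)"
    unfolding xcoeff_sum by (intro sum.cong refl) (simp add: xscale.rep_eq xcoeff_mono_sym eq)
  also have "\<dots> = (if ?\<alpha> \<in> partitions_of n then xcoeff f (monom_of ?\<alpha>) else 0)"
    by (simp add: finite_partitions_of)
  also have "\<dots> = xcoeff f M"
  proof (cases "size M = n")
    case True
    then have n: "n = sum_mset (exponents M)" by (simp add: size_eq_sum_exponents)
    have "?\<alpha> \<in> partitions_of n"
      unfolding n by (rule to_partition_partitions_of[OF zero_notin_exponents])
    moreover have "exponents (monom_of ?\<alpha>) = exponents M"
      by (simp add: exponents_monom_of zero_notin_exponents flip: set_mset_mset)
    ultimately show ?thesis using symm[of "monom_of ?\<alpha>" M] by simp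
  next
    case False
    have "sum_list ?\<alpha> = size M" by (simp add: size_eq_sum_exponents flip: sum_mset_sum_list)
    then have "?\<alpha> \<notin> partitions_of n" using False by (simp add: partitions_of_def)
    then show ?thesis using zero[OF False] by simp
  qed
  finally show "xcoeff f M = xcoeff (\<Sum>\<nu>\<in>partitions_of n. xscale (xcoeff f (monom_of \<nu>)) (mono_sym \<nu>)) M" ..
qed

lemma homogeneous_symmetric_mono_sym:
  "\<nu> \<in> partitions_of n \<Longrightarrow> homogeneous_symmetric n (mono_sym \<nu>)"
  by (auto simp: homogeneous_symmetric_def xcoeff_mono_sym size_eq_sum_exponents partitions_of_def
      sum_mset_sum_list)

lemma homogeneous_symmetric_sum:
  assumes "\<And>i. i \<in> I \<Longrightarrow> homogeneous_symmetric n (g i)" shows "homogeneous_symmetric n (\<Sum>i\<in>I. g i)"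
  unfolding homogeneous_symmetric_def xcoeff_sum
proof (intro conjI allI impI)
  fix M N :: "nat multiset" assume "exponents M = exponents N"
  then show "(\<Sum>i\<in>I. xcoeff (g i) M) = (\<Sum>i\<in>I. xcoeff (g i) N)"
    using assms unfolding homogeneous_symmetric_def by (intro sum.cong refl) blast
next
  fix M :: "nat multiset" assume "size M \<noteq> n"
  then show "(\<Sum>i\<in>I. xcoeff (g i) M) = 0"
    using assms unfolding homogeneous_symmetric_def by (intro sum.neutral) blast
qed

lemma homogeneous_symmetric_scale: "homogeneous_symmetric n f \<Longrightarrow> homogeneous_symmetric n (xscale c f)"
  unfolding homogeneous_symmetric_def xscale.rep_eq by (metis mult_zero_right)

lemma xcoeff_mono_sym_monom_of:
  assumes "is_partition \<alpha>" "is_partition \<nu>"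
  shows "xcoeff (mono_sym \<nu>) (monom_of \<alpha>) = of_bool (\<alpha> = \<nu>)"
  using assms partition_eqI[OF assms]
  by (auto simp: xcoeff_mono_sym exponents_monom_of partition_zero_notin)

lemma prod_coeff_exponents:
  "(\<Prod>i\<in>set_mset M. prod_coeff F (int (count M i))) = (\<Prod>k\<in>#exponents M. prod_coeff F (int k))"
  by (simp add: exponents_def prod_unfold_prod_mset multiset.map_comp comp_def)

text \<open>By duality a coefficient of the product is a coefficient of another product, which is built from the exponents of the
monomial alone.\<close>

lemma homogeneous_symmetric_prod_list_coeff:
  "homogeneous_symmetric (sum_list c) (prod_list_coeff F c)"
  unfolding homogeneous_symmetric_def
proof (intro conjI allI impI)
  fix M :: "nat multiset" assume "size M \<noteq> sum_list c"
  then show "xcoeff (prod_list_coeff F c) M = 0"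
  proof (induction c arbitrary: M)
    case (Cons k c)
    have "(if int (size A) = int k then fweight F A else 0) * xcoeff (prod_list_coeff F c) (M - A) = 0"
      if "A \<subseteq># M" for A
      using Cons.IH[of "M - A"] Cons.prems that size_mset_mono[OF that] by (auto simp: size_Diff_submset)
    then have "(\<Sum>A | A \<subseteq># M. (if int (size A) = int k then fweight F A else 0) *
        xcoeff (prod_list_coeff F c) (M - A)) = 0"
      by (intro sum.neutral ballI) blast
    then show ?case
      by (simp only: prod_list_coeff_def list.map prod_list.Cons times_xseries.rep_eq xcoeff_prod_coeff)
  qed (auto simp: prod_list_coeff_def one_xseries.rep_eq)
next
  fix M N :: "nat multiset" assume "exponents M = exponents N"
  then show "xcoeff (prod_list_coeff F c) M = xcoeff (prod_list_coeff F c) N"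
    unfolding prod_list_coeff_monom_of prod_coeff_duality[where R = "monom_of c" and M = M]
      prod_coeff_duality[where R = "monom_of c" and M = N]
    unfolding prod_coeff_exponents by simp
qed

lemma exponents_diff_replicate:
  assumes "i \<in># M" "k \<le> count M i"
  shows "exponents (M - replicate_mset k i)
       = exponents M - {#count M i#} + (if count M i = k then {#} else {#count M i - k#})"
proof -
  let ?S = "set_mset M - {i}"
  have "mset_set (set_mset M) = add_mset i (mset_set ?S)"
    using assms mset_set.insert_remove[of "set_mset M" i] by (simp add: insert_absorb)
  then have M: "exponents M - {#count M i#} = image_mset (count M) (mset_set ?S)"
    by (simp add: exponents_def)
  have cong: "image_mset (count (M - replicate_mset k i)) (mset_set ?S) = image_mset (count M) (mset_set ?S)"
    by (rule image_mset_cong) auto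
  have support: "x \<in># M - replicate_mset k i \<longleftrightarrow> (if x = i then k < count M i else x \<in># M)" for x
    by (simp add: count_greater_zero_iff[symmetric] del: count_greater_zero_iff)
  show ?thesis
  proof (cases "count M i = k")
    case True
    then have "x \<in># M - replicate_mset k i \<longleftrightarrow> x \<in> ?S" for x
      unfolding support by simp
    then have "set_mset (M - replicate_mset k i) = ?S" by blast
    then show ?thesis using True cong M by (simp add: exponents_def)
  next
    case False
    then have "x \<in># M - replicate_mset k i \<longleftrightarrow> x \<in> insert i ?S" for x
      using assms unfolding support by simp
    then have set: "set_mset (M - replicate_mset k i) = insert i ?S" by blast
    have "exponents (M - replicate_mset k i) = add_mset (count M i - k) (image_mset (count M) (mset_set ?S))"
      unfolding exponents_def set by (subst mset_set.insert) (simp_all add: cong)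
    then show ?thesis unfolding M using False by simp
  qed
qed

lemma size_filter_exponents: "size (filter_mset Q (exponents M)) = card {i. i \<in># M \<and> Q (count M i)}"
  by (simp add: exponents_def filter_mset_image_mset)

text \<open>The coefficient counts the variables from which a power \<open>k\<close> can be removed such that a monomial of type \<open>\<nu>\<close> is
left. It is stated in terms of the exponents only, which makes the product visibly symmetric.\<close>

lemma xcoeff_power_sum_mono_sym:
  assumes "k > 0"
  shows "xcoeff (power_sum k * mono_sym \<nu>) M = of_nat (size (filter_mset (\<lambda>x. k \<le> x \<and>
    exponents M - {#x#} + (if x = k then {#} else {#x - k#}) = mset \<nu>) (exponents M)))"
proof -
  let ?Q = "\<lambda>x. exponents M - {#x#} + (if x = k then {#} else {#x - k#}) = mset \<nu>"
  have "xcoeff (power_sum k * mono_sym \<nu>) M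
      = (\<Sum>i\<in>{i. i \<in># M \<and> k \<le> count M i}. of_bool (?Q (count M i)))"
    unfolding xcoeff_power_sum_mult[OF assms] xcoeff_mono_sym
    by (intro sum.cong refl) (simp add: exponents_diff_replicate)
  also have "\<dots> = of_nat (card ({i. i \<in># M \<and> k \<le> count M i} \<inter> {i. ?Q (count M i)}))"
    by (rule sum_of_bool_eq, rule finite_subset[of _ "set_mset M"]) auto
  also have "{i. i \<in># M \<and> k \<le> count M i} \<inter> {i. ?Q (count M i)}
      = {i. i \<in># M \<and> (k \<le> count M i \<and> ?Q (count M i))}" by blast
  finally show ?thesis unfolding size_filter_exponents .
qed

section \<open>Monomial symmetric functions are polynomials in the big complete ones\<close>

text \<open>The polynomials in the \<open>q\<^sub>r\<close> that are homogeneous of degree \<open>n\<close>.\<close>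

definition q_span :: "nat \<Rightarrow> ratfun xseries set" where
  "q_span n = xser.span {prod_list_coeff q_fps c | c. sum_list c = n}"

lemma q_span_mult:
  assumes f: "f \<in> q_span m" and g: "g \<in> q_span n" shows "f * g \<in> q_span (m + n)"
proof -
  have gen: "prod_list_coeff q_fps c * g \<in> q_span (m + n)" if c: "sum_list c = m" for c
    using g unfolding q_span_def
  proof (induction rule: xser.span_induct_alt)
    case base
    show ?case by (simp add: xser.span_zero)
  next
    case (step a x y)
    then obtain d where d: "x = prod_list_coeff q_fps d" "sum_list d = n" by auto
    have "prod_list_coeff q_fps c * x = prod_list_coeff q_fps (c @ d)"
      by (simp add: d prod_list_coeff_def)
    then have "prod_list_coeff q_fps c * x \<in> {prod_list_coeff q_fps c | c. sum_list c = m + n}"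
      using c d(2) by (intro CollectI exI[of _ "c @ d"]) simp
    then have "xscale a (prod_list_coeff q_fps c * x) + prod_list_coeff q_fps c * y
        \<in> xser.span {prod_list_coeff q_fps c | c. sum_list c = m + n}"
      using step.IH by (rule xser.span_add[OF xser.span_scale[OF xser.span_base]])
    then show ?case by (simp only: distrib_left xscale_mult_right)
  qed
  show ?thesis
    using f unfolding q_span_def[of m]
  proof (induction rule: xser.span_induct_alt)
    case base
    show ?case by (simp add: q_span_def xser.span_zero)
  next
    case (step a x y)
    then obtain c where c: "x = prod_list_coeff q_fps c" "sum_list c = m" by auto
    have "xscale a (x * g) + y * g \<in> q_span (m + n)"
      using gen[OF c(2)] step.IH unfolding c(1) q_span_def
      by (intro xser.span_add xser.span_scale)
    then show ?case by (simp only: distrib_right xscale_mult_left)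
  qed
qed

lemma prod_coeff_in_q_span: "prod_coeff q_fps (int n) \<in> q_span n"
proof -
  have "prod_coeff q_fps (int n) = prod_list_coeff q_fps [n]" by (simp add: prod_list_coeff_def)
  then show ?thesis unfolding q_span_def by (intro xser.span_base) auto
qed

lemma t_var_power_nonone: assumes "k > 0" shows "1 - t_var ^ k \<noteq> 0"
proof
  assume "1 - t_var ^ k = 0"
  then have "to_fract (1 :: rat poly poly) = to_fract ([:0, 1:] ^ k)"
    by (simp add: t_var_def to_fract_power)
  then have "(1 :: rat poly poly) = [:0, 1:] ^ k" by (simp only: to_fract_eq_iff)
  then have "coeff (1 :: rat poly poly) k = coeff ([:0, 1:] ^ k) k" by simp
  then show False using assms
    by (simp only: monom_altdef[of 1, symmetric, simplified] ) (simp add: coeff_1)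
qed

text \<open>Newton's identity can be solved for the power sum because \<open>1 - t\<^sup>k\<close> is invertible.\<close>

lemma power_sum_in_q_span: "k > 0 \<Longrightarrow> power_sum k \<in> q_span k"
proof (induction k rule: less_induct)
  case (less k)
  let ?q = "\<lambda>i. prod_coeff q_fps (int i)"
  have "{1..k} = insert k {1..<k}" using less.prems by auto
  then have "xscale (of_nat k) (?q k) = xscale (1 - t_var ^ k) (power_sum k)
      + (\<Sum>j\<in>{1..<k}. xscale (1 - t_var ^ j) (power_sum j * ?q (k - j)))"
    using newton_identity[of k] by (simp only:) simp
  then have eq: "xscale (1 - t_var ^ k) (power_sum k) = xscale (of_nat k) (?q k)
      - (\<Sum>j\<in>{1..<k}. xscale (1 - t_var ^ j) (power_sum j * ?q (k - j)))"
    by (simp only: add_diff_cancel_right')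
  have "power_sum j * ?q (k - j) \<in> q_span k" if "j \<in> {1..<k}" for j
    using q_span_mult[OF less.IH prod_coeff_in_q_span, of j "k - j"] that by simp
  then have "xscale (1 - t_var ^ k) (power_sum k) \<in> q_span k"
    unfolding eq using prod_coeff_in_q_span[of k] unfolding q_span_def
    by (intro xser.span_diff xser.span_sum xser.span_scale)
  then have "xscale (inverse (1 - t_var ^ k)) (xscale (1 - t_var ^ k) (power_sum k)) \<in> q_span k"
    unfolding q_span_def by (rule xser.span_scale)
  then show ?case using t_var_power_nonone[OF less.prems] by simp
qed

lemma homogeneous_symmetric_power_sum_mono_sym:
  assumes "k > 0" "\<nu> \<in> partitions_of n"
  shows "homogeneous_symmetric (k + n) (power_sum k * mono_sym \<nu>)"
  unfolding homogeneous_symmetric_def xcoeff_power_sum_mono_sym[OF assms(1)]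
proof (intro conjI allI impI)
  fix M :: "nat multiset" assume size: "size M \<noteq> k + n"
  have "False" if x: "x \<in># exponents M" "k \<le> x"
    and eq: "exponents M - {#x#} + (if x = k then {#} else {#x - k#}) = mset \<nu>" for x
  proof -
    obtain E where E: "exponents M = add_mset x E" using x(1) by (meson mset_add)
    have \<nu>: "sum_mset (mset \<nu>) = n" using assms(2) by (simp add: partitions_of_def sum_mset_sum_list)
    have "E + (if x = k then {#} else {#x - k#}) = mset \<nu>" using eq unfolding E by simp
    then have "sum_mset (E + (if x = k then {#} else {#x - k#})) = n" by (simp only: \<nu>)
    then have "sum_mset E + (x - k) = n" by (simp split: if_splits)
    then show False using size x(2) unfolding size_eq_sum_exponents E by simp
  qed
  then have "filter_mset (\<lambda>x. k \<le> x \<and> exponents M - {#x#} + (if x = k then {#} else {#x - k#}) = mset \<nu>)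
      (exponents M) = {#}"
    unfolding filter_mset_eq_mempty_iff by blast
  then show "of_nat (size (filter_mset (\<lambda>x. k \<le> x \<and> exponents M - {#x#} +
      (if x = k then {#} else {#x - k#}) = mset \<nu>) (exponents M))) = (0 :: ratfun)"
    by (simp only: size_empty of_nat_0)
qed (simp only:)

text \<open>Induction on the number of parts. For \<open>\<nu> = (k, \<rho>)\<close> the product of the power sum of degree \<open>k\<close> and the monomial function of
\<open>\<rho>\<close> is a nonzero multiple of the monomial function of \<open>\<nu>\<close> plus terms in which \<open>k\<close> has been added to a part of
\<open>\<rho>\<close>, and these have fewer parts than \<open>\<nu>\<close>.\<close>

lemma mono_sym_in_q_span:
  assumes "is_partition \<nu>" shows "mono_sym \<nu> \<in> q_span (sum_list \<nu>)"
  using assms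
proof (induction "length \<nu>" arbitrary: \<nu> rule: less_induct)
  case less
  show ?case
  proof (cases \<nu>)
    case Nil
    have "mono_sym [] = prod_list_coeff q_fps []"
      by (rule xseries_eqI)
        (simp add: xcoeff_mono_sym exponents_def prod_list_coeff_def one_xseries.rep_eq mset_set_empty_iff)
    then show ?thesis unfolding Nil q_span_def by (intro xser.span_base) auto
  next
    case (Cons k \<rho>)
    have k: "k > 0" and \<rho>: "is_partition \<rho>" using less.prems by (auto simp: Cons is_partition_def)
    define n where "n = sum_list \<nu>"
    have n: "n = k + sum_list \<rho>" by (simp add: n_def Cons)
    let ?f = "power_sum k * mono_sym \<rho>"
    have \<nu>n: "\<nu> \<in> partitions_of n" using less.prems by (simp add: partitions_of_def n_def)
    have "\<rho> \<in> partitions_of (sum_list \<rho>)" using \<rho> by (simp add: partitions_of_def)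
    then have symm: "homogeneous_symmetric n ?f"
      unfolding n by (rule homogeneous_symmetric_power_sum_mono_sym[OF k])
    let ?c = "\<lambda>\<beta>. xcoeff ?f (monom_of \<beta>)"
    have c_\<nu>: "?c \<nu> \<noteq> 0"
    proof -
      have "exponents (monom_of \<nu>) = add_mset k (mset \<rho>)"
        using exponents_monom_of[OF partition_zero_notin[OF less.prems]] by (simp add: Cons)
      then have exp: "exponents (monom_of \<nu>) = add_mset k (mset \<rho>)" .
      let ?F = "filter_mset (\<lambda>x. k \<le> x \<and> exponents (monom_of \<nu>) - {#x#} +
          (if x = k then {#} else {#x - k#}) = mset \<rho>) (exponents (monom_of \<nu>))"
      have "k \<in># ?F" unfolding exp by simp
      then have "?F \<noteq> {#}" unfolding set_mset_eq_empty_iff[symmetric] by (intro notI) (simp only: empty_iff)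
      then have "size ?F \<noteq> 0" by (simp only: size_eq_0_iff_empty simp_thms)
      then show ?thesis unfolding xcoeff_power_sum_mono_sym[OF k] by (simp only: of_nat_eq_0_iff simp_thms)
    qed
    \<comment> \<open>Removing the power \<open>k\<close> from a monomial of type \<open>\<beta>\<close> deletes a part equal to \<open>k\<close> or makes a larger part smaller.\<close>
    have short: "length \<beta> < length \<nu>" if \<beta>: "\<beta> \<in> partitions_of n" "\<beta> \<noteq> \<nu>" "?c \<beta> \<noteq> 0" for \<beta>
    proof -
      have exp: "exponents (monom_of \<beta>) = mset \<beta>"
        using \<beta>(1) by (simp add: exponents_monom_of partition_zero_notin partitions_of_def)
      have "filter_mset (\<lambda>x. k \<le> x \<and> mset \<beta> - {#x#} + (if x = k then {#} else {#x - k#}) = mset \<rho>)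
          (mset \<beta>) \<noteq> {#}"
        using \<beta>(3) unfolding xcoeff_power_sum_mono_sym[OF k] exp
        by (intro notI) (simp only: size_empty of_nat_0 simp_thms)
      then obtain x where x: "x \<in># mset \<beta>" "mset \<beta> - {#x#} + (if x = k then {#} else {#x - k#}) = mset \<rho>"
        unfolding filter_mset_eq_mempty_iff by blast
      have "x \<noteq> k"
      proof
        assume "x = k"
        then have "mset \<beta> = mset \<nu>" using x by (simp add: Cons insert_DiffM2 flip: x(2))
        then show False using \<beta>(1,2) less.prems partition_eqI by (auto simp: partitions_of_def)
      qed
      then have "size (mset \<beta>) = size (mset \<rho>)" using x(1) by (simp add: size_Suc_Diff1 flip: x(2))
      then show ?thesis by (simp add: Cons)
    qed
    have "?f = (\<Sum>\<beta>\<in>partitions_of n. xscale (?c \<beta>) (mono_sym \<beta>))"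
      by (rule homogeneous_symmetric_expand[OF symm])
    also have "\<dots> = xscale (?c \<nu>) (mono_sym \<nu>) + (\<Sum>\<beta>\<in>partitions_of n - {\<nu>}. xscale (?c \<beta>) (mono_sym \<beta>))"
      by (rule sum.remove[OF finite_partitions_of \<nu>n])
    finally have eq: "xscale (?c \<nu>) (mono_sym \<nu>) = ?f - (\<Sum>\<beta>\<in>partitions_of n - {\<nu>}. xscale (?c \<beta>) (mono_sym \<beta>))"
      unfolding eq_diff_eq by (rule HOL.sym)
    have "length \<rho> < length \<nu>" by (simp add: Cons)
    then have "?f \<in> q_span n"
      unfolding n using q_span_mult[OF power_sum_in_q_span[OF k]] less.hyps \<rho> by blast
    moreover have "xscale (?c \<beta>) (mono_sym \<beta>) \<in> q_span n" if \<beta>: "\<beta> \<in> partitions_of n - {\<nu>}" for \<beta>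
    proof (cases "?c \<beta> = 0")
      case True
      then show ?thesis by (simp add: q_span_def xser.span_zero)
    next
      case False
      then have "mono_sym \<beta> \<in> q_span n"
        using less.hyps[OF short[OF _ _ False]] \<beta> by (auto simp: partitions_of_def)
      then show ?thesis unfolding q_span_def by (rule xser.span_scale)
    qed
    ultimately have "xscale (?c \<nu>) (mono_sym \<nu>) \<in> q_span n"
      unfolding eq unfolding q_span_def by (intro xser.span_diff xser.span_sum)
    then have "xscale (inverse (?c \<nu>)) (xscale (?c \<nu>) (mono_sym \<nu>)) \<in> q_span n"
      unfolding q_span_def by (rule xser.span_scale)
    then show ?thesis using c_\<nu> by (simp add: n_def)
  qed
qed

section \<open>Jacobi-Trudi determinants\<close>

definition jacobi_trudi :: "ratfun fps \<Rightarrow> nat list \<Rightarrow> ratfun xseries" where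
  "jacobi_trudi F \<alpha> = det (mat (length \<alpha>) (length \<alpha>)
     (\<lambda>(i, j). prod_coeff F (int (\<alpha> ! i) - int i + int j)))"

lemma schur_jacobi_trudi: "schur = jacobi_trudi h_fps"
  by (simp only: fun_eq_iff schur_def jacobi_trudi_def complete_sym_h_fps simp_thms)

lemma big_schur_jacobi_trudi: "big_schur = jacobi_trudi q_fps"
  by (simp only: fun_eq_iff big_schur_def jacobi_trudi_def q_sym_q_fps simp_thms)

text \<open>The permutations whose term in the Jacobi-Trudi determinant has no factor with a negative index, and hence does not
vanish for that reason.\<close>

definition jt_perms :: "nat list \<Rightarrow> (nat \<Rightarrow> nat) set" where
  "jt_perms \<alpha> = {p. p permutes {0..<length \<alpha>} \<and> (\<forall>i<length \<alpha>. 0 \<le> int (\<alpha> ! i) - int i + int (p i))}"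

definition jt_exps :: "nat list \<Rightarrow> (nat \<Rightarrow> nat) \<Rightarrow> nat list" where
  "jt_exps \<alpha> p = map (\<lambda>i. nat (int (\<alpha> ! i) - int i + int (p i))) [0..<length \<alpha>]"

lemma finite_jt_perms: "finite (jt_perms \<alpha>)"
  by (rule finite_subset[OF _ finite_permutations[of "{0..<length \<alpha>}"]]) (auto simp: jt_perms_def)

lemma of_int_eq_xscale:
  fixes f :: "ratfun xseries"
  shows "of_int k * f = xscale (of_int k) f"
proof -
  have "of_nat m * f = xscale (of_nat m) f" for m
    by (induction m) (simp_all add: distrib_right xser.scale_left_distrib)
  then have "of_int (int m) * f = xscale (of_int (int m)) f"
    "of_int (- int m) * f = xscale (of_int (- int m)) f" for m
    by (simp_all add: xser.scale_minus_left)
  then show ?thesis by (cases k rule: int_cases2) auto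
qed

lemma jacobi_trudi_expand:
  "jacobi_trudi F \<alpha> = (\<Sum>p\<in>jt_perms \<alpha>. xscale (of_int (sign p)) (prod_list_coeff F (jt_exps \<alpha> p)))"
proof -
  let ?l = "length \<alpha>"
  let ?A = "mat ?l ?l (\<lambda>(i, j). prod_coeff F (int (\<alpha> ! i) - int i + int j))"
  let ?t = "\<lambda>p. \<Prod>i=0..<?l. prod_coeff F (int (\<alpha> ! i) - int i + int (p i))"
  have "jacobi_trudi F \<alpha> = (\<Sum>p | p permutes {0..<?l}. of_int (sign p) * (\<Prod>i=0..<?l. ?A $$ (i, p i)))"
    unfolding jacobi_trudi_def by (rule det_def') simp
  also have "\<dots> = (\<Sum>p | p permutes {0..<?l}. xscale (of_int (sign p)) (?t p))"
  proof (intro sum.cong refl)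
    fix p assume "p \<in> {p. p permutes {0..<?l}}"
    then have "p i < ?l" if "i < ?l" for i using that permutes_in_image[of p "{0..<?l}" i] by simp
    then have "(\<Prod>i=0..<?l. ?A $$ (i, p i)) = ?t p" by (intro prod.cong refl) simp
    then show "of_int (sign p) * (\<Prod>i=0..<?l. ?A $$ (i, p i)) = xscale (of_int (sign p)) (?t p)"
      by (simp only: of_int_eq_xscale)
  qed
  also have "\<dots> = (\<Sum>p\<in>jt_perms \<alpha>. xscale (of_int (sign p)) (prod_list_coeff F (jt_exps \<alpha> p)))"
  proof (rule sum.mono_neutral_cong_right)
    show "finite {p. p permutes {0..<?l}}" by (rule finite_permutations) simp
    show "jt_perms \<alpha> \<subseteq> {p. p permutes {0..<?l}}" by (auto simp: jt_perms_def)
    show "\<forall>p\<in>{p. p permutes {0..<?l}} - jt_perms \<alpha>. xscale (of_int (sign p)) (?t p) = 0"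
    proof
      fix p assume "p \<in> {p. p permutes {0..<?l}} - jt_perms \<alpha>"
      then obtain i where i: "i < ?l" "int (\<alpha> ! i) - int i + int (p i) < 0"
        by (auto simp: jt_perms_def not_le)
      then have "?t p = 0" by (intro prod_zero) (auto intro!: bexI[of _ i])
      then show "xscale (of_int (sign p)) (?t p) = 0" by (simp only: xser.scale_zero_right)
    qed
    fix p assume "p \<in> jt_perms \<alpha>"
    then have "prod_list_coeff F (jt_exps \<alpha> p) = ?t p"
      unfolding prod_list_coeff_def jt_exps_def map_map
      by (subst prod.distinct_set_conv_list[symmetric]) (auto simp: jt_perms_def intro!: prod.cong)
    then show "xscale (of_int (sign p)) (?t p) = xscale (of_int (sign p)) (prod_list_coeff F (jt_exps \<alpha> p))"
      by (simp only:)
  qed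
  finally show ?thesis .
qed

lemma sum_jt_exps:
  assumes "p \<in> jt_perms \<alpha>" shows "sum_list (jt_exps \<alpha> p) = sum_list \<alpha>"
proof -
  let ?l = "length \<alpha>"
  have p: "p permutes {0..<?l}" and nonneg: "\<forall>i<?l. 0 \<le> int (\<alpha> ! i) - int i + int (p i)"
    using assms by (auto simp: jt_perms_def)
  have "int (sum_list (jt_exps \<alpha> p)) = (\<Sum>i=0..<?l. int (\<alpha> ! i) - int i + int (p i))"
    unfolding jt_exps_def by (subst sum_list_sum_nth) (use nonneg in \<open>auto intro!: sum.cong\<close>)
  also have "\<dots> = (\<Sum>i=0..<?l. int (\<alpha> ! i)) - (\<Sum>i=0..<?l. int i) + (\<Sum>i=0..<?l. int (p i))"
    by (simp only: sum.distrib sum_subtractf)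
  also have "(\<Sum>i=0..<?l. int (p i)) = (\<Sum>i=0..<?l. int i)"
    using sum.permute[OF p, of int] by (simp only: comp_def)
  finally show ?thesis by (simp add: sum_list_sum_nth flip: of_nat_sum)
qed

lemma sum_lessThan_card_le: "finite A \<Longrightarrow> (\<Sum>i<card A. i) \<le> \<Sum>A" for A :: "nat set"
proof (induction A rule: finite_linorder_max_induct)
  case (insert b A)
  then have "A \<subseteq> {..<b}" by auto
  then have "card A \<le> b" using card_mono[of "{..<b}" A] by simp
  moreover have "b \<notin> A" using insert.hyps by auto
  ultimately show ?case using insert by simp
qed simp

text \<open>The rearrangement inequality. The weakly decreasing \<open>\<alpha>\<close> is a sum of indicator functions of
initial segments, and on an initial segment the values of \<open>p\<close> are distinct naturals.\<close>

lemma rearrangement_nonneg: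
  assumes \<alpha>: "sorted_wrt (\<ge>) \<alpha>" and p: "p permutes {0..<length \<alpha>}"
  shows "0 \<le> (\<Sum>i=0..<length \<alpha>. int (\<alpha> ! i) * (int (p i) - int i))"
proof -
  let ?l = "length \<alpha>"
  define N where "N = sum_list \<alpha>"
  have le: "\<alpha> ! i \<le> N" if "i < ?l" for i using that by (simp add: N_def member_le_sum_list)
  \<comment> \<open>The contribution of the initial segment of indices \<open>i\<close> with \<open>\<alpha>\<^sub>i > k\<close>.\<close>
  have layer: "0 \<le> (\<Sum>i\<in>{i \<in> {0..<?l}. k < \<alpha> ! i}. int (p i) - int i)" for k
  proof -
    let ?S = "{i \<in> {0..<?l}. k < \<alpha> ! i}"
    have "\<alpha> ! j \<le> \<alpha> ! i" if "i \<le> j" "j < ?l" for i j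
      using \<alpha> that by (cases "i = j") (auto simp: sorted_wrt_iff_nth_less)
    then have "?S = {..<card ?S}"
    proof -
      assume mono: "\<And>i j. i \<le> j \<Longrightarrow> j < ?l \<Longrightarrow> \<alpha> ! j \<le> \<alpha> ! i"
      have closed: "i \<in> ?S" if "j \<in> ?S" "i \<le> j" for i j
        using that mono[of i j] by auto
      define m where "m = (LEAST m. m \<notin> ?S)"
      have ex: "?l \<notin> ?S" by simp
      have m: "m \<notin> ?S" unfolding m_def by (rule LeastI[where P = "\<lambda>m. m \<notin> ?S", OF ex])
      have "?S = {..<m}"
      proof (intro equalityI subsetI)
        fix i assume "i \<in> ?S" then show "i \<in> {..<m}" using closed[of i m] m by (meson lessThan_iff not_le)
      next
        fix i assume "i \<in> {..<m}"
        then show "i \<in> ?S" using not_less_Least[of i "\<lambda>m. m \<notin> ?S"] unfolding m_def by blast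
      qed
      then show "?S = {..<card ?S}" by (metis card_lessThan)
    qed
    then have "\<Sum>?S = (\<Sum>i<card ?S. i)" by metis
    also have "\<dots> = (\<Sum>i<card (p ` ?S). i)"
      by (simp only: card_image[OF permutes_inj_on[OF p]])
    also have "\<dots> \<le> \<Sum>(p ` ?S)" by (rule sum_lessThan_card_le) simp
    also have "\<dots> = (\<Sum>i\<in>?S. p i)" by (simp only: sum.reindex[OF permutes_inj_on[OF p]] comp_def)
    finally have "int (\<Sum>?S) \<le> int (\<Sum>i\<in>?S. p i)" by (simp only: of_nat_le_iff)
    then show ?thesis by (simp only: sum_subtractf of_nat_sum)
  qed
  have "(\<Sum>i=0..<?l. int (\<alpha> ! i) * (int (p i) - int i))
      = (\<Sum>i=0..<?l. \<Sum>k\<in>{k \<in> {..<N}. k < \<alpha> ! i}. int (p i) - int i)"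
  proof (intro sum.cong refl)
    fix i assume "i \<in> {0..<?l}"
    then have "{k \<in> {..<N}. k < \<alpha> ! i} = {..<\<alpha> ! i}" using le[of i] by auto
    then show "int (\<alpha> ! i) * (int (p i) - int i) = (\<Sum>k\<in>{k \<in> {..<N}. k < \<alpha> ! i}. int (p i) - int i)"
      by simp
  qed
  also have "\<dots> = (\<Sum>k<N. \<Sum>i\<in>{i \<in> {0..<?l}. k < \<alpha> ! i}. int (p i) - int i)"
    by (rule sum.swap_restrict) auto
  also have "0 \<le> \<dots>" by (intro sum_nonneg layer)
  finally show ?thesis .
qed

definition sum_squares :: "nat list \<Rightarrow> nat" where
  "sum_squares c = (\<Sum>k\<leftarrow>c. k ^ 2)"

text \<open>With \<open>d\<^sub>i = p(i) - i\<close> the difference of the two sums is \<open>2 \<Sum> \<alpha>\<^sub>i d\<^sub>i + \<Sum> d\<^sub>i\<^sup>2\<close>. So the expansion of the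
determinant is triangular with respect to the sum of squares.\<close>

lemma sum_squares_jt_exps:
  assumes \<alpha>: "is_partition \<alpha>" and p: "p \<in> jt_perms \<alpha>" "p \<noteq> id"
  shows "sum_squares \<alpha> < sum_squares (jt_exps \<alpha> p)"
proof -
  let ?l = "length \<alpha>"
  let ?d = "\<lambda>i. int (p i) - int i"
  have perm: "p permutes {0..<?l}" and nonneg: "\<forall>i<?l. 0 \<le> int (\<alpha> ! i) - int i + int (p i)"
    using p by (auto simp: jt_perms_def)
  obtain j where "p j \<noteq> j" using p(2) by (auto simp: fun_eq_iff)
  then have j: "j \<in> {0..<?l}" "?d j \<noteq> 0" using permutes_not_in[OF perm] by auto
  have "0 < (\<Sum>i=0..<?l. (?d i)\<^sup>2)"
    by (rule sum_pos2[OF _ j(1)]) (use j(2) in auto)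
  moreover have "0 \<le> (\<Sum>i=0..<?l. int (\<alpha> ! i) * ?d i)"
    using \<alpha> by (intro rearrangement_nonneg[OF _ perm]) (simp add: is_partition_def)
  moreover have "int (sum_squares (jt_exps \<alpha> p)) = (\<Sum>i=0..<?l. (int (\<alpha> ! i) + ?d i)\<^sup>2)"
    unfolding sum_squares_def jt_exps_def map_map
    by (subst sum.distinct_set_conv_list[symmetric])
      (use nonneg in \<open>auto intro!: sum.cong arg_cong[of _ _ "\<lambda>x. x ^ 2"]\<close>)
  moreover have "\<dots> = (\<Sum>i=0..<?l. (int (\<alpha> ! i))\<^sup>2) + 2 * (\<Sum>i=0..<?l. int (\<alpha> ! i) * ?d i) + (\<Sum>i=0..<?l. (?d i)\<^sup>2)"
    by (simp only: power2_sum sum.distrib sum_distrib_left mult.assoc)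
  moreover have "(\<Sum>i=0..<?l. (int (\<alpha> ! i))\<^sup>2) = int (sum_squares \<alpha>)"
    unfolding sum_squares_def by (simp add: sum_list_sum_nth)
  ultimately show ?thesis by linarith
qed

section \<open>Graded bases and the big Schur basis\<close>

lemma prod_list_coeff_to_partition:
  "prod_list_coeff F (to_partition (filter_mset (\<lambda>k. k \<noteq> 0) (mset c))) = prod_list_coeff F c"
proof -
  have drop: "(\<Prod>k\<in>#filter_mset (\<lambda>k. k \<noteq> 0) N. prod_coeff F (int k)) = (\<Prod>k\<in>#N. prod_coeff F (int k))" for N
    by (induction N) auto
  have as_mset: "prod_list_coeff F d = (\<Prod>k\<in>#mset d. prod_coeff F (int k))" for d
    unfolding prod_list_coeff_def by (simp add: prod_mset_prod_list flip: mset_map)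
  show ?thesis unfolding as_mset mset_to_partition by (rule drop)
qed

lemma sum_squares_to_partition:
  "sum_squares (to_partition (filter_mset (\<lambda>k. k \<noteq> 0) (mset c))) = sum_squares c"
proof -
  have drop: "(\<Sum>k\<in>#filter_mset (\<lambda>k. k \<noteq> 0) N. k ^ 2) = (\<Sum>k\<in>#N. k ^ 2)" for N :: "nat multiset"
    by (induction N) auto
  have as_mset: "sum_squares d = (\<Sum>k\<in>#mset d. k ^ 2)" for d
    unfolding sum_squares_def by (simp add: sum_mset_sum_list flip: mset_map)
  show ?thesis unfolding as_mset mset_to_partition by (rule drop)
qed

lemma to_partition_mem:
  "to_partition (filter_mset (\<lambda>k. k \<noteq> 0) (mset c)) \<in> partitions_of (sum_list c)"
proof -
  have drop: "\<Sum>\<^sub># (filter_mset (\<lambda>k. k \<noteq> 0) N) = \<Sum>\<^sub># N" for N :: "nat multiset"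
    by (induction N) auto
  have "to_partition (filter_mset (\<lambda>k. k \<noteq> 0) (mset c))
      \<in> partitions_of (\<Sum>\<^sub># (filter_mset (\<lambda>k. k \<noteq> 0) (mset c)))"
    by (rule to_partition_partitions_of) simp
  then show ?thesis by (simp only: drop sum_mset_sum_list)
qed

lemma sum_squares_le: "sum_squares c \<le> (sum_list c)\<^sup>2"
proof (induction c)
  case (Cons k c)
  then show ?case by (simp add: sum_squares_def power2_sum)
qed (simp add: sum_squares_def)

text \<open>Solve the expansion of the determinant for its diagonal term. The other terms have a larger sum of squares,
which is bounded by \<open>n\<^sup>2\<close>.\<close>

lemma prod_list_coeff_in_schur_span:
  "sum_list c = n \<Longrightarrow> prod_list_coeff q_fps c \<in> xser.span (big_schur ` partitions_of n)"
proof (induction "n\<^sup>2 - sum_squares c" arbitrary: c rule: less_induct)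
  case less
  define \<alpha> where "\<alpha> = to_partition (filter_mset (\<lambda>k. k \<noteq> 0) (mset c))"
  have \<alpha>n: "\<alpha> \<in> partitions_of n" unfolding \<alpha>_def less.prems[symmetric] by (rule to_partition_mem)
  then have \<alpha>: "is_partition \<alpha>" "sum_list \<alpha> = n" by (simp_all add: partitions_of_def)
  have sq: "sum_squares \<alpha> = sum_squares c" unfolding \<alpha>_def by (rule sum_squares_to_partition)
  let ?t = "\<lambda>p. xscale (of_int (sign p)) (prod_list_coeff q_fps (jt_exps \<alpha> p))"
  have id: "id \<in> jt_perms \<alpha>" by (simp add: jt_perms_def permutes_id)
  have "jt_exps \<alpha> id = \<alpha>" by (simp add: jt_exps_def map_nth)
  then have "?t id = prod_list_coeff q_fps \<alpha>" by (simp add: sign_id)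
  also have "\<dots> = prod_list_coeff q_fps c" unfolding \<alpha>_def by (rule prod_list_coeff_to_partition)
  finally have t_id: "?t id = prod_list_coeff q_fps c" .
  have "big_schur \<alpha> = ?t id + (\<Sum>p\<in>jt_perms \<alpha> - {id}. ?t p)"
    unfolding big_schur_jacobi_trudi jacobi_trudi_expand by (rule sum.remove[OF finite_jt_perms id])
  then have eq: "prod_list_coeff q_fps c = big_schur \<alpha> - (\<Sum>p\<in>jt_perms \<alpha> - {id}. ?t p)"
    unfolding t_id eq_diff_eq by (rule HOL.sym)
  have "?t p \<in> xser.span (big_schur ` partitions_of n)" if p: "p \<in> jt_perms \<alpha> - {id}" for p
  proof -
    have sum: "sum_list (jt_exps \<alpha> p) = n" using sum_jt_exps[of p \<alpha>] p \<alpha>(2) by simp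
    have "sum_squares c < sum_squares (jt_exps \<alpha> p)" using sum_squares_jt_exps[OF \<alpha>(1), of p] p sq by simp
    moreover have "sum_squares (jt_exps \<alpha> p) \<le> n\<^sup>2" using sum_squares_le[of "jt_exps \<alpha> p"] sum by simp
    ultimately have "n\<^sup>2 - sum_squares (jt_exps \<alpha> p) < n\<^sup>2 - sum_squares c" by (intro diff_less_mono2) auto
    from less.hyps[OF this sum] show ?thesis by (rule xser.span_scale)
  qed
  moreover have "big_schur \<alpha> \<in> xser.span (big_schur ` partitions_of n)"
    using \<alpha>n by (intro xser.span_base imageI)
  ultimately show ?case unfolding eq by (intro xser.span_diff xser.span_sum)
qed

lemma mono_sym_in_schur_span:
  assumes "\<nu> \<in> partitions_of n" shows "mono_sym \<nu> \<in> xser.span (big_schur ` partitions_of n)"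
proof -
  have "mono_sym \<nu> \<in> q_span n" using mono_sym_in_q_span[of \<nu>] assms by (simp add: partitions_of_def)
  moreover have "q_span n \<subseteq> xser.span (big_schur ` partitions_of n)"
    unfolding q_span_def
    by (rule xser.span_minimal[OF _ xser.subspace_span]) (use prod_list_coeff_in_schur_span in blast)
  ultimately show ?thesis by blast
qed

lemma homogeneous_symmetric_jacobi_trudi:
  assumes "\<alpha> \<in> partitions_of n" shows "homogeneous_symmetric n (jacobi_trudi F \<alpha>)"
  unfolding jacobi_trudi_expand
proof (intro homogeneous_symmetric_sum homogeneous_symmetric_scale)
  fix p assume "p \<in> jt_perms \<alpha>"
  then have "sum_list (jt_exps \<alpha> p) = n" using sum_jt_exps assms by (simp add: partitions_of_def)
  then show "homogeneous_symmetric n (prod_list_coeff F (jt_exps \<alpha> p))"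
    using homogeneous_symmetric_prod_list_coeff[of "jt_exps \<alpha> p" F] by simp
qed

text \<open>The two conditions are what coordinates with respect to all partitions need: linear independence as an
indexed family, one degree at a time.\<close>

definition graded_basis :: "(nat list \<Rightarrow> ratfun xseries) \<Rightarrow> bool" where
  "graded_basis B \<longleftrightarrow> (\<forall>n. \<forall>\<alpha>\<in>partitions_of n. homogeneous_symmetric n (B \<alpha>)) \<and>
     (\<forall>n c. (\<Sum>\<alpha>\<in>partitions_of n. xscale (c \<alpha>) (B \<alpha>)) = 0 \<longrightarrow> (\<forall>\<alpha>\<in>partitions_of n. c \<alpha> = 0))"

lemma graded_basis_hom: "graded_basis B \<Longrightarrow> \<alpha> \<in> partitions_of n \<Longrightarrow> homogeneous_symmetric n (B \<alpha>)"
  unfolding graded_basis_def by blast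

lemma graded_basis_zero:
  "graded_basis B \<Longrightarrow> (\<Sum>\<alpha>\<in>partitions_of n. xscale (c \<alpha>) (B \<alpha>)) = 0 \<Longrightarrow> \<alpha> \<in> partitions_of n \<Longrightarrow> c \<alpha> = 0"
  unfolding graded_basis_def by blast

lemma partition_mem: "is_partition \<alpha> \<Longrightarrow> \<alpha> \<in> partitions_of (sum_list \<alpha>)"
  by (simp add: partitions_of_def)

lemma graded_basis_nonzero:
  assumes B: "graded_basis B" and \<alpha>: "\<alpha> \<in> partitions_of n" shows "B \<alpha> \<noteq> 0"
proof
  assume "B \<alpha> = 0"
  then have "(\<Sum>\<beta>\<in>partitions_of n. xscale (if \<beta> = \<alpha> then 1 else 0) (B \<beta>)) = 0"
    by (intro sum.neutral ballI) (auto simp: xser.scale_zero_left)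
  from graded_basis_zero[OF B this \<alpha>] show False by simp
qed

lemma homogeneous_symmetric_degree_unique:
  assumes "homogeneous_symmetric m f" "homogeneous_symmetric n f" "f \<noteq> 0" shows "m = n"
proof (rule ccontr)
  assume "m \<noteq> n"
  have "f = 0"
  proof (rule xseries_eqI)
    fix M :: "nat multiset"
    have "size M \<noteq> m \<or> size M \<noteq> n" using \<open>m \<noteq> n\<close> by auto
    then show "xcoeff f M = xcoeff 0 M"
      using assms(1,2) unfolding homogeneous_symmetric_def zero_xseries.rep_eq by blast
  qed
  with assms(3) show False by simp
qed

lemma graded_basis_inj:
  assumes B: "graded_basis B" shows "inj_on B (Collect is_partition)"
proof (rule inj_onI)
  fix \<alpha> \<beta> assume "\<alpha> \<in> Collect is_partition" "\<beta> \<in> Collect is_partition" and eq: "B \<alpha> = B \<beta>"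
  then have \<alpha>: "\<alpha> \<in> partitions_of (sum_list \<alpha>)" and \<beta>: "\<beta> \<in> partitions_of (sum_list \<beta>)"
    by (simp_all add: partitions_of_def)
  have "sum_list \<alpha> = sum_list \<beta>"
    using homogeneous_symmetric_degree_unique[OF graded_basis_hom[OF B \<alpha>] _ graded_basis_nonzero[OF B \<alpha>]]
      graded_basis_hom[OF B \<beta>] eq by simp
  then have \<beta>': "\<beta> \<in> partitions_of (sum_list \<alpha>)" using \<beta> by simp
  show "\<alpha> = \<beta>"
  proof (rule ccontr)
    assume neq: "\<alpha> \<noteq> \<beta>"
    let ?P = "partitions_of (sum_list \<alpha>)"
    let ?c = "\<lambda>\<gamma>. (if \<gamma> = \<alpha> then 1 else 0) - (if \<gamma> = \<beta> then 1 else 0) :: ratfun"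
    have "xscale (if \<gamma> = \<delta> then 1 else 0) (B \<gamma>) = (if \<gamma> = \<delta> then B \<gamma> else 0)" for \<gamma> \<delta>
      by simp
    then have "(\<Sum>\<gamma>\<in>?P. xscale (?c \<gamma>) (B \<gamma>)) = B \<alpha> - B \<beta>"
      unfolding xser.scale_left_diff_distrib sum_subtractf
      using \<alpha> \<beta>' by (simp add: sum.delta finite_partitions_of)
    then have "(\<Sum>\<gamma>\<in>?P. xscale (?c \<gamma>) (B \<gamma>)) = 0" using eq by simp
    from graded_basis_zero[OF B this \<alpha>] neq show False by simp
  qed
qed

text \<open>A linear relation can be tested on the monomials of one degree, where only finitely many basis elements contribute.\<close>

lemma graded_basis_independent:
  assumes B: "graded_basis B" shows "\<not> xser.dependent (B ` Collect is_partition)"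
proof
  assume "xser.dependent (B ` Collect is_partition)"
  then obtain T u v where T: "finite T" "T \<subseteq> B ` Collect is_partition" "(\<Sum>v\<in>T. xscale (u v) v) = 0"
    and v: "v \<in> T" "u v \<noteq> 0" unfolding xser.dependent_explicit by blast
  from v(1) T(2) obtain \<alpha> where \<alpha>: "is_partition \<alpha>" "v = B \<alpha>" by blast
  define n where "n = sum_list \<alpha>"
  have \<alpha>n: "\<alpha> \<in> partitions_of n" using \<alpha> by (simp add: partitions_of_def n_def)
  let ?c = "\<lambda>\<beta>. if B \<beta> \<in> T then u (B \<beta>) else 0"
  have inj: "inj_on B (partitions_of n)"
    by (rule inj_on_subset[OF graded_basis_inj[OF B]]) (auto simp: partitions_of_def)
  have "(\<Sum>\<beta>\<in>partitions_of n. xscale (?c \<beta>) (B \<beta>)) = 0"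
  proof (rule xseries_eqI)
    fix M :: "nat multiset"
    show "xcoeff (\<Sum>\<beta>\<in>partitions_of n. xscale (?c \<beta>) (B \<beta>)) M = xcoeff 0 M"
    proof (cases "size M = n")
      case True
      have "xcoeff (\<Sum>\<beta>\<in>partitions_of n. xscale (?c \<beta>) (B \<beta>)) M
          = (\<Sum>\<beta>\<in>partitions_of n. (\<lambda>w. if w \<in> T then u w * xcoeff w M else 0) (B \<beta>))"
        unfolding xcoeff_sum by (intro sum.cong refl) (simp add: xscale.rep_eq)
      also have "\<dots> = (\<Sum>w\<in>B ` partitions_of n. if w \<in> T then u w * xcoeff w M else 0)"
        by (simp only: sum.reindex[OF inj] comp_def)
      also have "\<dots> = (\<Sum>w\<in>T. u w * xcoeff w M)"
      proof (rule sum.mono_neutral_cong)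
        show "finite (B ` partitions_of n)" "finite T" using finite_partitions_of T(1) by simp_all
        fix w assume w: "w \<in> T - B ` partitions_of n"
        then obtain \<beta> where \<beta>: "is_partition \<beta>" "w = B \<beta>" using T(2) by blast
        then have "size M \<noteq> sum_list \<beta>" using w True by (auto simp: partitions_of_def)
        then have "xcoeff w M = 0"
          using graded_basis_hom[OF B partition_mem[OF \<beta>(1)]]
          unfolding homogeneous_symmetric_def \<beta>(2) by blast
        then show "u w * xcoeff w M = 0" by simp
      qed auto
      also have "\<dots> = xcoeff (\<Sum>w\<in>T. xscale (u w) w) M" by (simp only: xcoeff_sum xscale.rep_eq)
      finally show ?thesis unfolding T(3) .
    next
      case False
      have "xcoeff (B \<beta>) M = 0" if "\<beta> \<in> partitions_of n" for \<beta>
        using graded_basis_hom[OF B that] False unfolding homogeneous_symmetric_def by blast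
      then show ?thesis
        unfolding xcoeff_sum xscale.rep_eq zero_xseries.rep_eq by (intro sum.neutral) simp
    qed
  qed
  from graded_basis_zero[OF B this \<alpha>n] v \<alpha> show False by simp
qed

lemma coord_sum:
  assumes B: "graded_basis B" and f: "f = (\<Sum>\<alpha>\<in>partitions_of n. xscale (c \<alpha>) (B \<alpha>))"
    and \<beta>: "\<beta> \<in> partitions_of n"
  shows "coord B f \<beta> = c \<beta>"
proof -
  let ?S = "B ` Collect is_partition"
  have ind: "\<not> xser.dependent ?S" by (rule graded_basis_independent[OF B])
  have mem: "B \<alpha> \<in> ?S" if "\<alpha> \<in> partitions_of n" for \<alpha> using that by (auto simp: partitions_of_def)
  have "coord B f \<beta> = (\<Sum>\<alpha>\<in>partitions_of n. xser.representation ?S (xscale (c \<alpha>) (B \<alpha>)) (B \<beta>))"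
    unfolding coord_def f
    by (subst xser.representation_sum[OF ind]) (rule xser.span_scale[OF xser.span_base[OF mem]], auto)
  also have "\<dots> = (\<Sum>\<alpha>\<in>partitions_of n. if \<alpha> = \<beta> then c \<alpha> else 0)"
  proof (intro sum.cong refl)
    fix \<alpha> assume \<alpha>: "\<alpha> \<in> partitions_of n"
    have "B \<beta> = B \<alpha> \<longleftrightarrow> \<alpha> = \<beta>"
      using inj_on_eq_iff[OF graded_basis_inj[OF B], of \<beta> \<alpha>] \<alpha> \<beta> by (auto simp: partitions_of_def)
    then show "xser.representation ?S (xscale (c \<alpha>) (B \<alpha>)) (B \<beta>) = (if \<alpha> = \<beta> then c \<alpha> else 0)"
      by (simp only: xser.representation_scale[OF ind xser.span_base[OF mem[OF \<alpha>]]]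
          xser.representation_basis[OF ind mem[OF \<alpha>]]) simp
  qed
  also have "\<dots> = c \<beta>" using \<beta> by (simp add: finite_partitions_of)
  finally show ?thesis .
qed

lemma graded_basis_mono_sym:
  assumes d: "\<And>\<nu>. d \<nu> \<noteq> 0" shows "graded_basis (\<lambda>\<nu>. xscale (d \<nu>) (mono_sym \<nu>))"
  unfolding graded_basis_def
proof (intro conjI allI ballI impI)
  fix n \<alpha> assume "\<alpha> \<in> partitions_of n"
  then show "homogeneous_symmetric n (xscale (d \<alpha>) (mono_sym \<alpha>))"
    by (intro homogeneous_symmetric_scale homogeneous_symmetric_mono_sym)
next
  fix n c \<alpha> assume zero: "(\<Sum>\<alpha>\<in>partitions_of n. xscale (c \<alpha>) (xscale (d \<alpha>) (mono_sym \<alpha>))) = 0"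
    and \<alpha>: "\<alpha> \<in> partitions_of n"
  have "0 = xcoeff (\<Sum>\<alpha>\<in>partitions_of n. xscale (c \<alpha>) (xscale (d \<alpha>) (mono_sym \<alpha>))) (monom_of \<alpha>)"
    unfolding zero zero_xseries.rep_eq ..
  also have "\<dots> = (\<Sum>\<beta>\<in>partitions_of n. if \<beta> = \<alpha> then c \<beta> * d \<beta> else 0)"
    unfolding xcoeff_sum xscale.rep_eq
    by (intro sum.cong refl, subst xcoeff_mono_sym_monom_of) (use \<alpha> in \<open>auto simp: partitions_of_def\<close>)
  also have "\<dots> = c \<alpha> * d \<alpha>" using \<alpha> by (simp add: finite_partitions_of)
  finally show "c \<alpha> = 0" using d by simp
qed

text \<open>The big Schur functions of degree \<open>n\<close> span the monomial functions of degree \<open>n\<close>, and both families are indexed by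
the partitions of \<open>n\<close>; a spanning family of this size is independent.\<close>

lemma graded_basis_big_schur: "graded_basis big_schur"
  unfolding graded_basis_def
proof (intro conjI allI ballI impI)
  fix n \<alpha> assume "\<alpha> \<in> partitions_of n"
  then show "homogeneous_symmetric n (big_schur \<alpha>)"
    unfolding big_schur_jacobi_trudi by (rule homogeneous_symmetric_jacobi_trudi)
next
  fix n c \<alpha> assume zero: "(\<Sum>\<alpha>\<in>partitions_of n. xscale (c \<alpha>) (big_schur \<alpha>)) = 0"
    and \<alpha>: "\<alpha> \<in> partitions_of n"
  let ?P = "partitions_of n" and ?m = "mono_sym ` partitions_of n" and ?S = "big_schur ` partitions_of n"
  have m: "graded_basis mono_sym" using graded_basis_mono_sym[of "\<lambda>_. 1"] by simp
  have P: "?P \<subseteq> Collect is_partition" by (auto simp: partitions_of_def)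
  have ind_m: "\<not> xser.dependent ?m"
    by (rule xser.independent_mono[OF graded_basis_independent[OF m] image_mono[OF P]])
  have card_m: "card ?m = card ?P" by (rule card_image[OF inj_on_subset[OF graded_basis_inj[OF m] P]])
  have span: "?m \<subseteq> xser.span ?S" using mono_sym_in_schur_span by blast
  have fin: "finite ?S" by (rule finite_imageI[OF finite_partitions_of])
  have card_S: "card ?S = card ?P"
  proof (rule antisym)
    show "card ?S \<le> card ?P" by (rule card_image_le[OF finite_partitions_of])
    show "card ?P \<le> card ?S" using xser.independent_span_bound[OF fin ind_m span] card_m by simp
  qed
  then have inj: "inj_on big_schur ?P" by (rule eq_card_imp_inj_on[OF finite_partitions_of])
  have ind: "\<not> xser.dependent ?S"
  proof
    assume "xser.dependent ?S"
    then obtain b where b: "b \<in> ?S" "b \<in> xser.span (?S - {b})" unfolding xser.dependent_def by blast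
    have "?m \<subseteq> xser.span (?S - {b})" using span xser.span_redundant[of b "?S - {b}"] b
      by (simp add: insert_absorb)
    then have "card ?m \<le> card (?S - {b})"
      using xser.independent_span_bound[of "?S - {b}", OF _ ind_m] fin by simp
    then show False using card_m card_S b(1) fin by (metis card_Diff1_less not_le)
  qed
  let ?u = "\<lambda>w. c (inv_into ?P big_schur w)"
  have "(\<Sum>w\<in>?S. xscale (?u w) w) = (\<Sum>\<alpha>\<in>?P. xscale (c \<alpha>) (big_schur \<alpha>))"
    unfolding sum.reindex[OF inj] by (intro sum.cong refl) (simp add: inv_into_f_f[OF inj])
  then have "?u (big_schur \<alpha>) = 0"
    using xser.independentD[OF ind fin order_refl, of ?u "big_schur \<alpha>"] zero \<alpha> by simp
  then show "c \<alpha> = 0" by (simp add: inv_into_f_f[OF inj \<alpha>])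
qed

section \<open>Matching the two recursions\<close>

lemma hecke_trace_map:
  assumes "comm_ring_hom h" "hecke_trace q n f" shows "hecke_trace (h q) n (\<lambda>w. h (f w))"
proof -
  interpret comm_ring_hom h by fact
  have "h (q - 1) = h q - 1" by (simp add: hom_distribs)
  then show ?thesis using assms(2) unfolding hecke_trace_def by (simp add: hom_distribs)
qed

lemma hecke_trace_sum:
  assumes "\<And>\<nu>. \<nu> \<in> A \<Longrightarrow> hecke_trace q n (f \<nu>)"
  shows "hecke_trace q n (\<lambda>w. \<Sum>\<nu>\<in>A. \<alpha> \<nu> * f \<nu> w)"
  unfolding hecke_trace_def
proof (intro allI impI)
  fix w i assume wi: "w permutes {1..n}" "1 \<le> i" "i < n" "w i < w (Suc i)"
  have "(\<Sum>\<nu>\<in>A. \<alpha> \<nu> * f \<nu> (w \<circ> adj_transp i)) = (\<Sum>\<nu>\<in>A. \<alpha> \<nu> *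
      (if inv w i < inv w (Suc i) then f \<nu> (adj_transp i \<circ> w)
       else (q - 1) * f \<nu> w + q * f \<nu> (adj_transp i \<circ> w)))"
    using assms wi unfolding hecke_trace_def by (intro sum.cong refl) (simp only: simp_thms)
  then show "(\<Sum>\<nu>\<in>A. \<alpha> \<nu> * f \<nu> (w \<circ> adj_transp i)) =
      (if inv w i < inv w (Suc i) then \<Sum>\<nu>\<in>A. \<alpha> \<nu> * f \<nu> (adj_transp i \<circ> w)
       else (q - 1) * (\<Sum>\<nu>\<in>A. \<alpha> \<nu> * f \<nu> w) + q * (\<Sum>\<nu>\<in>A. \<alpha> \<nu> * f \<nu> (adj_transp i \<circ> w)))"
    by (cases "inv w i < inv w (Suc i)")
      (simp_all add: distrib_left sum.distrib sum_distrib_left mult.left_commute)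
qed

text \<open>Each step lowers the sum of the symmetrizer sizes or, for a block of size 0, their number.\<close>

lemma block_recursion_unique:
  fixes \<Gamma> \<Gamma>' :: "nat list \<Rightarrow> nat list \<Rightarrow> ratfun"
  assumes step: "\<And>\<rho> a c. 0 \<notin> set c \<Longrightarrow> sum_list \<rho> + Suc a + sum_list c = n \<Longrightarrow>
      q_int (Suc a) * \<Gamma> (\<rho> @ [Suc a]) c = (\<Sum>i\<le>a. \<Gamma> (\<rho> @ [i]) (Suc (a - i) # c))"
    and step': "\<And>\<rho> a c. 0 \<notin> set c \<Longrightarrow> sum_list \<rho> + Suc a + sum_list c = n \<Longrightarrow>
      q_int (Suc a) * \<Gamma>' (\<rho> @ [Suc a]) c = (\<Sum>i\<le>a. \<Gamma>' (\<rho> @ [i]) (Suc (a - i) # c))"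
    and zero: "\<And>\<rho> c. \<Gamma> (\<rho> @ [0]) c = \<Gamma> \<rho> c" "\<And>\<rho> c. \<Gamma>' (\<rho> @ [0]) c = \<Gamma>' \<rho> c"
    and base: "\<And>c. 0 \<notin> set c \<Longrightarrow> sum_list c = n \<Longrightarrow> \<Gamma> [] c = \<Gamma>' [] c"
    and c: "0 \<notin> set c" "sum_list \<rho> + sum_list c = n"
  shows "\<Gamma> \<rho> c = \<Gamma>' \<rho> c"
  using c
proof (induction "sum_list \<rho> + length \<rho>" arbitrary: \<rho> c rule: less_induct)
  case less
  show ?case
  proof (cases \<rho> rule: rev_cases)
    case Nil
    then show ?thesis using base less.prems by simp
  next
    case (snoc \<sigma> k)
    show ?thesis
    proof (cases k)
      case 0
      then show ?thesis using less.hyps[of \<sigma> c] less.prems by (simp add: snoc zero)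
    next
      case (Suc a)
      have "\<Gamma> (\<sigma> @ [i]) (Suc (a - i) # c) = \<Gamma>' (\<sigma> @ [i]) (Suc (a - i) # c)" if "i \<in> {..a}" for i
        using that less.prems by (intro less.hyps) (auto simp: snoc Suc)
      then have "(\<Sum>i\<le>a. \<Gamma> (\<sigma> @ [i]) (Suc (a - i) # c)) = (\<Sum>i\<le>a. \<Gamma>' (\<sigma> @ [i]) (Suc (a - i) # c))"
        by (intro sum.cong refl)
      then have "q_int (Suc a) * \<Gamma> (\<sigma> @ [Suc a]) c = q_int (Suc a) * \<Gamma>' (\<sigma> @ [Suc a]) c"
        using step[of c \<sigma> a] step'[of c \<sigma> a] less.prems by (simp add: snoc Suc)
      then show ?thesis using q_int_nonzero[of "Suc a"] by (simp add: snoc Suc)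
    qed
  qed
qed

text \<open>Read each term of the Jacobi-Trudi expansions as an exponent vector and extract the corresponding coefficient of
\<open>f\<close>. The functional does not depend on the series \<open>F\<close> that enters the determinants.\<close>

definition schur_functional :: "(nat list \<Rightarrow> ratfun) \<Rightarrow> nat \<Rightarrow> ratfun xseries \<Rightarrow> ratfun" where
  "schur_functional K n f = (\<Sum>\<beta>\<in>partitions_of n. \<Sum>p\<in>jt_perms \<beta>.
     K \<beta> * of_int (sign p) * xcoeff f (monom_of (jt_exps \<beta> p)))"

lemma schur_functional_scale: "schur_functional K n (xscale a f) = a * schur_functional K n f"
  by (simp add: schur_functional_def xscale.rep_eq sum_distrib_left mult_ac)

lemma schur_functional_sum:
  "schur_functional K n (\<Sum>i\<in>I. g i) = (\<Sum>i\<in>I. schur_functional K n (g i))"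
  unfolding schur_functional_def xcoeff_sum sum_distrib_left
  by (rule trans[OF sum.cong[OF refl sum.swap] sum.swap])

text \<open>Duality exchanges the exponents of the extracted monomial with the indices of the product.\<close>

lemma schur_functional_prod_list_coeff:
  "schur_functional K n (prod_list_coeff F c)
     = (\<Sum>\<beta>\<in>partitions_of n. K \<beta> * xcoeff (jacobi_trudi F \<beta>) (monom_of c))"
  unfolding schur_functional_def jacobi_trudi_expand xcoeff_sum xscale.rep_eq sum_distrib_left
  by (intro sum.cong refl) (simp only: prod_list_coeff_duality[of F c] mult.assoc)

text \<open>This interpolates between coefficients of the big Schur expansion (\<open>\<rho>\<close> empty) and of the Schur expansion (\<open>c\<close>
empty).\<close>

definition mixed_sum :: "(nat list \<Rightarrow> ratfun) \<Rightarrow> nat \<Rightarrow> nat list \<Rightarrow> nat list \<Rightarrow> ratfun" where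
  "mixed_sum K n \<rho> c = schur_functional K n (prod_list_coeff h_fps \<rho> * prod_list_coeff q_fps c)"

lemma mixed_sum_append_0: "mixed_sum K n (\<rho> @ [0]) c = mixed_sum K n \<rho> c"
  by (simp add: mixed_sum_def prod_list_coeff_def)

lemma mixed_sum_append_Suc:
  "(1 - t_var ^ Suc a) * mixed_sum K n (\<rho> @ [Suc a]) c
     = (\<Sum>i\<le>a. t_var ^ i * mixed_sum K n (\<rho> @ [i]) (Suc (a - i) # c))"
proof -
  let ?h = "\<lambda>i. prod_coeff h_fps (int i)" and ?q = "\<lambda>i. prod_coeff q_fps (int i)"
  let ?R = "prod_list_coeff h_fps \<rho> * prod_list_coeff q_fps c"
  have snoc: "prod_list_coeff h_fps (\<rho> @ [k]) = prod_list_coeff h_fps \<rho> * ?h k" for k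
    by (simp add: prod_list_coeff_def)
  have cons: "prod_list_coeff q_fps (k # c) = ?q k * prod_list_coeff q_fps c" for k
    by (simp add: prod_list_coeff_def)
  have "xscale (1 - t_var ^ Suc a) (prod_list_coeff h_fps (\<rho> @ [Suc a]) * prod_list_coeff q_fps c)
      = xscale (1 - t_var ^ Suc a) (?h (Suc a)) * ?R"
    by (simp only: snoc xscale_mult_left) (simp only: mult_ac)
  also have "\<dots> = (\<Sum>i\<le>a. xscale (t_var ^ i) (?h i * ?q (Suc (a - i))) * ?R)"
    unfolding h_recursion by (rule sum_distrib_right)
  also have "\<dots> = (\<Sum>i\<le>a. xscale (t_var ^ i) (prod_list_coeff h_fps (\<rho> @ [i]) * prod_list_coeff q_fps (Suc (a - i) # c)))"
    by (simp only: snoc cons xscale_mult_left) (simp only: mult_ac)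
  finally show ?thesis
    unfolding mixed_sum_def schur_functional_scale[symmetric] schur_functional_sum[symmetric] by (simp only:)
qed

lemma xcoeff_h_Ints: "xcoeff (prod_list_coeff h_fps c) M \<in> \<int>"
proof (induction c arbitrary: M)
  case Nil
  then show ?case by (simp add: prod_list_coeff_def one_xseries.rep_eq)
next
  case (Cons k c)
  have "prod_list_coeff h_fps (k # c) = prod_coeff h_fps (int k) * prod_list_coeff h_fps c"
    by (simp add: prod_list_coeff_def)
  moreover have "xcoeff (prod_coeff h_fps (int k)) A \<in> \<int>" for A
    by (simp add: xcoeff_prod_coeff fweight_def)
  ultimately show ?case
    unfolding times_xseries.rep_eq using Cons.IH by (simp add: times_xseries.rep_eq Ints_sum Ints_mult)
qed

lemma xcoeff_schur_Ints: "xcoeff (schur \<alpha>) M \<in> \<int>"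
  unfolding schur_jacobi_trudi jacobi_trudi_expand xcoeff_sum xscale.rep_eq
  by (intro Ints_sum Ints_mult Ints_of_int xcoeff_h_Ints)

lemma comm_ring_hom_Ints:
  fixes h :: "ratfun \<Rightarrow> ratfun"
  assumes "comm_ring_hom h" "x \<in> \<int>" shows "h x = x"
proof -
  interpret comm_ring_hom h by fact
  from assms(2) obtain k where "x = of_int k" by (rule Ints_cases)
  then show ?thesis by (simp add: hom_distribs)
qed

lemma homogeneous_symmetric_span:
  assumes "f \<in> xser.span (mono_sym ` partitions_of n)" shows "homogeneous_symmetric n f"
  using assms
proof (induction rule: xser.span_induct_alt)
  case base
  then show ?case by (simp add: homogeneous_symmetric_def zero_xseries.rep_eq)
next
  case (step a x y)
  then have "homogeneous_symmetric n (xscale a x)"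
    by (auto intro: homogeneous_symmetric_scale homogeneous_symmetric_mono_sym)
  then show ?case
    using step.IH unfolding homogeneous_symmetric_def plus_xseries.rep_eq by (metis add.right_neutral)
qed

text \<open>The triangularity of the Macdonald functions keeps them in one degree.\<close>

lemma macdonald_J_in_span:
  assumes P: "is_macdonald_P P" and \<mu>: "\<mu> \<in> partitions_of n"
  shows "macdonald_J P \<mu> \<in> xser.span (mono_sym ` partitions_of n)"
proof -
  let ?V = "xser.span (mono_sym ` partitions_of n)"
  let ?L = "{\<nu>. is_partition \<nu> \<and> dominates \<mu> \<nu> \<and> \<nu> \<noteq> \<mu>}"
  have "?L \<subseteq> partitions_of n" using \<mu> by (auto simp: partitions_of_def dominates_def)
  then have "xser.span (mono_sym ` ?L) \<subseteq> ?V" by (intro xser.span_mono image_mono)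
  moreover have "P \<mu> - mono_sym \<mu> \<in> xser.span (mono_sym ` ?L)"
    using P \<mu> unfolding is_macdonald_P_def partitions_of_def by blast
  ultimately have "P \<mu> - mono_sym \<mu> \<in> ?V" by blast
  moreover have "mono_sym \<mu> \<in> ?V" by (intro xser.span_base imageI \<mu>)
  ultimately have "P \<mu> - mono_sym \<mu> + mono_sym \<mu> \<in> ?V" by (rule xser.span_add)
  then show ?thesis unfolding macdonald_J_def by (intro xser.span_scale) simp
qed

lemma graded_basis_mono_sym_1: "graded_basis mono_sym"
  using graded_basis_mono_sym[of "\<lambda>_. 1"] by simp

text \<open>The coordinates in the definition of \<open>K\<close> run over all partitions; only those of \<open>n\<close> contribute.\<close>

lemma K_coeff_expand:
  assumes P: "is_macdonald_P P" and \<mu>: "\<mu> \<in> partitions_of n"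
  shows "macdonald_J P \<mu> = (\<Sum>\<beta>\<in>partitions_of n. xscale (K_coeff P \<beta> \<mu>) (big_schur \<beta>))"
proof -
  let ?J = "macdonald_J P \<mu>" and ?S = "big_schur ` partitions_of n"
  have "xser.span (mono_sym ` partitions_of n) \<subseteq> xser.span ?S"
    by (rule xser.span_minimal[OF _ xser.subspace_span]) (use mono_sym_in_schur_span in blast)
  then have "?J \<in> xser.span ?S" using macdonald_J_in_span[OF P \<mu>] by blast
  then obtain u where u: "?J = (\<Sum>v\<in>?S. xscale (u v) v)"
    unfolding xser.span_finite[OF finite_imageI[OF finite_partitions_of]] by blast
  have inj: "inj_on big_schur (partitions_of n)"
    by (rule inj_on_subset[OF graded_basis_inj[OF graded_basis_big_schur]]) (auto simp: partitions_of_def)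
  have J: "?J = (\<Sum>\<beta>\<in>partitions_of n. xscale (u (big_schur \<beta>)) (big_schur \<beta>))"
    unfolding u by (simp only: sum.reindex[OF inj] comp_def)
  have "K_coeff P \<beta> \<mu> = u (big_schur \<beta>)" if "\<beta> \<in> partitions_of n" for \<beta>
    unfolding K_coeff_def by (rule coord_sum[OF graded_basis_big_schur J that])
  then show ?thesis using J by (metis (no_types, lifting) sum.cong)
qed

lemma one_minus_t_nonzero: "1 - t_var \<noteq> 0"
  using t_var_power_nonone[of 1] by simp

lemma a_coeff_xcoeff:
  assumes P: "is_macdonald_P P" and \<mu>: "\<mu> \<in> partitions_of n" and \<nu>: "\<nu> \<in> partitions_of n"
  shows "xcoeff (macdonald_J P \<mu>) (monom_of \<nu>) = (1 - t_var) ^ length \<nu> * a_coeff P \<mu> \<nu>"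
proof -
  let ?J = "macdonald_J P \<mu>" and ?d = "\<lambda>\<nu> :: nat list. (1 - t_var) ^ length \<nu>"
  have d: "?d \<nu> \<noteq> 0" for \<nu> :: "nat list" using one_minus_t_nonzero by simp
  have "?J = (\<Sum>\<nu>\<in>partitions_of n. xscale (xcoeff ?J (monom_of \<nu>)) (mono_sym \<nu>))"
    by (rule homogeneous_symmetric_expand[OF homogeneous_symmetric_span[OF macdonald_J_in_span[OF P \<mu>]]])
  also have "\<dots> = (\<Sum>\<nu>\<in>partitions_of n. xscale (xcoeff ?J (monom_of \<nu>) / ?d \<nu>) (xscale (?d \<nu>) (mono_sym \<nu>)))"
    by (simp only: xser.scale_scale nonzero_eq_divide_eq[THEN iffD1, OF d refl])
  finally have "a_coeff P \<mu> \<nu> = xcoeff ?J (monom_of \<nu>) / ?d \<nu>"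
    unfolding a_coeff_def by (rule coord_sum[OF graded_basis_mono_sym[OF d] _ \<nu>])
  then have "a_coeff P \<mu> \<nu> * ?d \<nu> = xcoeff ?J (monom_of \<nu>)"
    by (rule nonzero_eq_divide_eq[THEN iffD1, OF d])
  then show ?thesis by (simp only: mult.commute)
qed

lemma b_coeff_xcoeff:
  assumes \<mu>: "\<mu> \<in> partitions_of n" and \<pi>: "\<pi> \<in> partitions_of n"
  shows "b_coeff P \<mu> \<pi> = t_var ^ n_stat \<mu> *
    (\<Sum>\<beta>\<in>partitions_of n. subst_qt q_var (inverse t_var) (K_coeff P \<beta> \<mu>) * xcoeff (schur \<beta>) (monom_of \<pi>))"
proof -
  let ?H = "macdonald_H P \<mu>"
  have n: "sum_list \<mu> = n" using \<mu> by (simp add: partitions_of_def)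
  have "homogeneous_symmetric n ?H"
    unfolding macdonald_H_def n schur_jacobi_trudi
    by (intro homogeneous_symmetric_sum homogeneous_symmetric_scale homogeneous_symmetric_jacobi_trudi)
  then have "?H = (\<Sum>\<nu>\<in>partitions_of n. xscale (xcoeff ?H (monom_of \<nu>)) (mono_sym \<nu>))"
    by (rule homogeneous_symmetric_expand)
  then have "b_coeff P \<mu> \<pi> = xcoeff ?H (monom_of \<pi>)"
    unfolding b_coeff_def by (rule coord_sum[OF graded_basis_mono_sym_1 _ \<pi>])
  then show ?thesis
    unfolding macdonald_H_def n xcoeff_sum xscale.rep_eq sum_distrib_left by (simp only: mult.assoc)
qed


lemma q_var_nonone: "q_var - 1 \<noteq> 0"
proof
  assume "q_var - 1 = 0"
  then have "to_fract [:[:0, 1:]:] = (to_fract 1 :: ratfun)" by (simp add: q_var_def)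
  then have "[:[:0, 1:]:] = (1 :: rat poly poly)" by (simp only: to_fract_eq_iff)
  then show False by (simp add: one_pCons)
qed

lemma q_int_geometric: "(q_var - 1) * q_int k = q_var ^ k - 1"
  unfolding q_int_def by (induction k) (simp_all add: algebra_simps)

abbreviation subst_tq :: "ratfun \<Rightarrow> ratfun" where "subst_tq \<equiv> subst_qt t_var (inverse q_var)"

text \<open>The substitution turns \<open>1 - t\<^sup>a\<close> into \<open>q\<^bsup>-a\<^esup> (q - 1) [a]\<close>; the scaling absorbs the factor \<open>q - 1\<close> into the number
of blocks and the powers of \<open>q\<close> into their total size.\<close>

lemma subst_mixed_sum_append_Suc:
  fixes K :: "nat list \<Rightarrow> ratfun" and n :: nat
  defines "\<Gamma> \<equiv> \<lambda>\<rho> c. q_var ^ sum_list c / (q_var - 1) ^ length c * subst_tq (mixed_sum K n \<rho> c)"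
  shows "q_int (Suc a) * \<Gamma> (\<rho> @ [Suc a]) c = (\<Sum>i\<le>a. \<Gamma> (\<rho> @ [i]) (Suc (a - i) # c))"
proof -
  interpret S: comm_ring_hom subst_tq by (rule hom_subst_qt[OF independent_pair_t_inverse_q])
  let ?m = "\<lambda>k c. subst_tq (mixed_sum K n (\<rho> @ [k]) c)"
  let ?q = "q_var" and ?s = "sum_list c" and ?l = "length c"
  have t: "subst_tq t_var = inverse ?q" by (rule subst_qt_vars[OF independent_pair_t_inverse_q])
  have "subst_tq ((1 - t_var ^ Suc a) * mixed_sum K n (\<rho> @ [Suc a]) c)
      = subst_tq (\<Sum>i\<le>a. t_var ^ i * mixed_sum K n (\<rho> @ [i]) (Suc (a - i) # c))"
    by (simp only: mixed_sum_append_Suc)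
  then have rec: "(1 - inverse ?q ^ Suc a) * ?m (Suc a) c = (\<Sum>i\<le>a. inverse ?q ^ i * ?m i (Suc (a - i) # c))"
    by (simp only: S.hom_mult S.hom_minus S.hom_one S.hom_power S.hom_sum t)
  have "(?q ^ Suc a - 1) * ?m (Suc a) c = ?q ^ Suc a * ((1 - inverse ?q ^ Suc a) * ?m (Suc a) c)"
    using q_var_nonzero by (simp add: right_diff_distrib left_diff_distrib power_inverse mult.assoc[symmetric] del: power_Suc)
  also have "\<dots> = (\<Sum>i\<le>a. ?q ^ Suc (a - i) * ?m i (Suc (a - i) # c))"
    unfolding rec sum_distrib_left
  proof (intro sum.cong refl)
    fix i assume "i \<in> {..a}"
    then have "?q ^ Suc a = ?q ^ Suc (a - i) * ?q ^ i" by (simp flip: power_add)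
    then have "?q ^ Suc a * inverse ?q ^ i = ?q ^ Suc (a - i)"
      using q_var_nonzero by (simp add: power_inverse del: power_Suc)
    then show "?q ^ Suc a * (inverse ?q ^ i * ?m i (Suc (a - i) # c)) = ?q ^ Suc (a - i) * ?m i (Suc (a - i) # c)"
      by (simp only: mult.assoc[symmetric])
  qed
  finally have rec': "(?q - 1) * q_int (Suc a) * ?m (Suc a) c = (\<Sum>i\<le>a. ?q ^ Suc (a - i) * ?m i (Suc (a - i) # c))"
    by (simp only: q_int_geometric)
  have cons: "\<Gamma> (\<rho> @ [i]) (k # c) = ?q ^ ?s / (?q - 1) ^ Suc ?l * (?q ^ k * ?m i (k # c))" for i k
    by (simp add: \<Gamma>_def power_add mult_ac)
  have "q_int (Suc a) * \<Gamma> (\<rho> @ [Suc a]) c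
      = ?q ^ ?s / (?q - 1) ^ Suc ?l * ((?q - 1) * q_int (Suc a) * ?m (Suc a) c)"
    using q_var_nonone by (simp add: \<Gamma>_def)
  also have "\<dots> = (\<Sum>i\<le>a. \<Gamma> (\<rho> @ [i]) (Suc (a - i) # c))"
    unfolding rec' sum_distrib_left cons ..
  finally show ?thesis .
qed

theorem theorem4p1:
  fixes n :: nat
    and \<mu> \<pi> :: "nat list"
    and P :: "nat list \<Rightarrow> ratfun xseries"
    and \<kappa> :: "nat list \<Rightarrow> (nat \<Rightarrow> nat) \<Rightarrow> rat poly"
  assumes "n > 0"
    and "\<mu> \<in> partitions_of n"
    and "\<pi> \<in> partitions_of n"
    and "is_macdonald_P P"
    and "is_expansion_matrix n \<kappa>"
  shows "(\<Sum>\<nu>\<in>partitions_of n. \<Sum>w\<in>{w. w permutes {1..n}}.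
            q_var ^ n_stat \<mu> * subst_qt t_var (inverse q_var) (a_coeff P \<mu> \<nu>)
              * q_var ^ (n - length \<nu>) * to_fract [:\<kappa> \<nu> w:]
              * contraction n w \<pi> * (1 / q_fact_part \<pi>))
         = subst_qt t_var q_var (b_coeff P \<mu> \<pi>)"
proof -
  note \<mu> = assms(2) and \<pi> = assms(3) and P = assms(4) and \<kappa> = assms(5)
  let ?q = "q_var"
  let ?J = "macdonald_J P \<mu>" and ?K = "\<lambda>\<beta>. K_coeff P \<beta> \<mu>"
  let ?\<alpha> = "\<lambda>\<nu>. ?q ^ n_stat \<mu> * subst_tq (a_coeff P \<mu> \<nu>) * ?q ^ (n - length \<nu>)"
  define f where "f w = (\<Sum>\<nu>\<in>partitions_of n. ?\<alpha> \<nu> * to_fract [:\<kappa> \<nu> w:])" for w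
  \<comment> \<open>The symmetric function counterpart of \<open>young_sum f n\<close>.\<close>
  define \<Gamma> where "\<Gamma> \<rho> c = ?q ^ n_stat \<mu> * (?q ^ sum_list c / (?q - 1) ^ length c * subst_tq (mixed_sum ?K n \<rho> c))" for \<rho> c
  interpret S: comm_ring_hom subst_tq by (rule hom_subst_qt[OF independent_pair_t_inverse_q])
  interpret W: comm_ring_hom "subst_qt t_var q_var" by (rule hom_subst_qt[OF independent_pair_t_q])

  have "hecke_trace ?q n (\<lambda>w. to_fract [:\<kappa> \<nu> w:])" if "\<nu> \<in> partitions_of n" for \<nu>
    using hecke_trace_map[OF const_poly_hom expansion_matrix_imp_hecke_trace[OF \<kappa> that]]
    by (simp only: q_var_def)
  then have trace: "hecke_trace ?q n f" unfolding f_def by (rule hecke_trace_sum)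

  have base: "young_sum f n [] c = \<Gamma> [] c" if c: "0 \<notin> set c" "sum_list c = n" for c
  proof -
    define \<nu> where "\<nu> = to_partition (mset c)"
    have \<nu>c: "mset \<nu> = mset c" by (simp add: \<nu>_def)
    have "sum_list \<nu> = n" using c(2) \<nu>c by (metis sum_mset_sum_list)
    moreover have "is_partition \<nu>" unfolding \<nu>_def using c(1) by (intro to_partition_is_partition) simp
    ultimately have \<nu>: "\<nu> \<in> partitions_of n" by (simp add: partitions_of_def)
    have len: "length \<nu> = length c" by (rule mset_eq_length[OF \<nu>c])
    have len_le: "length c \<le> n" using perm_length_coxeter_le[of c n] c by simp
    have "\<kappa> \<beta> (coxeter n c) = (if \<nu> = \<beta> then 1 else 0)" if "\<beta> \<in> partitions_of n" for \<beta>
      using \<kappa> that \<nu> coxeter_min_length[OF c \<nu>c] unfolding is_expansion_matrix_def by blast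
    then have "f (coxeter n c) = (\<Sum>\<beta>\<in>partitions_of n. if \<beta> = \<nu> then ?\<alpha> \<beta> else 0)"
      unfolding f_def by (intro sum.cong refl) (simp add: pCons_one)
    also have "\<dots> = ?\<alpha> \<nu>" using \<nu> by (simp add: finite_partitions_of)
    finally have lhs: "young_sum f n [] c = ?\<alpha> \<nu>" by (simp only: young_sum_Nil)

    \<comment> \<open>On the other side the initial value is the coefficient of \<open>x\<^sup>c\<close> in \<open>J\<^sub>\<mu>\<close>, up to the scaling factor.\<close>
    have "mixed_sum ?K n [] c = schur_functional ?K n (prod_list_coeff q_fps c)"
      by (simp add: mixed_sum_def prod_list_coeff_def)
    also have "\<dots> = xcoeff ?J (monom_of c)"
      unfolding schur_functional_prod_list_coeff big_schur_jacobi_trudi[symmetric]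
      by (subst K_coeff_expand[OF P \<mu>]) (simp only: xcoeff_sum xscale.rep_eq)
    also have "\<dots> = xcoeff ?J (monom_of \<nu>)"
    proof -
      have "0 \<notin> set \<nu>" using c(1) \<nu>c by (metis set_mset_mset)
      then have "exponents (monom_of c) = exponents (monom_of \<nu>)"
        by (simp only: exponents_monom_of[OF c(1)] exponents_monom_of[of \<nu>] \<nu>c not_False_eq_True)
      then show ?thesis
        using homogeneous_symmetric_span[OF macdonald_J_in_span[OF P \<mu>]]
        unfolding homogeneous_symmetric_def by blast
    qed
    also have "\<dots> = (1 - t_var) ^ length c * a_coeff P \<mu> \<nu>"
      unfolding a_coeff_xcoeff[OF P \<mu> \<nu>] len ..
    finally have "subst_tq (mixed_sum ?K n [] c) = (1 - inverse ?q) ^ length c * subst_tq (a_coeff P \<mu> \<nu>)"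
      by (simp only: S.hom_mult S.hom_power S.hom_minus S.hom_one subst_qt_vars[OF independent_pair_t_inverse_q])
    also have "1 - inverse ?q = (?q - 1) / ?q" using q_var_nonzero by (simp add: field_simps)
    finally have "\<Gamma> [] c = ?q ^ n_stat \<mu> * (?q ^ n / (?q - 1) ^ length c * (((?q - 1) / ?q) ^ length c * subst_tq (a_coeff P \<mu> \<nu>)))"
      unfolding \<Gamma>_def c(2) by (simp only:)
    also have "\<dots> = ?q ^ n_stat \<mu> * ((?q ^ n / ?q ^ length c) * subst_tq (a_coeff P \<mu> \<nu>))"
      using q_var_nonone by (simp add: power_divide)
    also have "?q ^ n / ?q ^ length c = ?q ^ (n - length c)"
      using power_diff[OF q_var_nonzero len_le] by simp
    finally show ?thesis unfolding lhs len by (simp only: mult_ac)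
  qed

  have "young_sum f n \<pi> [] = \<Gamma> \<pi> []"
  proof (rule block_recursion_unique[of n "young_sum f n" \<Gamma>])
    fix \<rho> a c assume "0 \<notin> set c" "sum_list \<rho> + Suc a + sum_list c = n"
    then show "q_int (Suc a) * young_sum f n (\<rho> @ [Suc a]) c = (\<Sum>i\<le>a. young_sum f n (\<rho> @ [i]) (Suc (a - i) # c))"
      by (intro young_sum_append_Suc[OF trace])
    show "q_int (Suc a) * \<Gamma> (\<rho> @ [Suc a]) c = (\<Sum>i\<le>a. \<Gamma> (\<rho> @ [i]) (Suc (a - i) # c))"
      unfolding \<Gamma>_def sum_distrib_left[symmetric] subst_mixed_sum_append_Suc[symmetric] by (simp only: mult_ac)
  next
    show "young_sum f n (\<rho> @ [0]) c = young_sum f n \<rho> c" for \<rho> c by (rule young_sum_append_0)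
    show "\<Gamma> (\<rho> @ [0]) c = \<Gamma> \<rho> c" for \<rho> c unfolding \<Gamma>_def mixed_sum_append_0 ..
  qed (use base \<pi> in \<open>auto simp: partitions_of_def\<close>)
  \<comment> \<open>Coefficients of Schur functions are integers, hence fixed by the substitution.\<close>
  also have "\<Gamma> \<pi> [] = ?q ^ n_stat \<mu> * (\<Sum>\<beta>\<in>partitions_of n. subst_tq (?K \<beta>) * xcoeff (schur \<beta>) (monom_of \<pi>))"
  proof -
    have "mixed_sum ?K n \<pi> [] = schur_functional ?K n (prod_list_coeff h_fps \<pi>)"
      by (simp add: mixed_sum_def prod_list_coeff_def)
    also have "\<dots> = (\<Sum>\<beta>\<in>partitions_of n. ?K \<beta> * xcoeff (schur \<beta>) (monom_of \<pi>))"
      unfolding schur_functional_prod_list_coeff schur_jacobi_trudi ..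
    finally show ?thesis
      unfolding \<Gamma>_def
      by (simp add: S.hom_sum S.hom_mult comm_ring_hom_Ints[OF hom_subst_qt[OF independent_pair_t_inverse_q] xcoeff_schur_Ints])
  qed
  also have "\<dots> = subst_qt t_var q_var (b_coeff P \<mu> \<pi>)"
    unfolding b_coeff_xcoeff[OF \<mu> \<pi>]
    by (simp only: W.hom_mult W.hom_power W.hom_sum subst_qt_vars[OF independent_pair_t_q] subst_qt_compose
        comm_ring_hom_Ints[OF hom_subst_qt[OF independent_pair_t_q] xcoeff_schur_Ints])
  finally have main: "young_sum f n \<pi> [] = subst_qt t_var q_var (b_coeff P \<mu> \<pi>)" .

  \<comment> \<open>It remains to write the left-hand side as a sum over the Young subgroup.\<close>
  have Y: "young_subgroup n \<pi> \<subseteq> {w. w permutes {1..n}}" using young_subgroup_permutes by blast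
  have "(\<Sum>\<nu>\<in>partitions_of n. \<Sum>w\<in>{w. w permutes {1..n}}.
      ?\<alpha> \<nu> * to_fract [:\<kappa> \<nu> w:] * contraction n w \<pi> * (1 / q_fact_part \<pi>))
      = (\<Sum>w\<in>{w. w permutes {1..n}}. f w * contraction n w \<pi> * (1 / q_fact_part \<pi>))"
    unfolding f_def sum_distrib_right by (rule sum.swap)
  also have "\<dots> = (\<Sum>w\<in>young_subgroup n \<pi>. f w * (1 / q_fact_part \<pi>))"
    by (rule sum.mono_neutral_cong_right[OF finite_permutations Y]) (auto simp: contraction_def)
  also have "\<dots> = young_sum f n \<pi> []"
    using \<pi> by (simp add: young_sum_def partitions_of_def sum_divide_distrib)
  finally show ?thesis unfolding main .
qed

end
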